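(* Let $k$ be a field, let $G$ be a finite simple graph with vertex set $[n]=\{1,\dots,n\}$, and let $k[\mathcal{Q}_G]$ be the toric ring associated with the stable set polytope $\mathcal{Q}_G$ of $G$. Then the following assertions are equivalent: (1) $k[\mathcal{Q}_G]$ is strongly Koszul; (2) $G$ is a trivially perfect graph. In particular, if $k[\mathcal{Q}_G]$ is strongly Koszul, then $k[\mathcal{Q}_G]$ is trivial.
   Context: A subset $S\subseteq [n]$ is stable in $G$ if no two elements of $S$ are joined by an edge; $\emptyset$ is stable. For a stable set $S$ put $\rho(S)=\sum_{i\in S}\mathbf{e}_i\in\mathbb{R}^n$. The stable set polytope $\mathcal{Q}_G$ is the convex hull of all $\rho(S)$, $S$ stable; its vertices are exactly the points $\rho(S)$. The toric ring is the $k$-subalgebra $k[\mathcal{Q}_G]=k[\,T\cdot X_1^{a_1}\cdots X_n^{a_n} \mid (a_1,\dots,a_n)\text{ a vertex of }\mathcal{Q}_G]$ of the polynomial ring $k[T,X_1,\dots,X_n]$, graded so that each of these generators has degree $1$. Strongly Koszul: a graded $k$-algebra $R$ with homogeneous maximal ideal $\mathfrak{m}=R_+$ is strongly Koszul with respect to a minimal system of homogeneous generators $u_1,\dots,u_t$ of $\mathfrak{m}$ if for every choice of indices $i_1<\cdots<i_r$ and every $j=1,\dots,r$ the colon ideal $(u_{i_1},\dots,u_{i_{j-1}}):u_{i_j}$ is generated by a subset (possibly empty) of $\{u_1,\dots,u_t\}$. For the toric ring $k[\mathcal{Q}_G]$, strong Koszulness is understood with respect to its monomial generators $T\cdot X_1^{a_1}\cdots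 X_n^{a_n}$. Trivially perfect: for a graph $H$, let $\alpha(H)$ be the maximum cardinality of a stable set of $H$ and $m(H)$ the number of (inclusion-)maximal cliques of $H$. The graph $G$ is trivially perfect if $\alpha(G_W)=m(G_W)$ for every induced subgraph $G_W$ of $G$ (on a nonempty vertex subset $W$). Trivial ring: a graded $k$-algebra is trivial if it can be constructed (up to isomorphism) by starting from (standard graded) polynomial rings over $k$ and repeatedly applying tensor products $A\otimes_k B$ and Segre products $\bigoplus_{d\ge 0}A_d\otimes_k B_d$. *)

theory Defs
  imports
    "HOL-Library.Poly_Mapping"
    "HOL-Analysis.Analysis"
    "HOL-Algebra.Module"
    "HOL-Algebra.QuotRing"
    "HOL-Algebra.Generated_Rings"
begin

section \<open>Finite simple graphs\<close>

text \<open>A graph is a pair of its vertex set and its set of edges, an edge being a set of two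
  distinct vertices.\<close>

type_synonym 'v sgraph = "'v set \<times> 'v set set"

abbreviation vertices :: "'v sgraph \<Rightarrow> 'v set" where "vertices \<equiv> fst"
abbreviation edges :: "'v sgraph \<Rightarrow> 'v set set" where "edges \<equiv> snd"

definition finite_simple_graph :: "'v sgraph \<Rightarrow> bool" where
  "finite_simple_graph G \<longleftrightarrow>
     finite (vertices G) \<and> (\<forall>e\<in>edges G. e \<subseteq> vertices G \<and> card e = 2)"

definition stable :: "'v sgraph \<Rightarrow> 'v set \<Rightarrow> bool" where
  "stable G S \<longleftrightarrow> S \<subseteq> vertices G \<and> (\<forall>i\<in>S. \<forall>j\<in>S. {i, j} \<notin> edges G)"

definition clique :: "'v sgraph \<Rightarrow> 'v set \<Rightarrow> bool" where
  "clique G C \<longleftrightarrow> C \<subseteq> vertices G \<and> (\<forall>i\<in>C. \<forall>j\<in>C. i \<noteq> j \<longrightarrow> {i, j} \<in> edges G)"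

definition maximal_clique :: "'v sgraph \<Rightarrow> 'v set \<Rightarrow> bool" where
  "maximal_clique G C \<longleftrightarrow> clique G C \<and> (\<forall>D. clique G D \<and> C \<subseteq> D \<longrightarrow> D = C)"

definition induced :: "'v sgraph \<Rightarrow> 'v set \<Rightarrow> 'v sgraph" where
  "induced G W = (W, {e \<in> edges G. e \<subseteq> W})"

definition stability_number :: "'v sgraph \<Rightarrow> nat" where
  "stability_number G = Max (card ` {S. stable G S})"

definition num_maximal_cliques :: "'v sgraph \<Rightarrow> nat" where
  "num_maximal_cliques G = card {C. maximal_clique G C}"

definition trivially_perfect :: "'v sgraph \<Rightarrow> bool" where
  "trivially_perfect G \<longleftrightarrow>
     (\<forall>W. W \<subseteq> vertices G \<and> W \<noteq> {} \<longrightarrow>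
        stability_number (induced G W) = num_maximal_cliques (induced G W))"


section \<open>Graded algebras over a field\<close>

text \<open>The scalars form a type of class \<open>field\<close>; \<open>scalars\<close> presents them as a ring in the sense
  of HOL-Algebra.\<close>

definition scalars :: "'k::field ring" where
  "scalars = \<lparr>carrier = UNIV, mult = (*), one = 1, ring.zero = 0, add = (+)\<rparr>"

record ('k, 'a) galg = "('k, 'a) module" +
  hpart :: "nat \<Rightarrow> 'a set"

text \<open>Commutative \<open>\<nat>\<close>-graded algebras \<open>A = A\<^sub>0 \<oplus> A\<^sub>1 \<oplus> \<dots>\<close> with \<open>A\<^sub>0 = k\<close>, so that \<open>A\<^sub>+\<close> is a maximal
  ideal.\<close>

locale graded_algebra =
  Module.algebra "scalars :: 'k::field ring" A for A :: "('k::field, 'a, 'm) galg_scheme" (structure) +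
  assumes hpart_submodule: "submodule (hpart A d) (scalars :: 'k::field ring) A"
    and hpart_mult:
      "\<lbrakk>x \<in> hpart A d; y \<in> hpart A e\<rbrakk> \<Longrightarrow> x \<otimes>\<^bsub>A\<^esub> y \<in> hpart A (d + e)"
    and hpart_direct_sum:
      "x \<in> carrier A \<Longrightarrow>
        \<exists>!f. (\<forall>d. f d \<in> hpart A d) \<and> finite {d. f d \<noteq> \<zero>\<^bsub>A\<^esub>} \<and>
             x = (\<Oplus>\<^bsub>A\<^esub>d\<in>{d. f d \<noteq> \<zero>\<^bsub>A\<^esub>}. f d)"
    and hpart_0: "hpart A 0 = {c \<odot>\<^bsub>A\<^esub> \<one>\<^bsub>A\<^esub> |c. True}"
    and one_not_zero: "\<one>\<^bsub>A\<^esub> \<noteq> \<zero>\<^bsub>A\<^esub>"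

definition irrelevant_ideal :: "('k, 'a, 'm) galg_scheme \<Rightarrow> 'a set" where
  "irrelevant_ideal A = generate (add_monoid A) (\<Union>d\<in>{1..}. hpart A d)"

definition galg_iso ::
    "('k, 'a, 'm) galg_scheme \<Rightarrow> ('k, 'b, 'n) galg_scheme \<Rightarrow> bool" (infix \<open>\<cong>\<^sub>g\<close> 50) where
  "A \<cong>\<^sub>g B \<longleftrightarrow>
     (\<exists>f \<in> ring_iso A B.
        (\<forall>c. \<forall>x\<in>carrier A. f (c \<odot>\<^bsub>A\<^esub> x) = c \<odot>\<^bsub>B\<^esub> f x) \<and>
        (\<forall>d. f ` hpart A d = hpart B d))"


section \<open>Strongly Koszul algebras\<close>

definition colon_ideal :: "('a, 'm) ring_scheme \<Rightarrow> 'a set \<Rightarrow> 'a \<Rightarrow> 'a set" where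
  "colon_ideal R I u = {x \<in> carrier R. x \<otimes>\<^bsub>R\<^esub> u \<in> I}"

definition minimal_homogeneous_generators ::
    "('k, 'a, 'm) galg_scheme \<Rightarrow> 'a list \<Rightarrow> bool" where
  "minimal_homogeneous_generators A us \<longleftrightarrow>
     (\<forall>u\<in>set us. \<exists>d. u \<in> hpart A d) \<and>
     Idl\<^bsub>A\<^esub> (set us) = irrelevant_ideal A \<and>
     (\<forall>i<length us.
        Idl\<^bsub>A\<^esub> {us ! j |j. j < length us \<and> j \<noteq> i} \<noteq> irrelevant_ideal A)"

text \<open>The list \<open>us\<close> is \<open>u\<^sub>1, \<dots>, u\<^sub>t\<close>, and \<open>ix\<close> is a sequence of indices \<open>i\<^sub>1 < \<dots> < i\<^sub>r\<close>; both are
  numbered from 0. Only a list carries the order of indices used here; a set of generators with no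
  preferred order is to be enumerated by an arbitrary list without repetitions.\<close>

definition strongly_koszul ::
    "('k::field, 'a, 'm) galg_scheme \<Rightarrow> 'a list \<Rightarrow> bool" where
  "strongly_koszul A us \<longleftrightarrow>
     graded_algebra A \<and>
     minimal_homogeneous_generators A us \<and>
     (\<forall>ix. sorted_wrt (<) ix \<and> set ix \<subseteq> {..<length us} \<longrightarrow>
        (\<forall>j<length ix. \<exists>S\<subseteq>set us.
           colon_ideal A (Idl\<^bsub>A\<^esub> {us ! (ix ! l) |l. l < j}) (us ! (ix ! j)) = Idl\<^bsub>A\<^esub> S))"


section \<open>Polynomial rings, tensor products and Segre products\<close>

text \<open>A polynomial in variables from \<open>'v\<close> is a finitely supported function on the exponent vectors
  \<open>'v \<Rightarrow>\<^sub>0 nat\<close>; its product is the convolution already provided for \<open>poly_mapping\<close>.\<close>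

type_synonym ('v, 'k) mpoly = "('v \<Rightarrow>\<^sub>0 nat) \<Rightarrow>\<^sub>0 'k"

definition poly_ring :: "'v set \<Rightarrow> ('k::field, ('v, 'k) mpoly) galg" where
  "poly_ring V =
     \<lparr>carrier = {p. \<forall>m\<in>Poly_Mapping.keys p. Poly_Mapping.keys m \<subseteq> V},
      mult = (*), one = 1, ring.zero = 0, add = (+),
      smult = (\<lambda>c p. Poly_Mapping.single 0 c * p),
      hpart = (\<lambda>d. {p. \<forall>m\<in>Poly_Mapping.keys p. Poly_Mapping.keys m \<subseteq> V \<and>
                         (\<Sum>v\<in>Poly_Mapping.keys m. Poly_Mapping.lookup m v) = d})\<rparr>"

text \<open>The free vector space on \<open>A \<times> B\<close>, with the multiplication that makes it the monoid algebra
  of the product of the multiplicative monoids of \<open>A\<close> and \<open>B\<close>.\<close>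

definition pair_algebra ::
    "('k::field, 'a, 'm) galg_scheme \<Rightarrow> ('k, 'b, 'n) galg_scheme \<Rightarrow> (('a \<times> 'b) \<Rightarrow>\<^sub>0 'k) ring" where
  "pair_algebra A B =
     \<lparr>carrier = {f. Poly_Mapping.keys f \<subseteq> carrier A \<times> carrier B},
      mult = (\<lambda>f g. \<Sum>(a, b)\<in>Poly_Mapping.keys f. \<Sum>(a', b')\<in>Poly_Mapping.keys g.
                Poly_Mapping.single (a \<otimes>\<^bsub>A\<^esub> a', b \<otimes>\<^bsub>B\<^esub> b')
                  (Poly_Mapping.lookup f (a, b) * Poly_Mapping.lookup g (a', b'))),
      one = Poly_Mapping.single (\<one>\<^bsub>A\<^esub>, \<one>\<^bsub>B\<^esub>) 1,
      ring.zero = 0, add = (+)\<rparr>"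

definition bilinear_relations ::
    "('k::field, 'a, 'm) galg_scheme \<Rightarrow> ('k, 'b, 'n) galg_scheme \<Rightarrow> (('a \<times> 'b) \<Rightarrow>\<^sub>0 'k) set" where
  "bilinear_relations A B =
     {Poly_Mapping.single (a \<oplus>\<^bsub>A\<^esub> a', b) 1 - Poly_Mapping.single (a, b) 1
        - Poly_Mapping.single (a', b) 1
        |a a' b. a \<in> carrier A \<and> a' \<in> carrier A \<and> b \<in> carrier B} \<union>
     {Poly_Mapping.single (a, b \<oplus>\<^bsub>B\<^esub> b') 1 - Poly_Mapping.single (a, b) 1
        - Poly_Mapping.single (a, b') 1
        |a b b'. a \<in> carrier A \<and> b \<in> carrier B \<and> b' \<in> carrier B} \<union>
     {Poly_Mapping.single (c \<odot>\<^bsub>A\<^esub> a, b) 1 - Poly_Mapping.single (a, b) c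
        |c a b. a \<in> carrier A \<and> b \<in> carrier B} \<union>
     {Poly_Mapping.single (a, c \<odot>\<^bsub>B\<^esub> b) 1 - Poly_Mapping.single (a, b) c
        |c a b. a \<in> carrier A \<and> b \<in> carrier B}"

text \<open>The linear span of the bilinearity relations is stable under multiplication by pairs, hence it
  is the ideal they generate, and the tensor product is the quotient by that ideal.\<close>

definition tensor_ideal ::
    "('k::field, 'a, 'm) galg_scheme \<Rightarrow> ('k, 'b, 'n) galg_scheme \<Rightarrow> (('a \<times> 'b) \<Rightarrow>\<^sub>0 'k) set" where
  "tensor_ideal A B = Idl\<^bsub>pair_algebra A B\<^esub> (bilinear_relations A B)"

definition tensor_ring ::
    "('k::field, 'a, 'm) galg_scheme \<Rightarrow> ('k, 'b, 'n) galg_scheme \<Rightarrow> (('a \<times> 'b) \<Rightarrow>\<^sub>0 'k) set ring" where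
  "tensor_ring A B = pair_algebra A B Quot tensor_ideal A B"

definition pure_tensor ::
    "('k::field, 'a, 'm) galg_scheme \<Rightarrow> ('k, 'b, 'n) galg_scheme \<Rightarrow> 'a \<Rightarrow> 'b
      \<Rightarrow> (('a \<times> 'b) \<Rightarrow>\<^sub>0 'k) set" where
  "pure_tensor A B a b =
     tensor_ideal A B +>\<^bsub>pair_algebra A B\<^esub> Poly_Mapping.single (a, b) 1"

definition tensor_part ::
    "('k::field, 'a, 'm) galg_scheme \<Rightarrow> ('k, 'b, 'n) galg_scheme \<Rightarrow> (nat \<times> nat) set
      \<Rightarrow> (('a \<times> 'b) \<Rightarrow>\<^sub>0 'k) set set" where
  \<comment> \<open>the sum of the subspaces \<open>A\<^sub>i \<otimes> B\<^sub>j\<close> over the pairs \<open>(i, j) \<in> D\<close>; the pure tensors with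
      factors in \<open>A\<^sub>i\<close> and \<open>B\<^sub>j\<close> are closed under scalars, so sums suffice\<close>
  "tensor_part A B D =
     generate (add_monoid (tensor_ring A B))
       {pure_tensor A B a b |a b i j. (i, j) \<in> D \<and> a \<in> hpart A i \<and> b \<in> hpart B j}"

definition tensor_product ::
    "('k::field, 'a, 'm) galg_scheme \<Rightarrow> ('k, 'b, 'n) galg_scheme
      \<Rightarrow> ('k, (('a \<times> 'b) \<Rightarrow>\<^sub>0 'k) set) galg" where
  "tensor_product A B =
     \<lparr>carrier = carrier (tensor_ring A B), mult = mult (tensor_ring A B),
      one = \<one>\<^bsub>tensor_ring A B\<^esub>, ring.zero = \<zero>\<^bsub>tensor_ring A B\<^esub>, add = add (tensor_ring A B),
      smult = (\<lambda>c Y. \<Union>x\<in>Y. tensor_ideal A B +>\<^bsub>pair_algebra A B\<^esub> Poly_Mapping.map ((*) c) x),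
      hpart = (\<lambda>d. tensor_part A B {(i, j). i + j = d})\<rparr>"

definition segre_product ::
    "('k::field, 'a, 'm) galg_scheme \<Rightarrow> ('k, 'b, 'n) galg_scheme
      \<Rightarrow> ('k, (('a \<times> 'b) \<Rightarrow>\<^sub>0 'k) set) galg" where
  "segre_product A B =
     (tensor_product A B)
       \<lparr>carrier := tensor_part A B {(i, j). i = j},
        hpart := (\<lambda>d. tensor_part A B {(d, d)})\<rparr>"


section \<open>Trivial rings\<close>

text \<open>All intermediate algebras of a construction have to live on one type. Every algebra that
  arises has countable dimension over \<open>k\<close>, and the type \<open>(nat, 'k) mpoly\<close> is a \<open>k\<close>-vector space
  of countably infinite dimension, so it contains the carrier of an isomorphic copy of each of
  them. The structure on a carrier is arbitrary: it need not be the one of polynomials.\<close>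

inductive constructible :: "('k::field, (nat, 'k) mpoly) galg \<Rightarrow> bool" where
  polynomial: "\<lbrakk>graded_algebra C; C \<cong>\<^sub>g (poly_ring {..<n} :: ('k, (nat, 'k) mpoly) galg)\<rbrakk>
    \<Longrightarrow> constructible C"
| tensor: "\<lbrakk>constructible A; constructible B; graded_algebra C; C \<cong>\<^sub>g tensor_product A B\<rbrakk>
    \<Longrightarrow> constructible C"
| segre: "\<lbrakk>constructible A; constructible B; graded_algebra C; C \<cong>\<^sub>g segre_product A B\<rbrakk>
    \<Longrightarrow> constructible C"

definition trivial_algebra :: "('k::field, 'a, 'm) galg_scheme \<Rightarrow> bool" where
  "trivial_algebra A \<longleftrightarrow>
     graded_algebra A \<and> (\<exists>C :: ('k, (nat, 'k) mpoly) galg. constructible C \<and> A \<cong>\<^sub>g C)"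


section \<open>The toric ring of the stable set polytope\<close>

text \<open>The vertex set \<open>[n]\<close> is \<open>UNIV :: 'n set\<close> for a finite type \<open>'n\<close>.\<close>

definition rho :: "'n::finite set \<Rightarrow> real ^ 'n" where
  "rho S = (\<Sum>i\<in>S. axis i 1)"

definition stable_set_polytope :: "'n::finite sgraph \<Rightarrow> (real ^ 'n) set" where
  "stable_set_polytope G = convex hull (rho ` {S. stable G S})"

text \<open>The variables of \<open>k[T, X\<^sub>1, \<dots>, X\<^sub>n]\<close> are indexed by \<open>'n option\<close>: \<open>None\<close> stands for \<open>T\<close> and
  \<open>Some i\<close> for \<open>X\<^sub>i\<close>.\<close>

definition toric_generators :: "'n::finite sgraph \<Rightarrow> ('n option, 'k::field) mpoly set" where
  "toric_generators G =
     {Poly_Mapping.single m 1 |m. Poly_Mapping.lookup m None = 1 \<and>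
        (\<chi> i. real (Poly_Mapping.lookup m (Some i))) extreme_point_of stable_set_polytope G}"

definition toric_carrier :: "'n::finite sgraph \<Rightarrow> ('n option, 'k::field) mpoly set" where
  "toric_carrier G =
     generate_ring (poly_ring UNIV) ({Poly_Mapping.single 0 c |c. True} \<union> toric_generators G)"

text \<open>Each generator has exponent 1 in \<open>T\<close>, so the grading in which the generators have degree 1 is
  the one by the exponent of \<open>T\<close>.\<close>

definition toric_ring :: "'n::finite sgraph \<Rightarrow> ('k::field, ('n option, 'k) mpoly) galg" where
  "toric_ring G =
     (poly_ring UNIV)
       \<lparr>carrier := toric_carrier G,
        hpart := (\<lambda>d. {p \<in> toric_carrier G.
                   \<forall>m\<in>Poly_Mapping.keys p. Poly_Mapping.lookup m None = d})\<rparr>"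

end

theory Submission
  imports Defs
begin

text \<open>
The toric ring \<open>k[Q\<^sub>G]\<close> is the algebra of the monoid generated by the exponent vectors
\<open>T + \<Sum>i\<in>S. X\<^sub>i\<close> of the stable sets \<open>S\<close> of \<open>G\<close> (\<open>toric_ring_eq\<close>), and the theorem is a statement about
this graded monoid.  In a monoid algebra the ideals involved are spanned by monomials, so strong
Koszulness becomes a divisibility condition on the monoid (\<open>strongly_koszul_monoid_algebra\<close>): if \<open>u\<close>
and \<open>v\<close> are generators and \<open>u\<close> divides \<open>v w\<close> with \<open>w \<noteq> 1\<close>, then some factor \<open>s\<close> of \<open>w\<close> of degree 1
satisfies \<open>u | v s\<close>.

The link to graphs is an obstruction: vertices \<open>a\<close>, \<open>b\<close>, \<open>c\<close>, \<open>d\<close> with edges \<open>ab\<close>, \<open>bc\<close>, \<open>cd\<close> and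
non-edges \<open>ac\<close>, \<open>bd\<close>, that is, an induced path or cycle on four vertices.  A graph is trivially
perfect if and only if it has none (\<open>trivially_perfect_if_no_obstruction\<close>,
\<open>no_obstruction_if_trivially_perfect\<close>).  An obstruction yields explicit monomials that
violate the divisibility condition (\<open>no_obstruction_if_koszul\<close>); they involve only stable sets
within the four vertices, and so do all their factors, which is why the rest of the graph does not
interfere.

Conversely, without an obstruction the neighbourhoods of adjacent vertices are nested, so each induced
subgraph is empty, has a universal vertex or is disconnected (\<open>universal_or_disconnected\<close>).  A
universal vertex adds a free variable to the monoid, and a disconnected graph gives the fibre
product, over the degree, of the monoids of its parts.  On algebras these are tensor products with a
polynomial ring in one variable and Segre products (\<open>monoid_algebra_tensor\<close>,
\<open>monoid_algebra_segre\<close>).  The divisibility condition is inherited by products and fibre products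
(\<open>koszul_monoid_product\<close>, \<open>koszul_monoid_fibre_product\<close>).  One induction over the vertex set
(\<open>stable_monoid_trivial\<close>) therefore shows both that the ring is strongly Koszul and that it is
trivial.
\<close>

section \<open>Linear maps between free vector spaces\<close>

abbreviation "keys \<equiv> Poly_Mapping.keys"
abbreviation "lookup \<equiv> Poly_Mapping.lookup"
abbreviation "single \<equiv> Poly_Mapping.single"

definition scale :: "'k::field \<Rightarrow> ('m \<Rightarrow>\<^sub>0 'k) \<Rightarrow> 'm \<Rightarrow>\<^sub>0 'k" where
  "scale c p = Poly_Mapping.map ((*) c) p"

lemma lookup_scale [simp]: "lookup (scale c p) m = c * lookup p m"
  by (simp add: scale_def Poly_Mapping.map.rep_eq when_def)

lemma scale_simps [simp]:
  "scale c 0 = 0" "scale 0 p = 0" "scale 1 p = p"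
  "scale c (p + q) = scale c p + scale c q"
  "scale (c + d) p = scale c p + scale d p"
  "scale c (scale d p) = scale (c * d) p"
  "scale c (single m d) = single m (c * d)"
  by (auto intro!: poly_mapping_eqI simp: lookup_add lookup_single when_def algebra_simps)

lemma scale_conv_mult: "scale c p = single 0 c * p"
  by (simp add: scale_def mult_map_scale_conv_mult)

lemma scale_uminus: "scale (- 1) p = - p"
  by (rule poly_mapping_eqI) simp

lemma scale_mult:
  fixes p :: "'m::comm_monoid_add \<Rightarrow>\<^sub>0 'k::field"
  shows "scale c p * q = scale c (p * q)" "p * scale c q = scale c (p * q)"
  by (simp_all only: scale_conv_mult mult.assoc mult.left_commute)

lemma scale_sum: "scale c (\<Sum>i\<in>I. f i) = (\<Sum>i\<in>I. scale c (f i))"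
  by (induct I rule: infinite_finite_induct) auto

lemma keys_scale: "keys (scale c p) \<subseteq> keys p"
  by (auto simp: in_keys_iff)

definition linear_extension :: "('m \<Rightarrow> ('b \<Rightarrow>\<^sub>0 'k)) \<Rightarrow> ('m \<Rightarrow>\<^sub>0 'k::field) \<Rightarrow> 'b \<Rightarrow>\<^sub>0 'k" where
  "linear_extension \<phi> p = (\<Sum>m\<in>keys p. scale (lookup p m) (\<phi> m))"

lemma linear_extension_superset:
  assumes "finite S" "keys p \<subseteq> S"
  shows "linear_extension \<phi> p = (\<Sum>m\<in>S. scale (lookup p m) (\<phi> m))"
  unfolding linear_extension_def
  by (rule sum.mono_neutral_left) (use assms in \<open>auto simp: in_keys_iff\<close>)

lemma linear_extension_0 [simp]: "linear_extension \<phi> 0 = 0"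
  by (simp add: linear_extension_def)

lemma linear_extension_single [simp]: "linear_extension \<phi> (single m c) = scale c (\<phi> m)"
  by (simp add: linear_extension_def)

lemma linear_extension_add: "linear_extension \<phi> (p + q) = linear_extension \<phi> p + linear_extension \<phi> q"
proof -
  let ?S = "keys p \<union> keys q"
  have "linear_extension \<phi> (p + q) = (\<Sum>m\<in>?S. scale (lookup (p + q) m) (\<phi> m))"
    by (rule linear_extension_superset) (auto simp: in_keys_iff lookup_add)
  also have "\<dots> = linear_extension \<phi> p + linear_extension \<phi> q"
    by (simp add: lookup_add sum.distrib linear_extension_superset[of ?S])
  finally show ?thesis .
qed

lemma linear_extension_scale: "linear_extension \<phi> (scale c p) = scale c (linear_extension \<phi> p)"
proof -
  have "linear_extension \<phi> (scale c p) = (\<Sum>m\<in>keys p. scale (lookup (scale c p) m) (\<phi> m))"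
    by (rule linear_extension_superset) (auto simp: in_keys_iff)
  then show ?thesis by (simp add: linear_extension_def scale_sum)
qed

lemma linear_extension_uminus: "linear_extension \<phi> (- p) = - linear_extension \<phi> p"
  using linear_extension_scale[of \<phi> "-1" p] by (simp add: scale_uminus)

lemma linear_extension_diff: "linear_extension \<phi> (p - q) = linear_extension \<phi> p - linear_extension \<phi> q"
  using linear_extension_add[of \<phi> p "- q"] by (simp add: linear_extension_uminus)

lemma linear_extension_add_fun: "linear_extension (\<lambda>m. \<phi> m + \<psi> m) p = linear_extension \<phi> p + linear_extension \<psi> p"
  by (simp add: linear_extension_def sum.distrib)

lemma linear_extension_scale_fun: "linear_extension (\<lambda>m. scale c (\<phi> m)) p = scale c (linear_extension \<phi> p)"
  by (simp add: linear_extension_def scale_sum mult.commute)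

lemma keys_linear_extension: "keys (linear_extension \<phi> p) \<subseteq> (\<Union>m\<in>keys p. keys (\<phi> m))"
proof -
  have "keys (linear_extension \<phi> p) \<subseteq> (\<Union>m\<in>keys p. keys (scale (lookup p m) (\<phi> m)))"
    unfolding linear_extension_def by (rule keys_sum)
  then show ?thesis using keys_scale by fastforce
qed

lemma linear_extension_ident: "linear_extension (\<lambda>m. single m 1) p = p"
proof (rule poly_mapping_eqI)
  fix k
  have "lookup (linear_extension (\<lambda>m. single m 1) p) k = (\<Sum>m\<in>keys p. if m = k then lookup p k else 0)"
    by (auto simp: linear_extension_def lookup_sum lookup_single when_def intro!: sum.cong)
  then show "lookup (linear_extension (\<lambda>m. single m 1) p) k = lookup p k"
    by (simp add: in_keys_iff)
qed

lemma keys_add_subset: "keys p \<subseteq> S \<Longrightarrow> keys q \<subseteq> S \<Longrightarrow> keys (p + q) \<subseteq> S"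
  using keys_add[of p q] by blast

text \<open>Every vector is a sum of multiples of basis vectors, so an identity between expressions that are
additive in each argument need only be checked on basis vectors.  The multiplicativity and
associativity laws below are all obtained this way.\<close>
lemma poly_mapping_induct_on [consumes 1, case_names zero single add]:
  fixes p :: "'m \<Rightarrow>\<^sub>0 'k::field"
  assumes "keys p \<subseteq> S"
    and "P 0"
    and single: "\<And>m c. m \<in> S \<Longrightarrow> P (single m c)"
    and add: "\<And>p q. keys p \<subseteq> S \<Longrightarrow> keys q \<subseteq> S \<Longrightarrow> P p \<Longrightarrow> P q \<Longrightarrow> P (p + q)"
  shows "P p"
proof -
  have "keys (\<Sum>m\<in>A. single m (lookup p m)) \<subseteq> S \<and> P (\<Sum>m\<in>A. single m (lookup p m))"
    if "finite A" "A \<subseteq> S" for A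
    using that
  proof (induct A rule: finite_induct)
    case (insert m A)
    have "keys (single m (lookup p m)) \<subseteq> S" using insert(4) by auto
    then show ?case
      using insert add[of "single m (lookup p m)"] single[of m] by (simp add: keys_add_subset)
  qed (simp add: assms(2))
  moreover have "(\<Sum>m\<in>keys p. single m (lookup p m)) = p"
    using linear_extension_ident[of p] by (simp add: linear_extension_def)
  ultimately show ?thesis using assms(1) finite_keys[of p] by metis
qed

section \<open>Graded monoids and their algebras\<close>

text \<open>These are the conditions under which the monoid algebra is a standard graded algebra whose part of
degree 0 is the field.  Cancellation makes multiplication by a monomial injective on monomials, so
that a colon ideal of monomial ideals is again spanned by monomials.\<close>
locale standard_graded_monoid =
  fixes M :: "'m::cancel_comm_monoid_add set" and dg :: "'m \<Rightarrow> nat"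
  assumes zero_mem: "0 \<in> M"
    and add_mem: "\<lbrakk>a \<in> M; b \<in> M\<rbrakk> \<Longrightarrow> a + b \<in> M"
    and deg_add: "\<lbrakk>a \<in> M; b \<in> M\<rbrakk> \<Longrightarrow> dg (a + b) = dg a + dg b"
    and deg_eq_0: "\<lbrakk>a \<in> M; dg a = 0\<rbrakk> \<Longrightarrow> a = 0"
    and split_deg_1: "\<lbrakk>a \<in> M; a \<noteq> 0\<rbrakk> \<Longrightarrow> \<exists>s\<in>M. \<exists>r\<in>M. dg s = 1 \<and> a = s + r"
begin

lemma deg_0 [simp]: "dg 0 = 0"
  using deg_add[OF zero_mem zero_mem] by simp

end

definition monoid_algebra ::
    "'m::cancel_comm_monoid_add set \<Rightarrow> ('m \<Rightarrow> nat) \<Rightarrow> ('k::field, 'm \<Rightarrow>\<^sub>0 'k) galg" where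
  "monoid_algebra M dg =
     \<lparr>carrier = {p. keys p \<subseteq> M}, mult = (*), one = 1, ring.zero = 0, add = (+),
      smult = (\<lambda>c p. single 0 c * p),
      hpart = (\<lambda>d. {p. keys p \<subseteq> {m \<in> M. dg m = d}})\<rparr>"

lemma monoid_algebra_simps [simp]:
  "carrier (monoid_algebra M dg) = {p. keys p \<subseteq> M}"
  "mult (monoid_algebra M dg) = (*)"
  "one (monoid_algebra M dg) = 1"
  "ring.zero (monoid_algebra M dg) = 0"
  "add (monoid_algebra M dg) = (+)"
  "smult (monoid_algebra M dg) c p = scale c p"
  "hpart (monoid_algebra M dg) d = {p. keys p \<subseteq> {m \<in> M. dg m = d}}"
  by (simp_all add: monoid_algebra_def scale_conv_mult)

lemma a_inv_monoid_algebra: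
  "keys p \<subseteq> M \<Longrightarrow> \<ominus>\<^bsub>monoid_algebra M dg :: ('k::field, 'm::cancel_comm_monoid_add \<Rightarrow>\<^sub>0 'k) galg\<^esub> p = - p"
  unfolding a_inv_def m_inv_def
  by (rule the_equality) (simp_all add: eq_neg_iff_add_eq_0)

lemma keys_mult_subset:
  assumes "keys p \<subseteq> S" "keys q \<subseteq> T" "\<And>a b. a \<in> S \<Longrightarrow> b \<in> T \<Longrightarrow> a + b \<in> U"
  shows "keys (p * q) \<subseteq> U"
proof
  fix m assume "m \<in> keys (p * q)"
  then obtain a b where "a \<in> keys p" "b \<in> keys q" "m = a + b"
    using keys_mult[of p q] by blast
  then show "m \<in> U" using assms by blast
qed

lemma cring_scalars: "cring (scalars :: 'k::field ring)"
proof (rule cringI)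
  show "abelian_group (scalars :: 'k ring)"
  proof (rule abelian_groupI)
    fix x :: 'k
    show "\<exists>y\<in>carrier scalars. y \<oplus>\<^bsub>scalars\<^esub> x = \<zero>\<^bsub>scalars\<^esub>"
      by (rule bexI[of _ "- x"]) (simp_all add: scalars_def)
  qed (simp_all add: scalars_def add_ac)
  show "Group.comm_monoid (scalars :: 'k ring)"
    by (rule comm_monoidI) (auto simp: scalars_def algebra_simps)
qed (auto simp: scalars_def algebra_simps)

context standard_graded_monoid begin

lemma keys_mult_mem:
  "\<lbrakk>keys p \<subseteq> M; keys q \<subseteq> M\<rbrakk> \<Longrightarrow> keys (p * q) \<subseteq> M"
  by (rule keys_mult_subset[of p M q M]) (assumption | rule add_mem)+

lemma cring_monoid_algebra: "cring (monoid_algebra M dg :: ('k::field, 'm \<Rightarrow>\<^sub>0 'k) galg)"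
proof (rule cringI)
  show "abelian_group (monoid_algebra M dg :: ('k::field, 'm \<Rightarrow>\<^sub>0 'k) galg)"
  proof (rule abelian_groupI)
    fix x assume "x \<in> carrier (monoid_algebra M dg :: ('k::field, 'm \<Rightarrow>\<^sub>0 'k) galg)"
    then show "\<exists>y\<in>carrier (monoid_algebra M dg :: ('k, 'm \<Rightarrow>\<^sub>0 'k) galg).
        y \<oplus>\<^bsub>monoid_algebra M dg\<^esub> x = \<zero>\<^bsub>monoid_algebra M dg\<^esub>"
      by (intro bexI[of _ "- x"]) simp_all
  qed (simp_all add: add_ac keys_add_subset)
  show "Group.comm_monoid (monoid_algebra M dg :: ('k::field, 'm \<Rightarrow>\<^sub>0 'k) galg)"
    by (rule comm_monoidI) (simp_all add: mult_ac keys_mult_mem zero_mem)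
qed (simp add: distrib_right)

lemma algebra_monoid_algebra:
  "Module.algebra scalars (monoid_algebra M dg :: ('k::field, 'm \<Rightarrow>\<^sub>0 'k) galg)"
  by (rule algebraI[OF cring_scalars cring_monoid_algebra])
    (simp_all add: scalars_def scale_mult order.trans[OF keys_scale])

lemma finsum_monoid_algebra:
  assumes "finite I" "\<And>i. i \<in> I \<Longrightarrow> keys (f i) \<subseteq> M"
  shows "finsum (monoid_algebra M dg :: ('k::field, 'm \<Rightarrow>\<^sub>0 'k) galg) f I = sum f I"
proof -
  interpret cring "monoid_algebra M dg :: ('k, 'm \<Rightarrow>\<^sub>0 'k) galg" by (rule cring_monoid_algebra)
  show ?thesis using assms by (induct I rule: finite_induct) (simp_all add: Pi_def)
qed

text \<open>The component of degree \<open>d\<close> collects the monomials of degree \<open>d\<close>; it is the only choice because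
monomials of different degrees cannot cancel.\<close>
lemma homogeneous_decomposition:
  fixes p :: "'m \<Rightarrow>\<^sub>0 'k::field"
  assumes "keys p \<subseteq> M"
  shows "\<exists>!f. (\<forall>d. keys (f d) \<subseteq> {m \<in> M. dg m = d}) \<and> finite {d. f d \<noteq> 0} \<and>
              p = (\<Sum>d\<in>{d. f d \<noteq> 0}. f d)"
proof (rule ex1I)
  define g where "g d = (\<Sum>m\<in>{m \<in> keys p. dg m = d}. single m (lookup p m))" for d
  have lookup_g: "lookup (g d) m = (if dg m = d then lookup p m else 0)" for d m
    by (auto simp: g_def lookup_sum lookup_single when_def in_keys_iff)
  have supp: "{d. g d \<noteq> 0} \<subseteq> dg ` keys p"
  proof
    fix d assume "d \<in> {d. g d \<noteq> 0}"
    then have "keys (g d) \<noteq> {}" by simp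
    then obtain m where "m \<in> keys (g d)" by blast
    then show "d \<in> dg ` keys p" by (auto simp: in_keys_iff lookup_g split: if_splits)
  qed
  have "keys (g d) \<subseteq> {m \<in> M. dg m = d}" for d
    using assms by (auto simp: in_keys_iff lookup_g split: if_splits)
  moreover have fin: "finite {d. g d \<noteq> 0}" by (rule finite_subset[OF supp]) simp
  moreover have "p = (\<Sum>d\<in>{d. g d \<noteq> 0}. g d)"
  proof (rule poly_mapping_eqI)
    fix m
    have "lookup (\<Sum>d\<in>{d. g d \<noteq> 0}. g d) m = (\<Sum>d\<in>{d. g d \<noteq> 0}. if d = dg m then lookup p m else 0)"
      by (auto simp: lookup_sum lookup_g intro!: sum.cong)
    also have "\<dots> = (if g (dg m) \<noteq> 0 then lookup p m else 0)"
      using fin by simp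
    also have "\<dots> = lookup p m" using lookup_g[of "dg m" m] by (cases "g (dg m) = 0") simp_all
    finally show "lookup p m = lookup (\<Sum>d\<in>{d. g d \<noteq> 0}. g d) m" ..
  qed
  ultimately show "(\<forall>d. keys (g d) \<subseteq> {m \<in> M. dg m = d}) \<and> finite {d. g d \<noteq> 0} \<and>
              p = (\<Sum>d\<in>{d. g d \<noteq> 0}. g d)" by blast
  fix f assume f: "(\<forall>d. keys (f d) \<subseteq> {m \<in> M. dg m = d}) \<and> finite {d. f d \<noteq> 0} \<and>
              p = (\<Sum>d\<in>{d. f d \<noteq> 0}. f d)"
  then have keys_f: "keys (f d) \<subseteq> {m \<in> M. dg m = d}" and fin: "finite {d. f d \<noteq> 0}"
    and sum_f: "p = (\<Sum>d\<in>{d. f d \<noteq> 0}. f d)" for d by blast+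
  show "f = g"
  proof (rule ext, rule poly_mapping_eqI)
    fix d m
    \<comment> \<open>only the component of degree \<open>dg m\<close> can contain the monomial \<open>m\<close>\<close>
    have z: "lookup (f d') m = 0" if "d' \<noteq> dg m" for d'
      using keys_f[of d'] that by (auto simp: in_keys_iff)
    have "lookup p m = lookup (\<Sum>d\<in>{d. f d \<noteq> 0}. f d) m"
      by (rule arg_cong[OF sum_f])
    also have "\<dots> = (\<Sum>d\<in>{d. f d \<noteq> 0}. lookup (f d) m)"
      by (rule lookup_sum)
    also have "\<dots> = (\<Sum>d\<in>{d. f d \<noteq> 0}. if d = dg m then lookup (f (dg m)) m else 0)"
      by (rule sum.cong) (auto simp: z)
    also have "\<dots> = lookup (f (dg m)) m" using fin by auto
    finally show "lookup (f d) m = lookup (g d) m" using z[of d] by (auto simp: lookup_g)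
  qed
qed

lemma graded_algebra_monoid_algebra:
  "graded_algebra (monoid_algebra M dg :: ('k::field, 'm \<Rightarrow>\<^sub>0 'k) galg)"
proof -
  let ?A = "monoid_algebra M dg :: ('k::field, 'm \<Rightarrow>\<^sub>0 'k) galg"
  interpret alg: Module.algebra scalars ?A by (rule algebra_monoid_algebra)
  show ?thesis
  proof (intro graded_algebra.intro graded_algebra_axioms.intro algebra_monoid_algebra)
    show "submodule (hpart ?A d) scalars ?A" for d
    proof (rule alg.submoduleI)
      fix a assume "a \<in> hpart ?A d"
      then have a: "keys a \<subseteq> {m \<in> M. dg m = d}" by simp
      then have "\<ominus>\<^bsub>?A\<^esub> a = - a" by (intro a_inv_monoid_algebra) auto
      with a show "\<ominus>\<^bsub>?A\<^esub> a \<in> hpart ?A d" by simp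
    next
      show "hpart ?A d \<subseteq> carrier ?A" by auto
    qed (auto simp: zero_mem keys_add_subset order.trans[OF keys_scale])
    show "x \<otimes>\<^bsub>?A\<^esub> y \<in> hpart ?A (d + e)" if "x \<in> hpart ?A d" "y \<in> hpart ?A e" for x y d e
      using that keys_mult_subset[of x "{m \<in> M. dg m = d}" y "{m \<in> M. dg m = e}" "{m \<in> M. dg m = d + e}"]
      by (simp add: add_mem deg_add)
    show "hpart ?A 0 = {c \<odot>\<^bsub>?A\<^esub> \<one>\<^bsub>?A\<^esub> |c. True}"
    proof (intro equalityI subsetI)
      fix p assume "p \<in> hpart ?A 0"
      then have "keys p \<subseteq> {0}" using deg_eq_0 by auto
      then have "p = single 0 (lookup p 0)"
        by (intro poly_mapping_eqI) (auto simp: lookup_single when_def in_keys_iff)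
      then show "p \<in> {c \<odot>\<^bsub>?A\<^esub> \<one>\<^bsub>?A\<^esub> |c. True}"
        by (auto simp: scale_conv_mult)
    qed (auto simp: scale_conv_mult zero_mem split: if_splits)
    show "\<exists>!f. (\<forall>d. f d \<in> hpart ?A d) \<and> finite {d. f d \<noteq> \<zero>\<^bsub>?A\<^esub>} \<and>
             x = (\<Oplus>\<^bsub>?A\<^esub>d\<in>{d. f d \<noteq> \<zero>\<^bsub>?A\<^esub>}. f d)" if "x \<in> carrier ?A" for x
    proof -
      have "(\<forall>d. f d \<in> hpart ?A d) \<and> finite {d. f d \<noteq> \<zero>\<^bsub>?A\<^esub>} \<and>
             x = (\<Oplus>\<^bsub>?A\<^esub>d\<in>{d. f d \<noteq> \<zero>\<^bsub>?A\<^esub>}. f d) \<longleftrightarrow>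
          (\<forall>d. keys (f d) \<subseteq> {m \<in> M. dg m = d}) \<and> finite {d. f d \<noteq> 0} \<and>
              x = (\<Sum>d\<in>{d. f d \<noteq> 0}. f d)" for f
      proof -
        have "(\<Oplus>\<^bsub>?A\<^esub>d\<in>{d. f d \<noteq> 0}. f d) = (\<Sum>d\<in>{d. f d \<noteq> 0}. f d)"
          if "\<forall>d. keys (f d) \<subseteq> {m \<in> M. dg m = d}" "finite {d. f d \<noteq> 0}"
          using that by (intro finsum_monoid_algebra) auto
        then show ?thesis by auto
      qed
      then show ?thesis using homogeneous_decomposition[of x] that by simp
    qed
  qed simp
qed

end

section \<open>Monomial ideals and strong Koszulness\<close>

text \<open>Strong Koszulness seen on monomials: whenever \<open>w\<close> lies in the colon ideal \<open>(u) : v\<close>, already a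
divisor of \<open>w\<close> of degree 1 does.  The condition \<open>w \<noteq> 0\<close> stands for \<open>u \<noteq> v\<close>, since for
degree reasons \<open>w = 0\<close> forces \<open>u = v\<close>; this form also gives a divisor of degree 1 when \<open>u = v\<close>,
which is the situation of one component of a pair.\<close>
definition koszul_monoid :: "'m::cancel_comm_monoid_add set \<Rightarrow> ('m \<Rightarrow> nat) \<Rightarrow> bool" where
  "koszul_monoid M dg \<longleftrightarrow>
     (\<forall>u\<in>M. \<forall>v\<in>M. \<forall>w\<in>M. \<forall>w'\<in>M. dg u = 1 \<and> dg v = 1 \<and> w \<noteq> 0 \<and> v + w = u + w' \<longrightarrow>
        (\<exists>s\<in>M. \<exists>r\<in>M. \<exists>t\<in>M. dg s = 1 \<and> w = s + r \<and> v + s = u + t))"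

lemma keys_mult_single:
  fixes p :: "'m::cancel_comm_monoid_add \<Rightarrow>\<^sub>0 'k::field"
  shows "keys (p * single v 1) = (\<lambda>m. m + v) ` keys p"
proof -
  have "lookup (p * single v 1) (m + v) = lookup p m" for m
    using subset_UNIV[of "keys p"]
    by (induct p rule: poly_mapping_induct_on)
      (simp_all add: mult_single distrib_right lookup_add lookup_single when_def)
  then show ?thesis
    using keys_mult[of p "single v 1"] by (force simp: in_keys_iff)
qed

context standard_graded_monoid begin

definition multiples :: "'m set \<Rightarrow> 'm set" where
  "multiples S = {s + m |s m. s \<in> S \<and> m \<in> M}"

lemma multiples_subset: "S \<subseteq> M \<Longrightarrow> multiples S \<subseteq> M"
  by (auto simp: multiples_def add_mem)

lemma multiples_self: "S \<subseteq> multiples S"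
proof
  fix s assume "s \<in> S"
  then have "s + 0 \<in> multiples S" unfolding multiples_def using zero_mem by blast
  then show "s \<in> multiples S" by simp
qed

lemma multiples_add: "\<lbrakk>a \<in> multiples S; b \<in> M\<rbrakk> \<Longrightarrow> a + b \<in> multiples S"
  unfolding multiples_def using add_mem by (force simp: add.assoc)

text \<open>The polynomials supported on multiples of \<open>S\<close> form an ideal, and each of their monomials is a
monomial times an element of \<open>S\<close>.\<close>
lemma Idl_monomials:
  assumes "S \<subseteq> M"
  shows "Idl\<^bsub>monoid_algebra M dg :: ('k::field, 'm \<Rightarrow>\<^sub>0 'k) galg\<^esub> ((\<lambda>s. single s 1) ` S) =
    {p. keys p \<subseteq> multiples S}"
proof -
  let ?A = "monoid_algebra M dg :: ('k, 'm \<Rightarrow>\<^sub>0 'k) galg"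
  let ?I = "{p :: 'm \<Rightarrow>\<^sub>0 'k. keys p \<subseteq> multiples S}"
  interpret A: cring ?A by (rule cring_monoid_algebra)
  note sub = multiples_subset[OF assms]
  have left: "keys (x * a) \<subseteq> multiples S" if "keys a \<subseteq> multiples S" "keys x \<subseteq> M" for a x :: "'m \<Rightarrow>\<^sub>0 'k"
    by (rule keys_mult_subset[OF that(2,1)]) (metis add.commute multiples_add)
  have ideal: "ideal ?I ?A"
  proof (rule idealI[OF A.ring_axioms])
    show "subgroup ?I (add_monoid ?A)"
    proof (rule A.add.subgroupI)
      fix a assume "a \<in> ?I"
      then show "\<ominus>\<^bsub>?A\<^esub> a \<in> ?I" using sub by (subst a_inv_monoid_algebra) auto
    next
      show "?I \<noteq> {}" by (auto intro: exI[of _ 0])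
    qed (use sub in \<open>auto simp: keys_add_subset\<close>)
    show "x \<otimes>\<^bsub>?A\<^esub> a \<in> ?I" if "a \<in> ?I" "x \<in> carrier ?A" for a x
      using that left by simp
    then show "a \<otimes>\<^bsub>?A\<^esub> x \<in> ?I" if "a \<in> ?I" "x \<in> carrier ?A" for a x
      using that left[of a x] by (simp add: mult.commute)
  qed
  have gens: "(\<lambda>s. single s 1) ` S \<subseteq> carrier ?A"
    using assms by auto
  show ?thesis
  proof
    show "Idl\<^bsub>?A\<^esub> ((\<lambda>s. single s 1) ` S) \<subseteq> ?I"
      by (rule A.genideal_minimal[OF ideal]) (use multiples_self[of S] in auto)
    interpret J: ideal "Idl\<^bsub>?A\<^esub> ((\<lambda>s. single s 1) ` S)" ?A
      by (rule A.genideal_ideal[OF gens])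
    show "?I \<subseteq> Idl\<^bsub>?A\<^esub> ((\<lambda>s. single s 1) ` S)"
    proof
      fix p assume "p \<in> ?I"
      then have "keys p \<subseteq> multiples S" by simp
      then show "p \<in> Idl\<^bsub>?A\<^esub> ((\<lambda>s. single s 1) ` S)"
      proof (induct rule: poly_mapping_induct_on)
        case zero
        show ?case using J.zero_closed by simp
      next
        case (single m c)
        then obtain s r where m: "m = s + r" "s \<in> S" "r \<in> M" by (auto simp: multiples_def)
        have "single r c \<otimes>\<^bsub>?A\<^esub> single s 1 \<in> Idl\<^bsub>?A\<^esub> ((\<lambda>s. single s 1) ` S)"
          by (rule J.I_l_closed) (use A.genideal_self[OF gens] m in auto)
        then show ?case using m by (simp add: mult_single add.commute)
      next
        case (add p q)
        then show ?case using J.a_closed[of p q] by simp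
      qed
    qed
  qed
qed

lemma irrelevant_ideal_monoid_algebra:
  "irrelevant_ideal (monoid_algebra M dg :: ('k::field, 'm \<Rightarrow>\<^sub>0 'k) galg) = {p. keys p \<subseteq> M - {0}}"
proof -
  let ?A = "monoid_algebra M dg :: ('k, 'm \<Rightarrow>\<^sub>0 'k) galg"
  interpret A: cring ?A by (rule cring_monoid_algebra)
  let ?G = "generate (add_monoid ?A) (\<Union>d\<in>{1..}. hpart ?A d)"
  have H: "(\<Union>d\<in>{1..}. hpart ?A d) \<subseteq> {p. keys p \<subseteq> M - {0}}"
  proof
    fix p assume "p \<in> (\<Union>d\<in>{1..}. hpart ?A d)"
    then obtain d where "d \<ge> 1" "keys p \<subseteq> {m \<in> M. dg m = d}" by auto
    then show "p \<in> {p. keys p \<subseteq> M - {0}}" by auto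
  qed
  show ?thesis
    unfolding irrelevant_ideal_def
  proof (intro equalityI subsetI)
    fix p assume "p \<in> ?G"
    then have "keys p \<subseteq> M - {0}"
    proof (induct rule: generate.induct)
      case (incl h)
      then show ?case using H by blast
    next
      case (inv h)
      then have h: "keys h \<subseteq> M - {0}" using H by blast
      then have "\<ominus>\<^bsub>?A\<^esub> h = - h" by (intro a_inv_monoid_algebra) auto
      with h show ?case by (simp add: a_inv_def)
    qed (simp_all add: keys_add_subset)
    then show "p \<in> {p. keys p \<subseteq> M - {0}}" by simp
  next
    fix p :: "'m \<Rightarrow>\<^sub>0 'k"
    assume "p \<in> {p. keys p \<subseteq> M - {0}}"
    then have "keys p \<subseteq> M - {0}" by simp
    then show "p \<in> ?G"
    proof (induct rule: poly_mapping_induct_on)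
      case zero
      show ?case using generate.one[of "add_monoid ?A"] by simp
    next
      case (single m c)
      then have "dg m \<ge> 1" using deg_eq_0[of m] by (cases "dg m") auto
      then have "single m c \<in> (\<Union>d\<in>{1..}. hpart ?A d)" using single by auto
      then show ?case by (rule generate.incl)
    next
      case (add p q)
      then show ?case using generate.eng[of p "add_monoid ?A" _ q] by simp
    qed
  qed
qed

lemma multiples_degree_one: "multiples {u \<in> M. dg u = 1} = M - {0}"
proof (intro equalityI subsetI)
  fix m assume "m \<in> multiples {u \<in> M. dg u = 1}"
  then obtain u r where m: "m = u + r" "u \<in> M" "dg u = 1" "r \<in> M" by (auto simp: multiples_def)
  then have "dg m \<noteq> 0" by (simp add: deg_add)
  then show "m \<in> M - {0}" using m add_mem by auto
next
  fix m assume "m \<in> M - {0}"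
  then show "m \<in> multiples {u \<in> M. dg u = 1}" using split_deg_1[of m] by (force simp: multiples_def)
qed

text \<open>A generator of degree 1 is not a multiple of a different one: the quotient would have degree 0.\<close>
lemma minimal_generators_monoid_algebra:
  fixes us :: "('m \<Rightarrow>\<^sub>0 'k::field) list"
  assumes "distinct us" "set us = (\<lambda>u. single u 1) ` {u \<in> M. dg u = 1}"
  shows "minimal_homogeneous_generators (monoid_algebra M dg) us"
  unfolding minimal_homogeneous_generators_def
proof (intro conjI ballI allI impI)
  let ?A = "monoid_algebra M dg :: ('k, 'm \<Rightarrow>\<^sub>0 'k) galg"
  show "\<exists>d. u \<in> hpart ?A d" if "u \<in> set us" for u
    using that assms(2) by (intro exI[of _ 1]) auto
  show "Idl\<^bsub>?A\<^esub> (set us) = irrelevant_ideal ?A"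
    unfolding assms(2) irrelevant_ideal_monoid_algebra multiples_degree_one[symmetric]
    by (rule Idl_monomials) auto
  fix i assume i: "i < length us"
  then obtain u where u: "us ! i = single u 1" "u \<in> M" "dg u = 1"
    using assms(2) nth_mem[OF i] by auto
  have others: "{us ! j |j. j < length us \<and> j \<noteq> i} = (\<lambda>u. single u 1) ` ({v \<in> M. dg v = 1} - {u})"
  proof -
    have "{us ! j |j. j < length us \<and> j \<noteq> i} = set us - {us ! i}"
      using assms(1) i by (auto simp: in_set_conv_nth nth_eq_iff_index_eq)
    also have "\<dots> = (\<lambda>u. single u 1) ` ({v \<in> M. dg v = 1} - {u})"
      unfolding assms(2) u(1) by (auto simp: inj_on_def dest!: arg_cong[of "single _ _" _ keys])
    finally show ?thesis .
  qed
  have "single u 1 \<notin> {p :: 'm \<Rightarrow>\<^sub>0 'k. keys p \<subseteq> multiples ({v \<in> M. dg v = 1} - {u})}"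
  proof
    assume "single u 1 \<in> {p :: 'm \<Rightarrow>\<^sub>0 'k. keys p \<subseteq> multiples ({v \<in> M. dg v = 1} - {u})}"
    then obtain v r where v: "u = v + r" "v \<in> M" "dg v = 1" "r \<in> M" "v \<noteq> u"
      by (auto simp: multiples_def)
    then have "dg r = 0" using u deg_add[of v r] by simp
    then show False using v deg_eq_0[of r] by simp
  qed
  moreover have "single u 1 \<in> irrelevant_ideal ?A"
    unfolding irrelevant_ideal_monoid_algebra using u by auto
  ultimately show "Idl\<^bsub>?A\<^esub> {us ! j |j. j < length us \<and> j \<noteq> i} \<noteq> irrelevant_ideal ?A"
    unfolding others using Idl_monomials[of "{v \<in> M. dg v = 1} - {u}", where ?'k = 'k] by blast
qed

lemma colon_monomials:
  assumes "S \<subseteq> M" "v \<in> M"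
  shows "colon_ideal (monoid_algebra M dg :: ('k::field, 'm \<Rightarrow>\<^sub>0 'k) galg)
      (Idl\<^bsub>monoid_algebra M dg\<^esub> ((\<lambda>s. single s 1) ` S)) (single v 1) =
    {p. keys p \<subseteq> {m \<in> M. m + v \<in> multiples S}}"
  unfolding colon_ideal_def Idl_monomials[OF assms(1)] by (auto simp: keys_mult_single)

text \<open>A colon ideal \<open>(u\<^sub>1, \<dots>, u\<^sub>j) : v\<close> of monomials is the sum of the ideals \<open>(u\<^sub>i) : v\<close>, so only pairs
of generators matter.  The definition of strong Koszulness speaks of \<open>(u) : v\<close> only if \<open>u\<close> precedes
\<open>v\<close> in the list; this covers both orders because a relation \<open>v + w = u + w'\<close> can be read in
both directions: a factor \<open>s\<close> of \<open>w'\<close> with \<open>u + s = v + t\<close> makes \<open>t\<close> a factor of \<open>w\<close>.\<close>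
lemma strongly_koszul_monoid_algebra:
  fixes us :: "('m \<Rightarrow>\<^sub>0 'k::field) list"
  assumes "distinct us" and set_us: "set us = (\<lambda>u. single u 1) ` {u \<in> M. dg u = 1}"
  shows "strongly_koszul (monoid_algebra M dg) us \<longleftrightarrow> koszul_monoid M dg"
proof
  let ?A = "monoid_algebra M dg :: ('k, 'm \<Rightarrow>\<^sub>0 'k) galg"
  assume "strongly_koszul ?A us"
  then have colon: "\<exists>S\<subseteq>set us.
      colon_ideal ?A (Idl\<^bsub>?A\<^esub> {us ! (ix ! l) |l. l < j}) (us ! (ix ! j)) = Idl\<^bsub>?A\<^esub> S"
    if "sorted_wrt (<) ix" "set ix \<subseteq> {..<length us}" "j < length ix" for ix j
    using that unfolding strongly_koszul_def by blast
  have key: "\<exists>s\<in>M. \<exists>r\<in>M. \<exists>t\<in>M. dg s = 1 \<and> w = s + r \<and> v + s = u + t"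
    if "i < j" "j < length us" "us ! i = single u 1" "us ! j = single v 1"
      "u \<in> M" "v \<in> M" "w \<in> M" "w' \<in> M" "v + w = u + w'" for i j u v w w'
  proof -
    note ij = that
    obtain S where S: "S \<subseteq> set us" "colon_ideal ?A (Idl\<^bsub>?A\<^esub> ((\<lambda>s. single s 1) ` {u})) (single v 1) = Idl\<^bsub>?A\<^esub> S"
      using colon[of "[i, j]" 1] ij(1,2) by (auto simp: ij(3,4))
    then obtain S' where S': "S = (\<lambda>s. single s 1) ` S'" "S' \<subseteq> {u \<in> M. dg u = 1}"
      unfolding set_us by (auto simp: subset_image_iff)
    have eq: "{p :: 'm \<Rightarrow>\<^sub>0 'k. keys p \<subseteq> {m \<in> M. m + v \<in> multiples {u}}} = {p. keys p \<subseteq> multiples S'}"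
      using S(2) S'(2) that unfolding S'(1) by (subst (asm) colon_monomials, simp, simp, subst (asm) Idl_monomials) auto
    have mem: "m \<in> M \<and> m + v \<in> multiples {u} \<longleftrightarrow> m \<in> multiples S'" for m
      using eqset_imp_iff[OF eq, of "single m 1"] by simp
    have "w + v \<in> multiples {u}"
      using that by (auto simp: multiples_def add.commute)
    then obtain s r where s: "w = s + r" "s \<in> S'" "r \<in> M"
      using mem[of w] ij(7) by (auto simp: multiples_def)
    moreover have "s + v \<in> multiples {u}" using mem[of s] s multiples_self by blast
    then obtain t where "t \<in> M" "v + s = u + t" by (auto simp: multiples_def add.commute)
    ultimately show ?thesis using S' by blast
  qed
  show "koszul_monoid M dg"
    unfolding koszul_monoid_def
  proof (intro ballI impI, elim conjE)
    fix u v w w' assume uv: "u \<in> M" "v \<in> M" "w \<in> M" "w' \<in> M" "dg u = 1" "dg v = 1" "w \<noteq> 0" "v + w = u + w'"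
    obtain i j where ij: "i < length us" "us ! i = single u 1" "j < length us" "us ! j = single v 1"
    proof -
      have "single u 1 \<in> set us" "single v 1 \<in> set us" unfolding set_us using uv by auto
      then show thesis using that by (auto simp: in_set_conv_nth)
    qed
    have "u = v" if "i = j"
      using arg_cong[of _ _ keys, OF trans[OF ij(2)[symmetric] ij(4)[folded that]]] by simp
    then consider "u = v" | "i < j" | "j < i" by linarith
    then show "\<exists>s\<in>M. \<exists>r\<in>M. \<exists>t\<in>M. dg s = 1 \<and> w = s + r \<and> v + s = u + t"
    proof cases
      case 1
      then show ?thesis using split_deg_1[of w] uv(3,7) by blast
    next
      case 2
      then show ?thesis using key[OF 2 ij(3) ij(2,4) uv(1-4) uv(8)] by blast
    next
      case 3
      then obtain s r t where s: "s \<in> M" "r \<in> M" "t \<in> M" "dg s = 1" "w' = s + r" "u + s = v + t"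
        using key[OF 3 ij(1) ij(4,2) uv(2,1,4,3) uv(8)[symmetric]] by blast
      \<comment> \<open>read the relation backwards and cancel \<open>v\<close>\<close>
      have "v + w = (u + s) + r" using s(5) uv(8) by (simp add: add.assoc)
      also have "\<dots> = v + (t + r)" using s(6) by (simp add: add.assoc)
      finally have "v + w = v + (t + r)" .
      then have "w = t + r" by simp
      moreover have "dg t = 1" using arg_cong[OF s(6), of dg] s(1-4) uv(1,2,5,6) by (simp add: deg_add)
      ultimately show ?thesis using s(1-3) s(6) by metis
    qed
  qed
next
  let ?A = "monoid_algebra M dg :: ('k, 'm \<Rightarrow>\<^sub>0 'k) galg"
  assume K: "koszul_monoid M dg"
  show "strongly_koszul ?A us"
    unfolding strongly_koszul_def
  proof (intro conjI graded_algebra_monoid_algebra minimal_generators_monoid_algebra assms allI impI, elim conjE)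
    fix ix j assume ix: "sorted_wrt (<) ix" "set ix \<subseteq> {..<length us}" and j: "j < length ix"
    define B where "B = {u \<in> M. dg u = 1 \<and> (\<exists>l<j. us ! (ix ! l) = single u 1)}"
    have us_mem: "\<exists>u\<in>M. dg u = 1 \<and> us ! i = single u 1" if "i < length us" for i
      using set_us nth_mem[OF that] by auto
    have ixl: "ix ! l < length us" if "l < length ix" for l
      using ix(2) nth_mem[OF that] by auto
    have B: "{us ! (ix ! l) |l. l < j} = (\<lambda>s. single s 1) ` B"
    proof (intro equalityI subsetI)
      fix x assume "x \<in> {us ! (ix ! l) |l. l < j}"
      then obtain l where "l < j" "x = us ! (ix ! l)" by blast
      then show "x \<in> (\<lambda>s. single s 1) ` B"
        using us_mem[OF ixl[of l]] j by (auto simp: B_def)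
    next
      fix x :: "'m \<Rightarrow>\<^sub>0 'k" assume "x \<in> (\<lambda>s. single s 1) ` B"
      then obtain s l where "x = single s 1" "l < j" "us ! (ix ! l) = single s 1" by (auto simp: B_def)
      then show "x \<in> {us ! (ix ! l) |l. l < j}" by (intro CollectI exI[of _ l]) simp
    qed
    obtain v where v: "v \<in> M" "dg v = 1" "us ! (ix ! j) = single v 1" using us_mem[OF ixl[OF j]] by blast
    have "v \<notin> B"
    proof
      assume "v \<in> B"
      then obtain l where l: "l < j" "us ! (ix ! l) = us ! (ix ! j)" using v by (auto simp: B_def)
      moreover have "ix ! l < ix ! j" using ix(1) l(1) j by (simp add: sorted_wrt_nth_less)
      ultimately show False
        using nth_eq_iff_index_eq[OF assms(1) ixl[of l] ixl[OF j]] j by simp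
    qed
    have BM: "B \<subseteq> M" by (auto simp: B_def)
    \<comment> \<open>the generators of degree 1 in the colon ideal generate it\<close>
    define S where "S = {s \<in> M. dg s = 1 \<and> s + v \<in> multiples B}"
    have "{m \<in> M. m + v \<in> multiples B} = multiples S"
    proof (intro equalityI subsetI)
      fix m assume "m \<in> {m \<in> M. m + v \<in> multiples B}"
      then obtain b m' where m: "m \<in> M" "m + v = b + m'" "b \<in> B" "m' \<in> M" by (auto simp: multiples_def)
      have b: "b \<in> M" "dg b = 1" using m by (auto simp: B_def)
      have "m \<noteq> 0"
      proof
        assume "m = 0"
        then have "v = b + m'" using m by simp
        moreover then have "dg m' = 0" using v b m deg_add[of b m'] by simp
        ultimately have "v = b" using m deg_eq_0 by simp
        then show False using \<open>v \<notin> B\<close> m by blast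
      qed
      then obtain s r t where s: "s \<in> M" "r \<in> M" "t \<in> M" "dg s = 1" "m = s + r" "s + v = b + t"
        using K[unfolded koszul_monoid_def, rule_format, of b v m m'] m b v \<open>m \<noteq> 0\<close>
        by (auto simp: add.commute)
      then have "s \<in> S" unfolding S_def multiples_def using m(3) by blast
      then show "m \<in> multiples S" unfolding multiples_def using s by blast
    next
      fix m assume "m \<in> multiples S"
      then obtain s r where s: "m = s + r" "s \<in> M" "s + v \<in> multiples B" "r \<in> M"
        unfolding multiples_def[of S] by (auto simp: S_def)
      have "s + v + r \<in> multiples B" using s(3,4) by (rule multiples_add)
      then show "m \<in> {m \<in> M. m + v \<in> multiples B}" using s by (simp add: add_ac add_mem)
    qed
    then have "colon_ideal ?A (Idl\<^bsub>?A\<^esub> {us ! (ix ! l) |l. l < j}) (us ! (ix ! j)) =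
        Idl\<^bsub>?A\<^esub> ((\<lambda>s. single s 1) ` S)"
      unfolding B v(3) by (subst colon_monomials[OF BM v(1)], subst Idl_monomials) (auto simp: S_def)
    moreover have "(\<lambda>s. single s 1) ` S \<subseteq> set us" unfolding set_us by (auto simp: S_def)
    ultimately show "\<exists>S\<subseteq>set us. colon_ideal ?A (Idl\<^bsub>?A\<^esub> {us ! (ix ! l) |l. l < j}) (us ! (ix ! j)) = Idl\<^bsub>?A\<^esub> S"
      by blast
  qed
qed

end

section \<open>Isomorphisms of graded algebras\<close>

lemma galg_iso_refl: "A \<cong>\<^sub>g A"
  unfolding galg_iso_def
  by (rule bexI[of _ "\<lambda>x. x"]) (auto simp: ring_iso_def ring_hom_def bij_betw_def inj_on_def)

lemma galg_iso_trans:
  assumes "A \<cong>\<^sub>g B" "B \<cong>\<^sub>g C"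
  shows "A \<cong>\<^sub>g C"
proof -
  obtain f where f: "f \<in> ring_iso A B" "\<And>c x. x \<in> carrier A \<Longrightarrow> f (c \<odot>\<^bsub>A\<^esub> x) = c \<odot>\<^bsub>B\<^esub> f x"
    "\<And>d. f ` hpart A d = hpart B d" using assms(1) unfolding galg_iso_def by blast
  obtain g where g: "g \<in> ring_iso B C" "\<And>c x. x \<in> carrier B \<Longrightarrow> g (c \<odot>\<^bsub>B\<^esub> x) = c \<odot>\<^bsub>C\<^esub> g x"
    "\<And>d. g ` hpart B d = hpart C d" using assms(2) unfolding galg_iso_def by blast
  have carr: "f x \<in> carrier B" if "x \<in> carrier A" for x
    using f(1) that by (auto simp: ring_iso_def ring_hom_def)
  show ?thesis
    unfolding galg_iso_def
  proof (intro bexI[of _ "g \<circ> f"] conjI allI ballI)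
    show "g \<circ> f \<in> ring_iso A C" using ring_iso_set_trans[OF f(1) g(1)] .
    show "(g \<circ> f) ` hpart A d = hpart C d" for d
      by (simp only: image_comp[symmetric] f(3) g(3))
  qed (simp add: f g carr)
qed

definition graded_iso ::
    "('a::cancel_comm_monoid_add \<Rightarrow> 'b::cancel_comm_monoid_add) \<Rightarrow> 'a set \<Rightarrow> ('a \<Rightarrow> nat) \<Rightarrow>
      'b set \<Rightarrow> ('b \<Rightarrow> nat) \<Rightarrow> bool" where
  "graded_iso \<phi> M d N d' \<longleftrightarrow>
     bij_betw \<phi> M N \<and> (\<forall>a\<in>M. \<forall>b\<in>M. \<phi> (a + b) = \<phi> a + \<phi> b) \<and> (\<forall>a\<in>M. d' (\<phi> a) = d a)"

context standard_graded_monoid begin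

lemma graded_iso_zero:
  assumes "graded_iso \<phi> M dg N d'"
  shows "\<phi> 0 = 0"
proof -
  have "\<phi> 0 + \<phi> 0 = \<phi> 0 + 0"
    using assms zero_mem unfolding graded_iso_def by (metis add.right_neutral)
  then show ?thesis by (rule add_left_imp_eq)
qed

lemma graded_iso_standard:
  assumes iso: "graded_iso \<phi> M dg N d'"
  shows "standard_graded_monoid N d'"
proof -
  have N: "N = \<phi> ` M" and inj: "inj_on \<phi> M" and add: "\<And>a b. a \<in> M \<Longrightarrow> b \<in> M \<Longrightarrow> \<phi> a + \<phi> b = \<phi> (a + b)"
    and d: "\<And>a. a \<in> M \<Longrightarrow> d' (\<phi> a) = dg a"
    using iso by (auto simp: graded_iso_def bij_betw_def)
  note zero = graded_iso_zero[OF iso]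
  show ?thesis
  proof
    show "0 \<in> N" using zero zero_mem N by (metis imageI)
    show "a + b \<in> N" if "a \<in> N" "b \<in> N" for a b using that N add add_mem by auto
    show "d' (a + b) = d' a + d' b" if "a \<in> N" "b \<in> N" for a b
      using that N add d add_mem deg_add by auto
    show "a = 0" if a: "a \<in> N" "d' a = 0" for a
    proof -
      obtain m where m: "m \<in> M" "a = \<phi> m" using a N by blast
      then have "m = 0" using a(2) d[of m] deg_eq_0[of m] by simp
      then show ?thesis using m zero by simp
    qed
    show "\<exists>s\<in>N. \<exists>r\<in>N. d' s = 1 \<and> a = s + r" if a: "a \<in> N" "a \<noteq> 0" for a
    proof -
      obtain m where m: "m \<in> M" "a = \<phi> m" "m \<noteq> 0" using a N zero by auto
      then obtain s r where "s \<in> M" "r \<in> M" "dg s = 1" "m = s + r" using split_deg_1 by blast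
      then show ?thesis using m N d add by (metis imageI)
    qed
  qed
qed

lemma monoid_algebra_iso:
  assumes iso: "graded_iso \<phi> M dg N d'"
  shows "(monoid_algebra M dg :: ('k::field, 'm \<Rightarrow>\<^sub>0 'k) galg) \<cong>\<^sub>g monoid_algebra N d'"
proof -
  have N: "N = \<phi> ` M" and inj: "inj_on \<phi> M" and add: "\<And>a b. a \<in> M \<Longrightarrow> b \<in> M \<Longrightarrow> \<phi> (a + b) = \<phi> a + \<phi> b"
    and d: "\<And>a. a \<in> M \<Longrightarrow> d' (\<phi> a) = dg a"
    using iso by (auto simp: graded_iso_def bij_betw_def)
  let ?f = "linear_extension (\<lambda>m. single (\<phi> m) 1) :: ('m \<Rightarrow>\<^sub>0 'k) \<Rightarrow> _"
  let ?g = "linear_extension (\<lambda>m. single (inv_into M \<phi> m) 1) :: _ \<Rightarrow> ('m \<Rightarrow>\<^sub>0 'k)"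
  have gf: "?g (?f p) = p" if "keys p \<subseteq> M" for p
    using that by (induct rule: poly_mapping_induct_on) (simp_all add: linear_extension_add inj)
  have fg: "?f (?g p) = p" if "keys p \<subseteq> N" for p
    using that by (induct rule: poly_mapping_induct_on) (simp_all add: linear_extension_add N f_inv_into_f)
  have keys_f: "keys (?f p) \<subseteq> \<phi> ` keys p" for p
    using keys_linear_extension[of "\<lambda>m. single (\<phi> m) 1" p] by auto
  have keys_g: "keys (?g p) \<subseteq> inv_into M \<phi> ` keys p" for p
    using keys_linear_extension[of "\<lambda>m. single (inv_into M \<phi> m) 1" p] by auto
  have image: "?f ` {p. keys p \<subseteq> {m \<in> M. P m}} = {p. keys p \<subseteq> {n \<in> N. Q n}}"
    if PQ: "\<And>m. m \<in> M \<Longrightarrow> Q (\<phi> m) \<longleftrightarrow> P m" for P Q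
  proof (intro equalityI subsetI)
    fix q assume "q \<in> ?f ` {p. keys p \<subseteq> {m \<in> M. P m}}"
    then obtain p where p: "q = ?f p" "keys p \<subseteq> {m \<in> M. P m}" by blast
    have "\<phi> ` keys p \<subseteq> {n \<in> N. Q n}" using p(2) N PQ by auto
    then show "q \<in> {p. keys p \<subseteq> {n \<in> N. Q n}}" using keys_f[of p] p(1) by simp
  next
    fix q :: "_ \<Rightarrow>\<^sub>0 'k" assume "q \<in> {p. keys p \<subseteq> {n \<in> N. Q n}}"
    then have q: "keys q \<subseteq> {n \<in> N. Q n}" by simp
    have "keys (?g q) \<subseteq> {m \<in> M. P m}"
    proof
      fix m assume "m \<in> keys (?g q)"
      then obtain n where n: "n \<in> keys q" "m = inv_into M \<phi> n" using keys_g[of q] by auto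
      then have "n \<in> \<phi> ` M" "Q n" using q N by auto
      then show "m \<in> {m \<in> M. P m}"
        using PQ[of m] by (simp add: n(2) inv_into_into f_inv_into_f)
    qed
    moreover have fgq: "?f (?g q) = q" using q by (intro fg) auto
    ultimately show "q \<in> ?f ` {p. keys p \<subseteq> {m \<in> M. P m}}"
      by (intro image_eqI[of _ _ "?g q"]) (simp_all only: mem_Collect_eq)
  qed
  have mult: "?f (p * q) = ?f p * ?f q" if "keys p \<subseteq> M" "keys q \<subseteq> M" for p q
    using that(1)
  proof (induct rule: poly_mapping_induct_on)
    case (single m c)
    show ?case using that(2) single
      by (induct rule: poly_mapping_induct_on)
        (simp_all add: linear_extension_add mult_single add distrib_left)
  qed (simp_all add: linear_extension_add distrib_right)
  show ?thesis
    unfolding galg_iso_def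
  proof (intro bexI[of _ ?f] conjI allI ballI)
    show "?f \<in> ring_iso (monoid_algebra M dg) (monoid_algebra N d')"
      unfolding ring_iso_def ring_hom_def
    proof (intro CollectI conjI Pi_I ballI)
      show "?f p \<in> carrier (monoid_algebra N d')" if "p \<in> carrier (monoid_algebra M dg)" for p
        using order.trans[OF keys_f image_mono[of "keys p" M \<phi>]] that N by simp
      show "?f \<one>\<^bsub>monoid_algebra M dg\<^esub> = \<one>\<^bsub>monoid_algebra N d'\<^esub>"
        unfolding monoid_algebra_simps single_one[symmetric]
        by (simp add: graded_iso_zero[OF iso] del: single_one)
      show "bij_betw ?f (carrier (monoid_algebra M dg)) (carrier (monoid_algebra N d'))"
        unfolding bij_betw_def
      proof
        show "inj_on ?f (carrier (monoid_algebra M dg))"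
          by (rule inj_on_inverseI[of _ ?g]) (simp add: gf)
        show "?f ` carrier (monoid_algebra M dg) = carrier (monoid_algebra N d')"
          using image[of "\<lambda>_. True" "\<lambda>_. True"] by simp
      qed
    qed (simp_all add: linear_extension_add mult)
    show "?f (c \<odot>\<^bsub>monoid_algebra M dg\<^esub> p) = c \<odot>\<^bsub>monoid_algebra N d'\<^esub> ?f p" for c p
      by (simp add: linear_extension_scale)
    show "?f ` hpart (monoid_algebra M dg) e = hpart (monoid_algebra N d') e" for e
      using image[of "\<lambda>m. d' m = e" "\<lambda>m. dg m = e"] by (simp add: d)
  qed
qed

end

section \<open>Tensor and Segre products of monoid algebras\<close>

text \<open>The multiplication of \<^const>\<open>pair_algebra\<close> as a bilinear extension, which makes its bilinearity
evident.\<close>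
definition pair_mult ::
    "('a::times \<times> 'b::times \<Rightarrow>\<^sub>0 'k::field) \<Rightarrow> ('a \<times> 'b \<Rightarrow>\<^sub>0 'k) \<Rightarrow> 'a \<times> 'b \<Rightarrow>\<^sub>0 'k" where
  "pair_mult f g = linear_extension (\<lambda>x. linear_extension (\<lambda>y. single (fst x * fst y, snd x * snd y) 1) g) f"

lemma pair_mult_simps [simp]:
  "pair_mult 0 g = 0"
  "pair_mult f 0 = 0"
  "pair_mult (f + f') g = pair_mult f g + pair_mult f' g"
  "pair_mult f (g + g') = pair_mult f g + pair_mult f g'"
  "pair_mult (single x c) (single y d) = single (fst x * fst y, snd x * snd y) (c * d)"
  by (simp_all add: pair_mult_def linear_extension_add linear_extension_add_fun) (simp add: linear_extension_def)

lemma keys_pair_mult: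
  "keys (pair_mult f g) \<subseteq> (\<lambda>(x, y). (fst x * fst y, snd x * snd y)) ` (keys f \<times> keys g)"
proof
  fix z assume z: "z \<in> keys (pair_mult f g)"
  from subsetD[OF keys_linear_extension z[unfolded pair_mult_def]] obtain x where x: "x \<in> keys f" "z \<in> keys (linear_extension (\<lambda>y. single (fst x * fst y, snd x * snd y) (1::'c)) g)"
    by (rule UN_E)
  from subsetD[OF keys_linear_extension x(2)]
  obtain y where "y \<in> keys g" "z \<in> keys (single (fst x * fst y, snd x * snd y) (1::'c))"
    by (rule UN_E)
  then show "z \<in> (\<lambda>(x, y). (fst x * fst y, snd x * snd y)) ` (keys f \<times> keys g)"
    using x(1) by force
qed

lemma pair_mult_comm:
  fixes f g :: "'a::ab_semigroup_mult \<times> 'b::ab_semigroup_mult \<Rightarrow>\<^sub>0 'k::field"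
  shows "pair_mult f g = pair_mult g f"
  using subset_UNIV[of "keys f"]
proof (induct rule: poly_mapping_induct_on)
  case (single x c)
  show ?case using subset_UNIV[of "keys g"]
    by (induct rule: poly_mapping_induct_on) (simp_all add: mult.commute)
qed simp_all

lemma pair_mult_assoc:
  fixes f g h :: "'a::semigroup_mult \<times> 'b::semigroup_mult \<Rightarrow>\<^sub>0 'k::field"
  shows "pair_mult (pair_mult f g) h = pair_mult f (pair_mult g h)"
  using subset_UNIV[of "keys f"]
proof (induct rule: poly_mapping_induct_on)
  case (single x c)
  show ?case using subset_UNIV[of "keys g"]
  proof (induct rule: poly_mapping_induct_on)
    case (single y d)
    show ?case using subset_UNIV[of "keys h"]
      by (induct rule: poly_mapping_induct_on) (simp_all add: mult.assoc)
  qed simp_all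
qed simp_all

lemma pair_mult_one:
  fixes f :: "'a::monoid_mult \<times> 'b::monoid_mult \<Rightarrow>\<^sub>0 'k::field"
  shows "pair_mult (single (1, 1) c) f = scale c f"
  using subset_UNIV[of "keys f"] by (induct rule: poly_mapping_induct_on) simp_all

text \<open>The tensor product of two polynomials, realised as a polynomial on pairs of monomials.\<close>
definition outer :: "('m \<Rightarrow>\<^sub>0 'k::field) \<Rightarrow> ('n \<Rightarrow>\<^sub>0 'k) \<Rightarrow> 'm \<times> 'n \<Rightarrow>\<^sub>0 'k" where
  "outer a b = linear_extension (\<lambda>m. linear_extension (\<lambda>n. single (m, n) 1) b) a"

lemma outer_simps [simp]:
  "outer 0 b = 0"
  "outer a 0 = 0"
  "outer (a + a') b = outer a b + outer a' b"
  "outer a (b + b') = outer a b + outer a b'"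
  "outer (scale c a) b = scale c (outer a b)"
  "outer a (scale c b) = scale c (outer a b)"
  "outer (single m c) (single n d) = single (m, n) (c * d)"
  by (simp_all add: outer_def linear_extension_add linear_extension_add_fun linear_extension_scale linear_extension_scale_fun) (simp add: linear_extension_def)

lemma keys_outer: "keys (outer a b) \<subseteq> keys a \<times> keys b"
proof
  fix z assume z: "z \<in> keys (outer a b)"
  from subsetD[OF keys_linear_extension z[unfolded outer_def]] obtain m where m: "m \<in> keys a" "z \<in> keys (linear_extension (\<lambda>n. single (m, n) (1::'c)) b)"
    by (rule UN_E)
  from subsetD[OF keys_linear_extension m(2)] obtain n where "n \<in> keys b" "z \<in> keys (single (m, n) (1::'c))"
    by (rule UN_E)
  then show "z \<in> keys a \<times> keys b" using m by simp
qed

lemma outer_mult: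
  fixes a a' :: "'m::cancel_comm_monoid_add \<Rightarrow>\<^sub>0 'k::field" and b b' :: "'n::cancel_comm_monoid_add \<Rightarrow>\<^sub>0 'k"
  shows "outer (a * a') (b * b') = outer a b * outer a' b'"
  using subset_UNIV[of "keys a"]
proof (induct rule: poly_mapping_induct_on)
  case (single m c)
  show ?case using subset_UNIV[of "keys a'"]
  proof (induct rule: poly_mapping_induct_on)
    case (single m' c')
    show ?case using subset_UNIV[of "keys b"]
    proof (induct rule: poly_mapping_induct_on)
      case (single n d)
      show ?case using subset_UNIV[of "keys b'"]
        by (induct rule: poly_mapping_induct_on) (simp_all add: mult_single distrib_left distrib_right ac_simps)
    qed (simp_all add: distrib_right)
  qed (simp_all add: distrib_left)
qed (simp_all add: distrib_right)

text \<open>The linear map induced by \<^const>\<open>outer\<close> and its section.  Evaluation kills the bilinearity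
relations; conversely every element is congruent modulo these relations to the normal form, a
combination of pairs of monomials, of its evaluation.\<close>
definition pair_eval :: "(('m \<Rightarrow>\<^sub>0 'k::field) \<times> ('n \<Rightarrow>\<^sub>0 'k) \<Rightarrow>\<^sub>0 'k) \<Rightarrow> 'm \<times> 'n \<Rightarrow>\<^sub>0 'k" where
  "pair_eval f = linear_extension (\<lambda>x. outer (fst x) (snd x)) f"

definition pair_normal :: "('m \<times> 'n \<Rightarrow>\<^sub>0 'k::field) \<Rightarrow> ('m \<Rightarrow>\<^sub>0 'k) \<times> ('n \<Rightarrow>\<^sub>0 'k) \<Rightarrow>\<^sub>0 'k" where
  "pair_normal p = linear_extension (\<lambda>x. single (single (fst x) 1, single (snd x) 1) 1) p"

lemma pair_eval_simps [simp]:
  "pair_eval 0 = 0"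
  "pair_eval (f + g) = pair_eval f + pair_eval g"
  "pair_eval (f - g) = pair_eval f - pair_eval g"
  "pair_eval (- f) = - pair_eval f"
  "pair_eval (single (a, b) c) = scale c (outer a b)"
  by (simp_all add: pair_eval_def linear_extension_add linear_extension_diff linear_extension_uminus)

lemma pair_normal_simps [simp]:
  "pair_normal 0 = 0"
  "pair_normal (p + q) = pair_normal p + pair_normal q"
  "pair_normal (p - q) = pair_normal p - pair_normal q"
  "pair_normal (- p) = - pair_normal p"
  "pair_normal (scale c p) = scale c (pair_normal p)"
  "pair_normal (single (m, n) c) = single (single m 1, single n 1) c"
  by (simp_all add: pair_normal_def linear_extension_add linear_extension_diff linear_extension_uminus linear_extension_scale)

lemma pair_eval_normal [simp]: "pair_eval (pair_normal p) = p"
  using subset_UNIV[of "keys p"] by (induct rule: poly_mapping_induct_on) auto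

lemma pair_eval_mult:
  fixes f :: "('m::cancel_comm_monoid_add \<Rightarrow>\<^sub>0 'k::field) \<times> ('n::cancel_comm_monoid_add \<Rightarrow>\<^sub>0 'k) \<Rightarrow>\<^sub>0 'k"
  shows "pair_eval (pair_mult f g) = pair_eval f * pair_eval g"
  using subset_UNIV[of "keys f"]
proof (induct rule: poly_mapping_induct_on)
  case (single x c)
  show ?case using subset_UNIV[of "keys g"]
  proof (induct rule: poly_mapping_induct_on)
    case (single y d)
    show ?case by (cases x; cases y) (simp add: outer_mult scale_mult mult.commute[of d c])
  qed (simp_all add: distrib_left)
qed (simp_all add: distrib_right)

lemma pair_normal_mult:
  fixes p q :: "'m::cancel_comm_monoid_add \<times> 'n::cancel_comm_monoid_add \<Rightarrow>\<^sub>0 'k::field"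
  shows "pair_normal (p * q) = pair_mult (pair_normal p) (pair_normal q)"
  using subset_UNIV[of "keys p"]
proof (induct rule: poly_mapping_induct_on)
  case (single x c)
  show ?case using subset_UNIV[of "keys q"]
  proof (induct rule: poly_mapping_induct_on)
    case (single y d)
    show ?case by (cases x; cases y) (simp add: mult_single)
  qed (simp_all add: distrib_left)
qed (simp_all add: distrib_right)

text \<open>The parameter \<open>ty\<close> fixes the field of coefficients, so that the algebras can be abbreviated.\<close>
locale two_graded_monoids =
  X: standard_graded_monoid M d1 + Y: standard_graded_monoid N d2
  for M :: "'m::cancel_comm_monoid_add set" and d1 and N :: "'n::cancel_comm_monoid_add set" and d2 +
  fixes ty :: "'k::field itself"
begin

abbreviation A :: "('k, 'm \<Rightarrow>\<^sub>0 'k) galg" where "A \<equiv> monoid_algebra M d1"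
abbreviation B :: "('k, 'n \<Rightarrow>\<^sub>0 'k) galg" where "B \<equiv> monoid_algebra N d2"
abbreviation "P \<equiv> pair_algebra A B"
abbreviation "I \<equiv> tensor_ideal A B"
abbreviation "T \<equiv> tensor_ring A B"

lemma pair_algebra_simps [simp]:
  "carrier P = {f. keys f \<subseteq> {a. keys a \<subseteq> M} \<times> {b. keys b \<subseteq> N}}"
  "mult P = pair_mult" "one P = single (1, 1) 1" "ring.zero P = 0" "add P = (+)"
proof -
  show "mult P = pair_mult"
    by (intro ext)
      (simp add: pair_algebra_def pair_mult_def linear_extension_def scale_sum case_prod_unfold)
qed (simp_all add: pair_algebra_def)

lemma cring_P: "cring P"
proof (rule cringI)
  show "abelian_group P"
  proof (rule abelian_groupI)
    fix f assume "f \<in> carrier P"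
    then show "\<exists>g\<in>carrier P. g \<oplus>\<^bsub>P\<^esub> f = \<zero>\<^bsub>P\<^esub>"
      by (intro bexI[of _ "- f"]) simp_all
  qed (simp_all add: add_ac keys_add_subset)
  have closed: "keys (pair_mult f g) \<subseteq> {a. keys a \<subseteq> M} \<times> {b. keys b \<subseteq> N}"
    if "keys f \<subseteq> {a. keys a \<subseteq> M} \<times> {b. keys b \<subseteq> N}" "keys g \<subseteq> {a. keys a \<subseteq> M} \<times> {b. keys b \<subseteq> N}"
    for f g :: "('m \<Rightarrow>\<^sub>0 'k) \<times> ('n \<Rightarrow>\<^sub>0 'k) \<Rightarrow>\<^sub>0 'k"
  proof
    fix z assume "z \<in> keys (pair_mult f g)"
    then obtain x y where "x \<in> keys f" "y \<in> keys g" "z = (fst x * fst y, snd x * snd y)"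
      using keys_pair_mult[of f g] by auto
    moreover have "x \<in> {a. keys a \<subseteq> M} \<times> {b. keys b \<subseteq> N}" "y \<in> {a. keys a \<subseteq> M} \<times> {b. keys b \<subseteq> N}"
      using calculation that by blast+
    ultimately show "z \<in> {a. keys a \<subseteq> M} \<times> {b. keys b \<subseteq> N}"
      using X.keys_mult_mem[of "fst x" "fst y"] Y.keys_mult_mem[of "snd x" "snd y"] by (simp add: mem_Times_iff)
  qed
  show "Group.comm_monoid P"
    by (rule comm_monoidI)
      (simp_all add: pair_mult_assoc closed pair_mult_one X.zero_mem Y.zero_mem,
       rule pair_mult_comm)
qed simp

lemma relations_carrier: "bilinear_relations A B \<subseteq> carrier P"
proof -
  have sub: "keys (f - g) \<subseteq> S" if "keys f \<subseteq> S" "keys g \<subseteq> S"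
    for f g :: "('m \<Rightarrow>\<^sub>0 'k) \<times> ('n \<Rightarrow>\<^sub>0 'k) \<Rightarrow>\<^sub>0 'k" and S
    using that keys_diff[of f g] by blast
  show ?thesis
  proof
    fix r assume "r \<in> bilinear_relations A B"
    then show "r \<in> carrier P"
      unfolding bilinear_relations_def pair_algebra_simps mem_Collect_eq
      by (elim UnE CollectE exE conjE; hypsubst; intro sub)
        (simp_all add: keys_add_subset order.trans[OF keys_scale])
  qed
qed

lemma ideal_I: "ideal I P"
  unfolding tensor_ideal_def by (rule ring.genideal_ideal[OF cring.axioms(1)[OF cring_P] relations_carrier])

lemma I_relations: "bilinear_relations A B \<subseteq> I"
  unfolding tensor_ideal_def by (rule ring.genideal_self[OF cring.axioms(1)[OF cring_P] relations_carrier])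

lemma a_inv_P: "f \<in> carrier P \<Longrightarrow> \<ominus>\<^bsub>P\<^esub> f = - f"
proof -
  interpret P: cring P by (rule cring_P)
  assume "f \<in> carrier P"
  then show ?thesis by (intro P.minus_equality) simp_all
qed

lemma I_carrier: "f \<in> I \<Longrightarrow> f \<in> carrier P"
  using ideal.Icarr[OF ideal_I] .

lemma I_zero: "0 \<in> I"
  using additive_subgroup.zero_closed[OF ideal.axioms(1)[OF ideal_I]] by simp

lemma I_add: "f \<in> I \<Longrightarrow> g \<in> I \<Longrightarrow> f + g \<in> I"
  using additive_subgroup.a_closed[OF ideal.axioms(1)[OF ideal_I]] by simp

lemma I_scale: "f \<in> I \<Longrightarrow> scale c f \<in> I"
  using ideal.I_l_closed[OF ideal_I, of f "single (1, 1) c"]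
  by (simp add: pair_mult_one X.zero_mem Y.zero_mem)

lemma I_uminus: "f \<in> I \<Longrightarrow> - f \<in> I"
  using I_scale[of f "- 1"] by (simp add: scale_uminus)

text \<open>Evaluation is a ring homomorphism that respects all bilinearity relations, so it vanishes on the
ideal that they generate.\<close>
lemma pair_eval_I: "f \<in> I \<Longrightarrow> pair_eval f = 0"
proof -
  interpret P: cring P by (rule cring_P)
  have "ideal {f \<in> carrier P. pair_eval f = 0} P"
  proof (rule idealI[OF P.ring_axioms])
    show "subgroup {f \<in> carrier P. pair_eval f = 0} (add_monoid P)"
    proof (rule P.add.subgroupI)
      show "{f \<in> carrier P. pair_eval f = 0} \<noteq> {}" by (auto intro: exI[of _ 0])
      show "\<ominus>\<^bsub>P\<^esub> f \<in> {f \<in> carrier P. pair_eval f = 0}" if "f \<in> {f \<in> carrier P. pair_eval f = 0}" for f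
        using that a_inv_P[of f] by simp
    qed (auto simp: keys_add_subset)
    show "f \<otimes>\<^bsub>P\<^esub> g \<in> {f \<in> carrier P. pair_eval f = 0}"
      if "g \<in> {f \<in> carrier P. pair_eval f = 0}" "f \<in> carrier P" for f g
      using that P.m_closed[of f g] by (simp add: pair_eval_mult)
    show "g \<otimes>\<^bsub>P\<^esub> f \<in> {f \<in> carrier P. pair_eval f = 0}"
      if "g \<in> {f \<in> carrier P. pair_eval f = 0}" "f \<in> carrier P" for f g
      using that P.m_closed[of g f] by (simp add: pair_eval_mult)
  qed
  moreover have "bilinear_relations A B \<subseteq> {f. pair_eval f = 0}"
    unfolding bilinear_relations_def by auto
  ultimately have "I \<subseteq> {f \<in> carrier P. pair_eval f = 0}"
    unfolding tensor_ideal_def using relations_carrier by (intro P.genideal_minimal) blast+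
  then show "pair_eval f = 0" if "f \<in> I" using that by blast
qed

text \<open>The relations allow \<open>(a, b)\<close> to be expanded linearly, first in \<open>a\<close> and then in \<open>b\<close>, until only
pairs of monomials are left.\<close>
lemma pair_reduction_pure:
  assumes "keys a \<subseteq> M" "keys b \<subseteq> N"
  shows "single (a, b) 1 - pair_normal (outer a b) \<in> I"
proof -
  let ?R = "\<lambda>a b. single (a, b) 1 - pair_normal (outer a b) :: ('m \<Rightarrow>\<^sub>0 'k) \<times> ('n \<Rightarrow>\<^sub>0 'k) \<Rightarrow>\<^sub>0 'k"
  have add_left: "single (a + a', b) 1 - single (a, b) 1 - single (a', b) 1 \<in> I"
    if "keys a \<subseteq> M" "keys a' \<subseteq> M" "keys b \<subseteq> N" for a a' b
    by (rule subsetD[OF I_relations], unfold bilinear_relations_def, rule UnI1, rule UnI1, rule UnI1,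
        intro CollectI exI[of _ a] exI[of _ a'] exI[of _ b]) (simp add: that)
  have add_right: "single (a, b + b') 1 - single (a, b) 1 - single (a, b') 1 \<in> I"
    if "keys a \<subseteq> M" "keys b \<subseteq> N" "keys b' \<subseteq> N" for a b b'
    by (rule subsetD[OF I_relations], unfold bilinear_relations_def, rule UnI1, rule UnI1, rule UnI2,
        intro CollectI exI[of _ a] exI[of _ b] exI[of _ b']) (simp add: that)
  have scale_left: "single (scale c a, b) 1 - single (a, b) c \<in> I"
    if "keys a \<subseteq> M" "keys b \<subseteq> N" for a b c
    by (rule subsetD[OF I_relations], unfold bilinear_relations_def, rule UnI1, rule UnI2,
        intro CollectI exI[of _ c] exI[of _ a] exI[of _ b]) (simp add: that)
  have scale_right: "single (a, scale c b) 1 - single (a, b) c \<in> I"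
    if "keys a \<subseteq> M" "keys b \<subseteq> N" for a b c
    by (rule subsetD[OF I_relations], unfold bilinear_relations_def, rule UnI2,
        intro CollectI exI[of _ c] exI[of _ a] exI[of _ b]) (simp add: that)
  have scale_R: "scale c (?R a b) = single (a, b) c - scale c (pair_normal (outer a b))" for a b c
    by (rule poly_mapping_eqI) (simp add: lookup_minus lookup_single when_def algebra_simps)
  show ?thesis using assms(1)
  proof (induct rule: poly_mapping_induct_on)
    case zero
    \<comment> \<open>additivity at \<open>0 + 0\<close> puts \<open>(0, b)\<close> into the ideal\<close>
    show ?case using I_uminus[OF add_left[of 0 0 b]] assms(2) by simp
  next
    case (add a a')
    have "single (a + a', b) 1 - single (a, b) 1 - single (a', b) 1 + (?R a b + ?R a' b) \<in> I"
      by (intro I_add add_left add assms)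
    then show ?case by (simp add: algebra_simps)
  next
    case (single m c)
    have "?R (single m 1) b \<in> I" using assms(2)
    proof (induct rule: poly_mapping_induct_on)
      case zero
      show ?case using I_uminus[OF add_right[of "single m 1" 0 0]] single by simp
    next
      case (add b b')
      have "single (single m 1, b + b') 1 - single (single m 1, b) 1 - single (single m 1, b') 1
          + (?R (single m 1) b + ?R (single m 1) b') \<in> I"
        using single by (intro I_add add_right add) auto
      then show ?case by (simp add: algebra_simps)
    next
      case (single n d)
      have "single (single m 1, scale d (single n 1)) 1 - single (single m 1, single n 1) d \<in> I"
        using single \<open>m \<in> M\<close> by (intro scale_right) auto
      then show ?case by simp
    qed
    then have "single (scale c (single m 1), b) 1 - single (single m 1, b) c + scale c (?R (single m 1) b) \<in> I"
      using single assms(2) by (intro I_add scale_left I_scale) auto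
    then have "single (scale c (single m 1), b) 1 - pair_normal (outer (scale c (single m 1)) b) \<in> I"
      unfolding scale_R by (simp del: scale_simps(7))
    then show ?case by simp
  qed
qed

lemma pair_reduction:
  assumes "f \<in> carrier P"
  shows "f - pair_normal (pair_eval f) \<in> I"
proof -
  have "keys f \<subseteq> {a. keys a \<subseteq> M} \<times> {b. keys b \<subseteq> N}" using assms by simp
  then show ?thesis
  proof (induct rule: poly_mapping_induct_on)
    case zero
    show ?case using I_zero by simp
  next
    case (single x c)
    then obtain a b where x: "x = (a, b)" "keys a \<subseteq> M" "keys b \<subseteq> N" by auto
    have "scale c (single (a, b) 1 - pair_normal (outer a b)) \<in> I"
      by (intro I_scale pair_reduction_pure x)
    moreover have "scale c (single (a, b) 1 - pair_normal (outer a b))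
        = single (a, b) c - scale c (pair_normal (outer a b))"
      by (rule poly_mapping_eqI) (simp add: lookup_minus lookup_single when_def algebra_simps)
    ultimately show ?case using x by simp
  next
    case (add f g)
    then show ?case using I_add[OF add(3,4)] by (simp add: algebra_simps)
  qed
qed

definition to_tensor :: "('m \<times> 'n \<Rightarrow>\<^sub>0 'k) \<Rightarrow> (('m \<Rightarrow>\<^sub>0 'k) \<times> ('n \<Rightarrow>\<^sub>0 'k) \<Rightarrow>\<^sub>0 'k) set" where
  "to_tensor p = I +>\<^bsub>P\<^esub> pair_normal p"

lemma pair_normal_carrier: "keys p \<subseteq> M \<times> N \<Longrightarrow> pair_normal p \<in> carrier P"
  by (induct rule: poly_mapping_induct_on) (auto simp: keys_add_subset split: if_splits)

lemma pair_eval_carrier: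
  assumes "f \<in> carrier P"
  shows "keys (pair_eval f) \<subseteq> M \<times> N"
proof -
  have "keys f \<subseteq> {a. keys a \<subseteq> M} \<times> {b. keys b \<subseteq> N}" using assms by simp
  then show ?thesis
  proof (induct rule: poly_mapping_induct_on)
    case (single x c)
    then show ?case
      using order.trans[OF keys_scale keys_outer[of "fst x" "snd x"], of c]
      by (cases x) (fastforce simp: mem_Times_iff)
  qed (simp_all add: keys_add_subset)
qed

lemma coset_eq_iff:
  assumes "f \<in> carrier P" "g \<in> carrier P"
  shows "I +>\<^bsub>P\<^esub> f = I +>\<^bsub>P\<^esub> g \<longleftrightarrow> f - g \<in> I"
proof -
  interpret P: cring P by (rule cring_P)
  have "f \<ominus>\<^bsub>P\<^esub> g = f - g" using assms by (simp add: a_minus_def a_inv_P del: pair_algebra_simps(1))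
  then show ?thesis using P.quotient_eq_iff_same_a_r_cos[OF ideal_I assms] by simp
qed

text \<open>Surjectivity of the normal form map onto the quotient.\<close>
lemma coset_eq_to_tensor:
  assumes "f \<in> carrier P"
  shows "I +>\<^bsub>P\<^esub> f = to_tensor (pair_eval f)"
  unfolding to_tensor_def
  by (subst coset_eq_iff)
    (use assms pair_reduction pair_normal_carrier pair_eval_carrier in \<open>blast+\<close>)

lemma to_tensor_add:
  assumes "keys p \<subseteq> M \<times> N" "keys q \<subseteq> M \<times> N"
  shows "to_tensor (p + q) = to_tensor p \<oplus>\<^bsub>T\<^esub> to_tensor q"
  using ring_hom_add[OF ideal.rcos_ring_hom[OF ideal_I] pair_normal_carrier[OF assms(1)] pair_normal_carrier[OF assms(2)]]
  by (simp add: to_tensor_def tensor_ring_def)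

lemma to_tensor_mult:
  assumes "keys p \<subseteq> M \<times> N" "keys q \<subseteq> M \<times> N"
  shows "to_tensor (p * q) = to_tensor p \<otimes>\<^bsub>T\<^esub> to_tensor q"
  using ring_hom_mult[OF ideal.rcos_ring_hom[OF ideal_I] pair_normal_carrier[OF assms(1)] pair_normal_carrier[OF assms(2)]]
  by (simp add: to_tensor_def tensor_ring_def pair_normal_mult)

lemma to_tensor_one: "to_tensor 1 = \<one>\<^bsub>T\<^esub>"
proof -
  have "pair_normal (single (0, 0) 1 :: 'm \<times> 'n \<Rightarrow>\<^sub>0 'k) = single (1, 1) 1"
    by simp
  then have "pair_normal (1 :: 'm \<times> 'n \<Rightarrow>\<^sub>0 'k) = \<one>\<^bsub>P\<^esub>" by (simp flip: zero_prod_def)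
  then show ?thesis by (simp add: to_tensor_def tensor_ring_def FactRing_def)
qed

text \<open>Evaluation is a left inverse that is well defined on cosets.\<close>
lemma inj_to_tensor: "inj_on to_tensor {p. keys p \<subseteq> M \<times> N}"
proof (rule inj_onI)
  fix p q :: "'m \<times> 'n \<Rightarrow>\<^sub>0 'k"
  assume "p \<in> {p. keys p \<subseteq> M \<times> N}" "q \<in> {p. keys p \<subseteq> M \<times> N}" "to_tensor p = to_tensor q"
  then have "pair_normal p - pair_normal q \<in> I"
    unfolding to_tensor_def by (subst (asm) coset_eq_iff) (auto intro!: pair_normal_carrier simp del: pair_algebra_simps)
  from pair_eval_I[OF this] show "p = q" by simp
qed

lemma carrier_T: "carrier T = to_tensor ` {p. keys p \<subseteq> M \<times> N}"
proof -
  have "carrier T = (\<lambda>f. I +>\<^bsub>P\<^esub> f) ` carrier P"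
    by (auto simp: tensor_ring_def FactRing_def A_RCOSETS_def' a_r_coset_def' simp del: pair_algebra_simps)
  also have "\<dots> = to_tensor ` {p. keys p \<subseteq> M \<times> N}"
  proof (intro equalityI subsetI)
    fix z assume "z \<in> (\<lambda>f. I +>\<^bsub>P\<^esub> f) ` carrier P"
    then obtain f where "f \<in> carrier P" "z = I +>\<^bsub>P\<^esub> f" by blast
    then show "z \<in> to_tensor ` {p. keys p \<subseteq> M \<times> N}"
      using coset_eq_to_tensor[of f] pair_eval_carrier[of f] by blast
  next
    fix z assume "z \<in> to_tensor ` {p. keys p \<subseteq> M \<times> N}"
    then show "z \<in> (\<lambda>f. I +>\<^bsub>P\<^esub> f) ` carrier P"
      unfolding to_tensor_def using pair_normal_carrier by blast
  qed
  finally show ?thesis .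
qed

lemma zero_T: "\<zero>\<^bsub>T\<^esub> = to_tensor 0"
proof -
  have "I +>\<^bsub>P\<^esub> \<zero>\<^bsub>P\<^esub> = I"
    using ring.a_rcos_zero[OF cring.axioms(1)[OF cring_P] ideal_I I_zero] by simp
  then show ?thesis by (simp add: to_tensor_def tensor_ring_def FactRing_def)
qed

lemma ring_T: "ring T"
  unfolding tensor_ring_def by (rule ideal.quotient_is_ring[OF ideal_I])

lemma a_inv_T:
  assumes "keys p \<subseteq> M \<times> N"
  shows "\<ominus>\<^bsub>T\<^esub> to_tensor p = to_tensor (- p)"
proof -
  interpret T: ring T by (rule ring_T)
  have "to_tensor (- p) \<oplus>\<^bsub>T\<^esub> to_tensor p = \<zero>\<^bsub>T\<^esub>"
    using to_tensor_add[of "- p" p] assms by (simp add: zero_T)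
  then show ?thesis
    by (rule T.minus_equality) (use assms in \<open>auto simp: carrier_T\<close>)
qed

lemma pure_tensor_eq:
  assumes "keys a \<subseteq> M" "keys b \<subseteq> N"
  shows "pure_tensor A B a b = to_tensor (outer a b)"
  unfolding pure_tensor_def using coset_eq_to_tensor[of "single (a, b) 1"] assms by simp

lemma smult_tensor:
  assumes "keys p \<subseteq> M \<times> N"
  shows "(\<Union>x\<in>to_tensor p. I +>\<^bsub>P\<^esub> Poly_Mapping.map ((*) c) x) = to_tensor (scale c p)"
proof -
  have "I +>\<^bsub>P\<^esub> Poly_Mapping.map ((*) c) x = to_tensor (scale c p)" if x: "x \<in> to_tensor p" for x
  proof -
    obtain i where i: "i \<in> I" "x = i + pair_normal p"
      using x unfolding to_tensor_def by (auto simp: a_r_coset_def')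
    have carr: "scale c x \<in> carrier P" "scale c (pair_normal p) \<in> carrier P"
      using I_carrier[OF i(1)] pair_normal_carrier[OF assms] unfolding i(2)
      by (simp_all add: keys_add_subset order.trans[OF keys_scale])
    have "scale c x - scale c (pair_normal p) \<in> I"
      using I_scale[OF i(1)] by (simp add: i(2))
    then show ?thesis
      using coset_eq_iff[OF carr] by (simp add: to_tensor_def scale_def[symmetric])
  qed
  moreover have "pair_normal p \<in> to_tensor p"
    unfolding to_tensor_def a_r_coset_def' using I_zero by force
  ultimately show ?thesis by blast
qed

text \<open>The bigraded pieces of the tensor product correspond to the pairs of monomials with the given pairs
of degrees: a pure tensor of homogeneous elements expands into such pairs, and each such pair is a
pure tensor itself.\<close>
lemma tensor_part_eq:
  "tensor_part A B D = to_tensor ` {p. keys p \<subseteq> {x \<in> M \<times> N. (d1 (fst x), d2 (snd x)) \<in> D}}"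
  (is "?L = to_tensor ` {p. keys p \<subseteq> ?S}")
proof -
  interpret T: ring T by (rule ring_T)
  let ?H = "{pure_tensor A B a b |a b i j. (i, j) \<in> D \<and> a \<in> hpart A i \<and> b \<in> hpart B j}"
  have S: "?S \<subseteq> M \<times> N" by blast
  have H: "?H \<subseteq> to_tensor ` {p. keys p \<subseteq> ?S}"
  proof
    fix z assume "z \<in> ?H"
    then obtain a b i j where z: "z = pure_tensor A B a b" "(i, j) \<in> D"
      "keys a \<subseteq> {m \<in> M. d1 m = i}" "keys b \<subseteq> {n \<in> N. d2 n = j}" by auto
    then have "keys a \<subseteq> M" "keys b \<subseteq> N" by blast+
    then have "z = to_tensor (outer a b)" using z(1) pure_tensor_eq[of a b] by simp
    moreover have "keys (outer a b) \<subseteq> ?S" using keys_outer[of a b] z by fastforce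
    ultimately show "z \<in> to_tensor ` {p. keys p \<subseteq> ?S}" by blast
  qed
  show ?thesis
    unfolding tensor_part_def
  proof (intro equalityI subsetI)
    fix z assume "z \<in> generate (add_monoid T) ?H"
    then show "z \<in> to_tensor ` {p. keys p \<subseteq> ?S}"
    proof (induct rule: generate.induct)
      case one
      show ?case by (rule image_eqI[of _ _ 0]) (simp_all add: zero_T)
    next
      case (incl h)
      then show ?case using H by blast
    next
      case (inv h)
      then obtain p where p: "h = to_tensor p" "keys p \<subseteq> ?S" using H by blast
      then have "\<ominus>\<^bsub>T\<^esub> h = to_tensor (- p)" using a_inv_T[of p] S by blast
      then show ?case using p by (intro image_eqI[of _ _ "- p"]) (simp_all add: a_inv_def)
    next
      case (eng h1 h2)
      then obtain p q where pq: "h1 = to_tensor p" "keys p \<subseteq> ?S" "h2 = to_tensor q" "keys q \<subseteq> ?S" by blast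
      then have "h1 \<oplus>\<^bsub>T\<^esub> h2 = to_tensor (p + q)" using to_tensor_add[of p q] order.trans[OF _ S] by simp
      then show ?case using pq by (intro image_eqI[of _ _ "p + q"]) (simp_all add: keys_add_subset)
    qed
  next
    fix z assume "z \<in> to_tensor ` {p. keys p \<subseteq> ?S}"
    then obtain p where p: "z = to_tensor p" "keys p \<subseteq> ?S" by blast
    have "to_tensor p \<in> generate (add_monoid T) ?H" using p(2)
    proof (induct rule: poly_mapping_induct_on)
      case zero
      show ?case using generate.one[of "add_monoid T" ?H] by (simp add: zero_T)
    next
      case (single x c)
      then obtain m n where x: "x = (m, n)" "m \<in> M" "n \<in> N" "(d1 m, d2 n) \<in> D" by auto
      have "to_tensor (single x c) = pure_tensor A B (single m c) (single n 1)"
        using x by (subst pure_tensor_eq) auto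
      also have "\<dots> \<in> ?H" using x by (intro CollectI exI conjI refl) (assumption | simp)+
      finally show ?case by (rule generate.incl)
    next
      case (add p q)
      then show ?case
        using generate.eng[OF add(3,4)] to_tensor_add[OF order.trans[OF add(1) S] order.trans[OF add(2) S]] by simp
    qed
    then show "z \<in> generate (add_monoid T) ?H" using p(1) by simp
  qed
qed

text \<open>The normal form map is multiplicative, evaluation makes it bijective onto the quotient, and the
pairs \<open>(i, j)\<close> with \<open>i + j = d\<close> give the grading by the total degree.\<close>
theorem monoid_algebra_tensor:
  "monoid_algebra (M \<times> N) (\<lambda>x. d1 (fst x) + d2 (snd x)) \<cong>\<^sub>g tensor_product A B"
  unfolding galg_iso_def
proof (intro bexI[of _ to_tensor] conjI allI ballI)
  show "to_tensor \<in> ring_iso (monoid_algebra (M \<times> N) (\<lambda>x. d1 (fst x) + d2 (snd x))) (tensor_product A B)"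
    unfolding ring_iso_def ring_hom_def
    by (simp add: tensor_product_def carrier_T to_tensor_add to_tensor_mult to_tensor_one
        bij_betw_def inj_to_tensor)
  show "to_tensor (c \<odot>\<^bsub>monoid_algebra (M \<times> N) (\<lambda>x. d1 (fst x) + d2 (snd x))\<^esub> p)
      = c \<odot>\<^bsub>tensor_product A B\<^esub> to_tensor p"
    if "p \<in> carrier (monoid_algebra (M \<times> N) (\<lambda>x. d1 (fst x) + d2 (snd x)))" for c p
    using that smult_tensor[of p c] by (simp add: tensor_product_def)
  show "to_tensor ` hpart (monoid_algebra (M \<times> N) (\<lambda>x. d1 (fst x) + d2 (snd x))) d = hpart (tensor_product A B) d" for d
    by (simp add: tensor_product_def tensor_part_eq)
qed

text \<open>The same map, restricted to the diagonal bidegrees: the pairs of monomials that occur there form the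
fibre product of the two monoids over their degrees.\<close>
theorem monoid_algebra_segre:
  "monoid_algebra {x \<in> M \<times> N. d1 (fst x) = d2 (snd x)} (\<lambda>x. d1 (fst x)) \<cong>\<^sub>g segre_product A B"
    (is "monoid_algebra ?S ?d \<cong>\<^sub>g _")
  unfolding galg_iso_def
proof (intro bexI[of _ to_tensor] conjI allI ballI)
  have sub: "keys p \<subseteq> M \<times> N" if "keys p \<subseteq> ?S" for p :: "'m \<times> 'n \<Rightarrow>\<^sub>0 'k" using that by blast
  have inj: "inj_on to_tensor {p. keys p \<subseteq> ?S}"
    by (rule inj_on_subset[OF inj_to_tensor]) (use sub in blast)
  have carr: "carrier (segre_product A B) = to_tensor ` {p. keys p \<subseteq> ?S}"
    by (simp add: segre_product_def tensor_part_eq)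
  show "to_tensor \<in> ring_iso (monoid_algebra ?S ?d) (segre_product A B)"
    unfolding ring_iso_def ring_hom_def
    by (simp add: carr bij_betw_def inj to_tensor_add to_tensor_mult sub)
       (simp add: segre_product_def tensor_product_def to_tensor_add to_tensor_mult to_tensor_one sub)
  show "to_tensor (c \<odot>\<^bsub>monoid_algebra ?S ?d\<^esub> p) = c \<odot>\<^bsub>segre_product A B\<^esub> to_tensor p"
    if "p \<in> carrier (monoid_algebra ?S ?d)" for c p
    using smult_tensor[OF sub, of p c] that by (simp add: segre_product_def tensor_product_def)
  show "to_tensor ` hpart (monoid_algebra ?S ?d) d = hpart (segre_product A B) d" for d
  proof -
    have "{x \<in> ?S. ?d x = d} = {x \<in> M \<times> N. (d1 (fst x), d2 (snd x)) \<in> {(d, d)}}" by auto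
    then show ?thesis by (simp add: segre_product_def tensor_part_eq)
  qed
qed

end

section \<open>Monoids built from the natural numbers\<close>

lemma graded_iso_trans:
  assumes "graded_iso \<phi> M d N d'" "graded_iso \<psi> N d' L d''"
  shows "graded_iso (\<psi> \<circ> \<phi>) M d L d''"
proof -
  have "\<phi> a \<in> N" if "a \<in> M" for a using assms(1) that by (auto simp: graded_iso_def bij_betw_def)
  then show ?thesis using assms by (auto simp: graded_iso_def intro: bij_betw_trans)
qed

lemma (in standard_graded_monoid) graded_iso_inverse:
  assumes "graded_iso \<phi> M dg N d'"
  shows "graded_iso (inv_into M \<phi>) N d' M dg"
proof -
  have N: "N = \<phi> ` M" and inj: "inj_on \<phi> M" and add: "\<And>a b. a \<in> M \<Longrightarrow> b \<in> M \<Longrightarrow> \<phi> a + \<phi> b = \<phi> (a + b)"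
    and d: "\<And>a. a \<in> M \<Longrightarrow> d' (\<phi> a) = dg a"
    using assms by (auto simp: graded_iso_def bij_betw_def)
  show ?thesis
    unfolding graded_iso_def
  proof (intro conjI ballI)
    show "bij_betw (inv_into M \<phi>) N M"
      using assms by (simp add: graded_iso_def bij_betw_inv_into)
  qed (auto simp: N inj add add_mem d)
qed

lemma standard_graded_product:
  assumes "standard_graded_monoid M d1" "standard_graded_monoid N d2"
  shows "standard_graded_monoid (M \<times> N) (\<lambda>x. d1 (fst x) + d2 (snd x))"
proof -
  interpret X: standard_graded_monoid M d1 by fact
  interpret Y: standard_graded_monoid N d2 by fact
  show ?thesis
  proof
    show "0 \<in> M \<times> N" by (simp add: zero_prod_def X.zero_mem Y.zero_mem)
    show "a + b \<in> M \<times> N" if "a \<in> M \<times> N" "b \<in> M \<times> N" for a b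
      using that by (auto simp: mem_Times_iff X.add_mem Y.add_mem)
    show "d1 (fst (a + b)) + d2 (snd (a + b)) = d1 (fst a) + d2 (snd a) + (d1 (fst b) + d2 (snd b))"
      if "a \<in> M \<times> N" "b \<in> M \<times> N" for a b
      using that by (auto simp: mem_Times_iff X.deg_add Y.deg_add)
    show "a = 0" if "a \<in> M \<times> N" "d1 (fst a) + d2 (snd a) = 0" for a
      using that X.deg_eq_0[of "fst a"] Y.deg_eq_0[of "snd a"] by (auto simp: prod_eq_iff)
    show "\<exists>s\<in>M \<times> N. \<exists>r\<in>M \<times> N. d1 (fst s) + d2 (snd s) = 1 \<and> a = s + r"
      if a: "a \<in> M \<times> N" "a \<noteq> 0" for a
    proof (cases "fst a = 0")
      case False
      then obtain s r where "s \<in> M" "r \<in> M" "d1 s = 1" "fst a = s + r"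
        using X.split_deg_1[of "fst a"] a by auto
      then show ?thesis using a Y.zero_mem
        by (intro bexI[of _ "(s, 0)"] bexI[of _ "(r, snd a)"]) (auto simp: prod_eq_iff)
    next
      case True
      then have "snd a \<noteq> 0" using a by (auto simp: prod_eq_iff)
      then obtain s r where "s \<in> N" "r \<in> N" "d2 s = 1" "snd a = s + r"
        using Y.split_deg_1[of "snd a"] a by auto
      then show ?thesis using a X.zero_mem
        by (intro bexI[of _ "(0, s)"] bexI[of _ "(fst a, r)"]) (auto simp: prod_eq_iff)
    qed
  qed
qed

lemma standard_graded_fibre_product:
  assumes "standard_graded_monoid M d1" "standard_graded_monoid N d2"
  shows "standard_graded_monoid {x \<in> M \<times> N. d1 (fst x) = d2 (snd x)} (\<lambda>x. d1 (fst x))"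
    (is "standard_graded_monoid ?S _")
proof -
  interpret X: standard_graded_monoid M d1 by fact
  interpret Y: standard_graded_monoid N d2 by fact
  show ?thesis
  proof
    show "0 \<in> ?S" by (simp add: zero_prod_def X.zero_mem Y.zero_mem)
    show "a + b \<in> ?S" if "a \<in> ?S" "b \<in> ?S" for a b
      using that by (auto simp: mem_Times_iff X.add_mem Y.add_mem X.deg_add Y.deg_add)
    show "d1 (fst (a + b)) = d1 (fst a) + d1 (fst b)" if "a \<in> ?S" "b \<in> ?S" for a b
      using that by (auto simp: mem_Times_iff X.deg_add)
    show "a = 0" if "a \<in> ?S" "d1 (fst a) = 0" for a
      using that X.deg_eq_0[of "fst a"] Y.deg_eq_0[of "snd a"] by (auto simp: prod_eq_iff)
    show "\<exists>s\<in>?S. \<exists>r\<in>?S. d1 (fst s) = 1 \<and> a = s + r" if a: "a \<in> ?S" "a \<noteq> 0" for a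
    proof -
      have mem: "fst a \<in> M" "snd a \<in> N" and eq: "d1 (fst a) = d2 (snd a)" using a by auto
      have "fst a \<noteq> 0" "snd a \<noteq> 0"
        using a(2) eq X.deg_eq_0[OF mem(1)] Y.deg_eq_0[OF mem(2)] by (auto simp: prod_eq_iff)
      then obtain s r s' r' where *: "s \<in> M" "r \<in> M" "d1 s = 1" "fst a = s + r"
        "s' \<in> N" "r' \<in> N" "d2 s' = 1" "snd a = s' + r'"
        using X.split_deg_1[OF mem(1)] Y.split_deg_1[OF mem(2)] by blast
      moreover have "d1 r = d2 r'" using eq * by (simp add: X.deg_add Y.deg_add)
      ultimately show ?thesis
        by (intro bexI[of _ "(s, s')"] bexI[of _ "(r, r')"]) (auto simp: prod_eq_iff)
    qed
  qed
qed

text \<open>Constructible algebras live on one fixed carrier type.  Asking only for an isomorphic copy inside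
\<open>nat \<Rightarrow>\<^sub>0 nat\<close> turns this into a property of graded monoids of any type, stable under isomorphism.\<close>
definition constructible_monoid ::
    "'k::field itself \<Rightarrow> 'm::cancel_comm_monoid_add set \<Rightarrow> ('m \<Rightarrow> nat) \<Rightarrow> bool" where
  "constructible_monoid ty M d \<longleftrightarrow>
     (\<exists>(M' :: (nat \<Rightarrow>\<^sub>0 nat) set) d' \<phi>. standard_graded_monoid M' d' \<and> graded_iso \<phi> M' d' M d \<and>
        constructible (monoid_algebra M' d' :: ('k, (nat, 'k) mpoly) galg))"

lemma constructible_monoid_iso:
  assumes "constructible_monoid ty M d" "graded_iso \<phi> M d N d'"
  shows "constructible_monoid ty N d'"
  using assms unfolding constructible_monoid_def by (meson graded_iso_trans)

lemma graded_iso_image: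
  fixes \<phi> :: "'a::cancel_comm_monoid_add \<Rightarrow> 'b::cancel_comm_monoid_add"
  assumes "inj \<phi>" "\<And>a b. \<phi> (a + b) = \<phi> a + \<phi> b"
  shows "graded_iso \<phi> M d (\<phi> ` M) (d \<circ> inv_into UNIV \<phi>)" "graded_iso (inv_into UNIV \<phi>) (\<phi> ` M) (d \<circ> inv_into UNIV \<phi>) M d"
  using assms by (auto simp: graded_iso_def bij_betw_def inj_on_def image_image inv_f_f[OF assms(1)] simp flip: assms(2))

text \<open>A product of two monoids of exponent vectors embeds into exponent vectors again: the first factor
uses the even variables and the second factor the odd ones.\<close>
definition interleave :: "(nat \<Rightarrow>\<^sub>0 nat) \<times> (nat \<Rightarrow>\<^sub>0 nat) \<Rightarrow> nat \<Rightarrow>\<^sub>0 nat" where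
  "interleave x = Abs_poly_mapping
     (\<lambda>k. if even k then lookup (fst x) (k div 2) else lookup (snd x) (k div 2))"

lemma lookup_interleave:
  "lookup (interleave x) k = (if even k then lookup (fst x) (k div 2) else lookup (snd x) (k div 2))"
proof -
  let ?g = "\<lambda>k. if even k then lookup (fst x) (k div 2) else lookup (snd x) (k div 2)"
  have "{k. ?g k \<noteq> 0} \<subseteq> (\<lambda>i. 2 * i) ` keys (fst x) \<union> (\<lambda>i. 2 * i + 1) ` keys (snd x)"
  proof
    fix k assume k: "k \<in> {k. ?g k \<noteq> 0}"
    show "k \<in> (\<lambda>i. 2 * i) ` keys (fst x) \<union> (\<lambda>i. 2 * i + 1) ` keys (snd x)"
    proof (cases "even k")
      case True
      then show ?thesis using k by (intro UnI1 image_eqI[of _ _ "k div 2"]) (auto simp: in_keys_iff)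
    next
      case False
      then show ?thesis using k by (intro UnI2 image_eqI[of _ _ "k div 2"]) (auto simp: in_keys_iff)
    qed
  qed
  then have "finite {k. ?g k \<noteq> 0}" by (rule finite_subset) simp
  then show ?thesis unfolding interleave_def by simp
qed

lemma interleave_add: "interleave (x + y) = interleave x + interleave y"
  by (rule poly_mapping_eqI) (simp add: lookup_interleave lookup_add)

lemma inj_interleave: "inj interleave"
proof (rule injI)
  fix x y :: "(nat \<Rightarrow>\<^sub>0 nat) \<times> (nat \<Rightarrow>\<^sub>0 nat)" assume eq: "interleave x = interleave y"
  have "lookup (fst x) k = lookup (fst y) k" for k
    using arg_cong[OF eq, of "\<lambda>p. lookup p (2 * k)"] by (simp add: lookup_interleave)
  moreover have "lookup (snd x) k = lookup (snd y) k" for k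
    using arg_cong[OF eq, of "\<lambda>p. lookup p (2 * k + 1)"] by (simp add: lookup_interleave)
  ultimately show "x = y" by (intro prod_eqI poly_mapping_eqI)
qed

lemma graded_iso_product:
  assumes f: "graded_iso f M d1 M' d1'" and g: "graded_iso g N d2 N' d2'"
  shows "graded_iso (map_prod f g) (M \<times> N) (\<lambda>x. d1 (fst x) + d2 (snd x)) (M' \<times> N') (\<lambda>x. d1' (fst x) + d2' (snd x))"
    and "graded_iso (map_prod f g) {x \<in> M \<times> N. d1 (fst x) = d2 (snd x)} (\<lambda>x. d1 (fst x))
      {x \<in> M' \<times> N'. d1' (fst x) = d2' (snd x)} (\<lambda>x. d1' (fst x))"
proof -
  have inj: "inj_on (map_prod f g) (M \<times> N)"
    using f g by (auto simp: graded_iso_def bij_betw_def inj_on_def)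
  have img: "M' = f ` M" "N' = g ` N" using f g by (auto simp: graded_iso_def bij_betw_def)
  show "graded_iso (map_prod f g) (M \<times> N) (\<lambda>x. d1 (fst x) + d2 (snd x)) (M' \<times> N') (\<lambda>x. d1' (fst x) + d2' (snd x))"
    using f g inj unfolding graded_iso_def bij_betw_def by (auto simp: map_prod_surj_on)
  have "map_prod f g ` {x \<in> M \<times> N. d1 (fst x) = d2 (snd x)} = {x \<in> M' \<times> N'. d1' (fst x) = d2' (snd x)}"
    using f g unfolding img by (force simp: graded_iso_def)
  then show "graded_iso (map_prod f g) {x \<in> M \<times> N. d1 (fst x) = d2 (snd x)} (\<lambda>x. d1 (fst x))
      {x \<in> M' \<times> N'. d1' (fst x) = d2' (snd x)} (\<lambda>x. d1' (fst x))"
    using f g inj_on_subset[OF inj, of "{x \<in> M \<times> N. d1 (fst x) = d2 (snd x)}"]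
    unfolding graded_iso_def bij_betw_def by auto
qed

text \<open>Tensor and Segre products of the two copies are carried back to \<open>nat \<Rightarrow>\<^sub>0 nat\<close> by interleaving the
variables.\<close>
lemma constructible_monoid_product:
  fixes ty :: "'k::field itself"
  assumes "constructible_monoid ty M d1" "constructible_monoid ty N d2"
  shows "constructible_monoid ty (M \<times> N) (\<lambda>x. d1 (fst x) + d2 (snd x))"
    and "constructible_monoid ty {x \<in> M \<times> N. d1 (fst x) = d2 (snd x)} (\<lambda>x. d1 (fst x))"
proof -
  obtain M' :: "(nat \<Rightarrow>\<^sub>0 nat) set" and d1' \<phi> where M':
    "standard_graded_monoid M' d1'" "graded_iso \<phi> M' d1' M d1"
    "constructible (monoid_algebra M' d1' :: ('k, (nat, 'k) mpoly) galg)"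
    using assms(1) unfolding constructible_monoid_def by blast
  obtain N' :: "(nat \<Rightarrow>\<^sub>0 nat) set" and d2' \<psi> where N':
    "standard_graded_monoid N' d2'" "graded_iso \<psi> N' d2' N d2"
    "constructible (monoid_algebra N' d2' :: ('k, (nat, 'k) mpoly) galg)"
    using assms(2) unfolding constructible_monoid_def by blast
  interpret two_graded_monoids M' d1' N' d2' ty
    by (intro two_graded_monoids.intro M' N')
  note inter = graded_iso_image[OF inj_interleave interleave_add]
  let ?P = "M' \<times> N'" and ?dP = "\<lambda>x. d1' (fst x) + d2' (snd x)"
  have stdP: "standard_graded_monoid ?P ?dP"
    by (rule standard_graded_product[OF M'(1) N'(1)])
  have std: "standard_graded_monoid (interleave ` ?P) (?dP \<circ> inv_into UNIV interleave)"
    by (rule standard_graded_monoid.graded_iso_standard[OF stdP inter(1)])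
  have "(monoid_algebra (interleave ` ?P) (?dP \<circ> inv_into UNIV interleave) :: ('k, (nat, 'k) mpoly) galg) \<cong>\<^sub>g tensor_product A B"
    by (rule galg_iso_trans[OF standard_graded_monoid.monoid_algebra_iso[OF std inter(2)] monoid_algebra_tensor])
  then have "constructible (monoid_algebra (interleave ` ?P) (?dP \<circ> inv_into UNIV interleave) :: ('k, (nat, 'k) mpoly) galg)"
    by (rule constructible.tensor[OF M'(3) N'(3) standard_graded_monoid.graded_algebra_monoid_algebra[OF std]])
  then show "constructible_monoid ty (M \<times> N) (\<lambda>x. d1 (fst x) + d2 (snd x))"
    unfolding constructible_monoid_def
    using std graded_iso_trans[OF inter(2) graded_iso_product(1)[OF M'(2) N'(2)]] by blast
  let ?S = "{x \<in> M' \<times> N'. d1' (fst x) = d2' (snd x)}" and ?dS = "\<lambda>x::(nat \<Rightarrow>\<^sub>0 nat) \<times> (nat \<Rightarrow>\<^sub>0 nat). d1' (fst x)"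
  have stdS: "standard_graded_monoid ?S ?dS"
    by (rule standard_graded_fibre_product[OF M'(1) N'(1)])
  have std: "standard_graded_monoid (interleave ` ?S) (?dS \<circ> inv_into UNIV interleave)"
    by (rule standard_graded_monoid.graded_iso_standard[OF stdS inter(1)])
  have "(monoid_algebra (interleave ` ?S) (?dS \<circ> inv_into UNIV interleave) :: ('k, (nat, 'k) mpoly) galg) \<cong>\<^sub>g segre_product A B"
    by (rule galg_iso_trans[OF standard_graded_monoid.monoid_algebra_iso[OF std inter(2)] monoid_algebra_segre])
  then have "constructible (monoid_algebra (interleave ` ?S) (?dS \<circ> inv_into UNIV interleave) :: ('k, (nat, 'k) mpoly) galg)"
    by (rule constructible.segre[OF M'(3) N'(3) standard_graded_monoid.graded_algebra_monoid_algebra[OF std]])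
  then show "constructible_monoid ty {x \<in> M \<times> N. d1 (fst x) = d2 (snd x)} (\<lambda>x. d1 (fst x))"
    unfolding constructible_monoid_def
    using std graded_iso_trans[OF inter(2) graded_iso_product(2)[OF M'(2) N'(2)]] by blast
qed

lemma standard_graded_nat: "standard_graded_monoid (UNIV :: nat set) (\<lambda>j. j)"
proof
  show "\<exists>s\<in>UNIV. \<exists>r\<in>UNIV. s = 1 \<and> a = s + r" if "a \<noteq> 0" for a :: nat
    using that by (intro bexI[of _ 1] bexI[of _ "a - 1"]) auto
qed auto

text \<open>The algebra of the natural numbers is the polynomial ring in one variable.\<close>
lemma constructible_monoid_nat:
  fixes ty :: "'k::field itself"
  shows "constructible_monoid ty (UNIV :: nat set) (\<lambda>j. j)"
proof -
  let ?M = "{m :: nat \<Rightarrow>\<^sub>0 nat. keys m \<subseteq> {..<1}}"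
  let ?d = "\<lambda>m :: nat \<Rightarrow>\<^sub>0 nat. \<Sum>v\<in>keys m. lookup m v"
  have iso: "graded_iso (single 0) (UNIV :: nat set) (\<lambda>j. j) ?M ?d"
    unfolding graded_iso_def
  proof (intro conjI ballI)
    show "bij_betw (single 0) UNIV ?M"
      unfolding bij_betw_def
    proof (intro conjI equalityI subsetI)
      show "inj (single (0::nat) :: nat \<Rightarrow> _)" by (rule inj_single)
      fix m :: "nat \<Rightarrow>\<^sub>0 nat" assume "m \<in> ?M"
      then have "m = single 0 (lookup m 0)"
        by (intro poly_mapping_eqI) (auto simp: lookup_single when_def in_keys_iff)
      then show "m \<in> range (single 0)" by blast
    next
      fix m :: "nat \<Rightarrow>\<^sub>0 nat" assume "m \<in> range (single 0)"
      then obtain n where "m = single 0 n" by blast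
      then show "m \<in> ?M" by simp
    qed
  qed (auto simp: single_add)
  interpret N: standard_graded_monoid "UNIV :: nat set" "\<lambda>j. j" by (rule standard_graded_nat)
  have std: "standard_graded_monoid ?M ?d" by (rule N.graded_iso_standard[OF iso])
  have "monoid_algebra ?M ?d = (poly_ring {..<1} :: ('k, (nat, 'k) mpoly) galg)"
    unfolding monoid_algebra_def poly_ring_def by (simp only: subset_eq mem_Collect_eq)
  then have "(monoid_algebra ?M ?d :: ('k, (nat, 'k) mpoly) galg) \<cong>\<^sub>g
      (poly_ring {..<1} :: ('k, (nat, 'k) mpoly) galg)"
    by (rule ssubst) (rule galg_iso_refl)
  then have "constructible (monoid_algebra ?M ?d :: ('k, (nat, 'k) mpoly) galg)"
    by (rule constructible.polynomial[OF standard_graded_monoid.graded_algebra_monoid_algebra[OF std]])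
  then show ?thesis
    unfolding constructible_monoid_def
    by (intro exI conjI) (rule std, rule N.graded_iso_inverse[OF iso])
qed

lemma trivial_algebra_monoid_algebra:
  assumes "standard_graded_monoid M d" "constructible_monoid TYPE('k::field) M d"
  shows "trivial_algebra (monoid_algebra M d :: ('k, 'm::cancel_comm_monoid_add \<Rightarrow>\<^sub>0 'k) galg)"
proof -
  interpret standard_graded_monoid M d by fact
  obtain M' :: "(nat \<Rightarrow>\<^sub>0 nat) set" and d' \<phi> where M':
    "standard_graded_monoid M' d'" "graded_iso \<phi> M' d' M d"
    "constructible (monoid_algebra M' d' :: ('k, (nat, 'k) mpoly) galg)"
    using assms(2) unfolding constructible_monoid_def by blast
  have "(monoid_algebra M d :: ('k, 'm \<Rightarrow>\<^sub>0 'k) galg) \<cong>\<^sub>g monoid_algebra M' d'"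
    by (rule monoid_algebra_iso[OF standard_graded_monoid.graded_iso_inverse[OF M'(1,2)]])
  then show ?thesis
    unfolding trivial_algebra_def using graded_algebra_monoid_algebra M'(3) by blast
qed

section \<open>Strong Koszulness of products\<close>
lemma koszul_monoidD:
  assumes "koszul_monoid M d" "u \<in> M" "v \<in> M" "w \<in> M" "w' \<in> M" "d u = 1" "d v = 1" "w \<noteq> 0" "v + w = u + w'"
  shows "\<exists>s\<in>M. \<exists>r\<in>M. \<exists>t\<in>M. d s = 1 \<and> w = s + r \<and> v + s = u + t"
  using assms unfolding koszul_monoid_def by blast

lemma koszul_monoid_iso:
  assumes "standard_graded_monoid M d" "koszul_monoid M d" "graded_iso \<phi> M d N d'"
  shows "koszul_monoid N d'"
  unfolding koszul_monoid_def
proof (intro ballI impI, elim conjE)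
  interpret standard_graded_monoid M d by fact
  have N: "N = \<phi> ` M" and inj: "inj_on \<phi> M" and add: "\<And>a b. a \<in> M \<Longrightarrow> b \<in> M \<Longrightarrow> \<phi> (a + b) = \<phi> a + \<phi> b"
    and d: "\<And>a. a \<in> M \<Longrightarrow> d' (\<phi> a) = d a"
    using assms(3) by (auto simp: graded_iso_def bij_betw_def)
  fix u v w w' assume "u \<in> N" "v \<in> N" "w \<in> N" "w' \<in> N"
  then obtain a b c c' where abc: "a \<in> M" "b \<in> M" "c \<in> M" "c' \<in> M"
    "u = \<phi> a" "v = \<phi> b" "w = \<phi> c" "w' = \<phi> c'" unfolding N by blast
  assume *: "d' u = 1" "d' v = 1" "w \<noteq> 0" "v + w = u + w'"
  have "\<phi> (b + c) = \<phi> (a + c')" using * abc by (simp add: add)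
  then have eq: "b + c = a + c'"
    by (rule inj_onD[OF inj]) (use abc in \<open>simp_all add: add_mem\<close>)
  have "c \<noteq> 0" using *(3) abc(7) graded_iso_zero[OF assms(3)] by auto
  moreover have "d a = 1" "d b = 1" using * abc d by auto
  ultimately obtain s r t where s: "s \<in> M" "r \<in> M" "t \<in> M" "d s = 1" "c = s + r" "b + s = a + t"
    using koszul_monoidD[OF assms(2) abc(1-4) _ _ _ eq] by blast
  have "\<phi> b + \<phi> s = \<phi> (b + s)" by (rule add[OF abc(2) s(1), symmetric])
  also have "\<dots> = \<phi> a + \<phi> t" unfolding s(6) by (rule add[OF abc(1) s(3)])
  finally have t: "v + \<phi> s = u + \<phi> t" using abc by simp
  show "\<exists>s\<in>N. \<exists>r\<in>N. \<exists>t\<in>N. d' s = 1 \<and> w = s + r \<and> v + s = u + t"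
  proof (intro bexI conjI)
    show "w = \<phi> s + \<phi> r" unfolding abc(7) s(5) by (rule add[OF s(1,2)])
    show "v + \<phi> s = u + \<phi> t" by (rule t)
  qed (use s d N in auto)
qed

lemma koszul_monoid_nat: "koszul_monoid (UNIV :: nat set) (\<lambda>j. j)"
  unfolding koszul_monoid_def
proof (intro ballI impI, elim conjE)
  fix u v w w' :: nat assume "u = 1" "v = 1" "w \<noteq> 0"
  then show "\<exists>s\<in>UNIV. \<exists>r\<in>UNIV. \<exists>t\<in>UNIV. s = 1 \<and> w = s + r \<and> v + s = u + t"
    by (intro bexI[of _ 1] bexI[of _ "w - 1"]) auto
qed

lemma (in standard_graded_monoid) degree_one_sum:
  assumes "a \<in> M" "b \<in> M" "dg u = 1" "dg a = 1" "u = a + b"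
  shows "b = 0"
  using assms deg_add[of a b] deg_eq_0[of b] by simp

text \<open>An element of degree 1 of a product has a component 0.  If \<open>u\<close> and \<open>v\<close> lie in the same factor, the
condition of that factor applies; if they lie in different factors, then \<open>u\<close> itself divides \<open>w\<close>
and can be taken for \<open>s\<close>.\<close>
lemma koszul_monoid_product:
  assumes M: "standard_graded_monoid M d1" "koszul_monoid M d1"
    and N: "standard_graded_monoid N d2" "koszul_monoid N d2"
  shows "koszul_monoid (M \<times> N) (\<lambda>x. d1 (fst x) + d2 (snd x))"
  unfolding koszul_monoid_def
proof (intro ballI impI, elim conjE)
  interpret X: standard_graded_monoid M d1 by fact
  interpret Y: standard_graded_monoid N d2 by fact
  interpret XY: standard_graded_monoid "M \<times> N" "\<lambda>x. d1 (fst x) + d2 (snd x)"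
    by (rule standard_graded_product[OF M(1) N(1)])
  fix u v w w' assume mem: "u \<in> M \<times> N" "v \<in> M \<times> N" "w \<in> M \<times> N" "w' \<in> M \<times> N"
    and du: "d1 (fst u) + d2 (snd u) = 1" and dv: "d1 (fst v) + d2 (snd v) = 1"
    and w: "w \<noteq> 0" and eq: "v + w = u + w'"
  have split: "(d1 (fst x) = 1 \<and> snd x = 0) \<or> (fst x = 0 \<and> d2 (snd x) = 1)"
    if "x \<in> M \<times> N" "d1 (fst x) + d2 (snd x) = 1" for x
    using that X.deg_eq_0[of "fst x"] Y.deg_eq_0[of "snd x"] by (auto simp: mem_Times_iff add_is_1)
  have eqs: "fst v + fst w = fst u + fst w'" "snd v + snd w = snd u + snd w'"
    using arg_cong[OF eq, of fst] arg_cong[OF eq, of snd] by simp_all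
  have M_mem: "fst u \<in> M" "fst v \<in> M" "fst w \<in> M" "fst w' \<in> M"
    and N_mem: "snd u \<in> N" "snd v \<in> N" "snd w \<in> N" "snd w' \<in> N"
    using mem by (auto simp: mem_Times_iff)
  show "\<exists>s\<in>M \<times> N. \<exists>r\<in>M \<times> N. \<exists>t\<in>M \<times> N. d1 (fst s) + d2 (snd s) = 1 \<and> w = s + r \<and> v + s = u + t"
  proof (cases "u = v")
    case True
    then show ?thesis using XY.split_deg_1[OF mem(3) w] by blast
  next
    case False
    consider (left) "d1 (fst u) = 1" "snd u = 0" "d1 (fst v) = 1" "snd v = 0"
      | (right) "fst u = 0" "d2 (snd u) = 1" "fst v = 0" "d2 (snd v) = 1"
      | (lr) "snd u = 0" "fst v = 0" | (rl) "fst u = 0" "snd v = 0"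
      using split[OF mem(1) du] split[OF mem(2) dv] by blast
    then show ?thesis
    proof cases
      case left
      have "fst w \<noteq> 0"
      proof
        assume "fst w = 0"
        then have *: "fst v = fst u + fst w'" using eqs by simp
        then have "fst w' = 0" using X.degree_one_sum[OF M_mem(1,4) left(3,1)] by simp
        then show False using False left * by (simp add: prod_eq_iff)
      qed
      then obtain s r t where "s \<in> M" "r \<in> M" "t \<in> M" "d1 s = 1" "fst w = s + r" "fst v + s = fst u + t"
        using koszul_monoidD[OF M(2) M_mem left(1,3) _ eqs(1)] by blast
      then show ?thesis using N_mem Y.zero_mem left
        by (intro bexI[of _ "(s, 0)"] bexI[of _ "(r, snd w)"] bexI[of _ "(t, 0)"])
          (auto simp: prod_eq_iff)
    next
      case right
      have "snd w \<noteq> 0"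
      proof
        assume "snd w = 0"
        then have *: "snd v = snd u + snd w'" using eqs by simp
        then have "snd w' = 0" using Y.degree_one_sum[OF N_mem(1,4) right(4,2)] by simp
        then show False using False right * by (simp add: prod_eq_iff)
      qed
      then obtain s r t where "s \<in> N" "r \<in> N" "t \<in> N" "d2 s = 1" "snd w = s + r" "snd v + s = snd u + t"
        using koszul_monoidD[OF N(2) N_mem right(2,4) _ eqs(2)] by blast
      then show ?thesis using M_mem X.zero_mem right
        by (intro bexI[of _ "(0, s)"] bexI[of _ "(fst w, r)"] bexI[of _ "(0, t)"])
          (auto simp: prod_eq_iff)
    next
      case lr
      then show ?thesis using mem(1,2) M_mem N_mem du eqs
        by (intro bexI[of _ u] bexI[of _ "(fst w', snd w)"] bexI[of _ v])
          (auto simp: prod_eq_iff add.commute)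
    next
      case rl
      then show ?thesis using mem(1,2) M_mem N_mem du eqs
        by (intro bexI[of _ u] bexI[of _ "(fst w, snd w')"] bexI[of _ v])
          (auto simp: prod_eq_iff add.commute)
    qed
  qed
qed

text \<open>Apply the conditions of the two factors to the two components.  Both components of \<open>w\<close> have the
same positive degree, and the components found have degree 1, so they match up to elements of
the fibre product.  One component of \<open>u\<close> may agree with that of \<open>v\<close> although \<open>u \<noteq> v\<close>; then any
divisor of degree 1 of that component of \<open>w\<close> serves.\<close>
lemma koszul_monoid_fibre_product:
  assumes M: "standard_graded_monoid M d1" "koszul_monoid M d1"
    and N: "standard_graded_monoid N d2" "koszul_monoid N d2"
  shows "koszul_monoid {x \<in> M \<times> N. d1 (fst x) = d2 (snd x)} (\<lambda>x. d1 (fst x))"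
    (is "koszul_monoid ?S _")
  unfolding koszul_monoid_def
proof (intro ballI impI, elim conjE)
  interpret X: standard_graded_monoid M d1 by fact
  interpret Y: standard_graded_monoid N d2 by fact
  fix u v w w' assume mem: "u \<in> ?S" "v \<in> ?S" "w \<in> ?S" "w' \<in> ?S"
    and du: "d1 (fst u) = 1" and dv: "d1 (fst v) = 1"
    and w: "w \<noteq> 0" and eq: "v + w = u + w'"
  have M_mem: "fst u \<in> M" "fst v \<in> M" "fst w \<in> M" "fst w' \<in> M"
    and N_mem: "snd u \<in> N" "snd v \<in> N" "snd w \<in> N" "snd w' \<in> N"
    and degs: "d2 (snd u) = 1" "d2 (snd v) = 1" "d1 (fst w) = d2 (snd w)"
    using mem du dv by (auto simp: mem_Times_iff)
  have eqs: "fst v + fst w = fst u + fst w'" "snd v + snd w = snd u + snd w'"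
    using arg_cong[OF eq, of fst] arg_cong[OF eq, of snd] by simp_all
  have nz: "fst w \<noteq> 0" "snd w \<noteq> 0"
    using w degs(3) X.deg_eq_0[OF M_mem(3)] Y.deg_eq_0[OF N_mem(3)] by (auto simp: prod_eq_iff)
  obtain s r t where s: "s \<in> M" "r \<in> M" "t \<in> M" "d1 s = 1" "fst w = s + r" "fst v + s = fst u + t"
    using koszul_monoidD[OF M(2) M_mem du dv nz(1) eqs(1)] by blast
  obtain s' r' t' where s': "s' \<in> N" "r' \<in> N" "t' \<in> N" "d2 s' = 1" "snd w = s' + r'" "snd v + s' = snd u + t'"
    using koszul_monoidD[OF N(2) N_mem degs(1,2) nz(2) eqs(2)] by blast
  have "d1 r = d2 r'" using degs(3) s s' by (simp add: X.deg_add Y.deg_add)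
  moreover have "d1 t = 1"
    using arg_cong[OF s(6), of d1] s(1-4) M_mem du dv by (simp add: X.deg_add)
  moreover have "d2 t' = 1"
    using arg_cong[OF s'(6), of d2] s'(1-4) N_mem degs by (simp add: Y.deg_add)
  ultimately show "\<exists>s\<in>?S. \<exists>r\<in>?S. \<exists>t\<in>?S. d1 (fst s) = 1 \<and> w = s + r \<and> v + s = u + t"
    using s s' by (intro bexI[of _ "(s, s')"] bexI[of _ "(r, r')"] bexI[of _ "(t, t')"])
      (auto simp: prod_eq_iff)
qed

section \<open>Trivially perfect graphs\<close>

text \<open>An induced path (if \<open>{a, d}\<close> is not an edge) or an induced cycle (otherwise) on four vertices.
The conditions force \<open>a \<noteq> d\<close>.\<close>
definition has_obstruction :: "'v sgraph \<Rightarrow> bool" where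
  "has_obstruction G \<longleftrightarrow> (\<exists>a b c d. {a, b} \<in> edges G \<and> {b, c} \<in> edges G \<and> {c, d} \<in> edges G \<and>
     {a, c} \<notin> edges G \<and> {b, d} \<notin> edges G \<and> a \<noteq> c \<and> b \<noteq> d)"

lemma no_loop: "finite_simple_graph G \<Longrightarrow> {a} \<notin> edges G"
  unfolding finite_simple_graph_def by force

lemma edge_neq: "\<lbrakk>finite_simple_graph G; {a, b} \<in> edges G\<rbrakk> \<Longrightarrow> a \<noteq> b"
  using no_loop[of G a] by auto

lemma edge_vertices: "\<lbrakk>finite_simple_graph G; {a, b} \<in> edges G\<rbrakk> \<Longrightarrow> a \<in> vertices G \<and> b \<in> vertices G"
  unfolding finite_simple_graph_def by auto

definition neighbours :: "'v sgraph \<Rightarrow> 'v set \<Rightarrow> 'v \<Rightarrow> 'v set" where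
  "neighbours G W x = {y \<in> W. {x, y} \<in> edges G}"

text \<open>If \<open>z\<close> has a neighbour \<open>y\<close> outside the closed neighbourhood of \<open>x\<close>, then every other neighbour
\<open>t\<close> of \<open>x\<close> is a neighbour of \<open>z\<close>, as otherwise \<open>t\<close>, \<open>x\<close>, \<open>z\<close>, \<open>y\<close> would be an obstruction.
Hence \<open>z\<close> has more neighbours than \<open>x\<close>.\<close>
lemma neighbourhoods_nested:
  assumes G: "finite_simple_graph G" "\<not> has_obstruction G" and W: "finite W" "x \<in> W" "z \<in> W"
    and xz: "{x, z} \<in> edges G" and card: "card (neighbours G W z) \<le> card (neighbours G W x)"
  shows "neighbours G W z \<subseteq> insert x (neighbours G W x)"
proof (rule ccontr)
  assume "\<not> ?thesis"
  then obtain y where y: "y \<in> W" "{z, y} \<in> edges G" "y \<noteq> x" "{x, y} \<notin> edges G"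
    by (auto simp: neighbours_def)
  have zx: "{z, x} \<in> edges G" using xz by (simp add: insert_commute)
  have sub: "neighbours G W x - {z} \<subseteq> neighbours G W z"
  proof
    fix t assume t: "t \<in> neighbours G W x - {z}"
    then have tx: "{t, x} \<in> edges G" by (simp add: neighbours_def insert_commute)
    have "{t, z} \<in> edges G"
    proof (rule ccontr)
      assume "{t, z} \<notin> edges G"
      then have "has_obstruction G"
        unfolding has_obstruction_def
        by (intro exI[of _ t] exI[of _ x] exI[of _ z] exI[of _ y]) (use tx xz y t in auto)
      then show False using G(2) by blast
    qed
    then show "t \<in> neighbours G W z" using t by (simp add: neighbours_def insert_commute)
  qed
  have fin: "finite (neighbours G W z)" "finite (neighbours G W x)" using W(1) by (auto simp: neighbours_def)
  \<comment> \<open>from the neighbours of \<open>x\<close> to those of \<open>z\<close>, only \<open>z\<close> is lost, and \<open>x\<close> and \<open>y\<close> are gained\<close>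
  have "insert x (insert y (neighbours G W x - {z})) \<subseteq> neighbours G W z"
    using sub y zx W(2) by (simp add: neighbours_def)
  then have "card (insert x (insert y (neighbours G W x - {z}))) \<le> card (neighbours G W z)"
    by (rule card_mono[OF fin(1)])
  moreover have "x \<notin> insert y (neighbours G W x - {z})" "y \<notin> neighbours G W x - {z}"
    using y no_loop[OF G(1), of x] by (auto simp: neighbours_def)
  then have "card (insert x (insert y (neighbours G W x - {z}))) = Suc (Suc (card (neighbours G W x - {z})))"
    using fin by simp
  moreover have "z \<in> neighbours G W x" using W(3) xz by (simp add: neighbours_def)
  then have "card (neighbours G W x) = Suc (card (neighbours G W x - {z}))"
    by (rule card.remove[OF fin(2)])
  ultimately show False using card by linarith
qed

text \<open>Let \<open>x\<close> have the largest number of neighbours.  By nestedness no vertex of its closed neighbourhood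
has a neighbour outside it, so this neighbourhood is everything or splits off.\<close>
lemma universal_or_disconnected:
  assumes G: "finite_simple_graph G" "\<not> has_obstruction G" and W: "finite W" "W \<noteq> {}"
  obtains (universal) x where "x \<in> W" "\<And>y. y \<in> W \<Longrightarrow> y \<noteq> x \<Longrightarrow> {x, y} \<in> edges G"
    | (disconnected) V1 V2 where "W = V1 \<union> V2" "V1 \<inter> V2 = {}" "V1 \<noteq> {}" "V2 \<noteq> {}"
      "\<And>i j. i \<in> V1 \<Longrightarrow> j \<in> V2 \<Longrightarrow> {i, j} \<notin> edges G"
proof -
  have fin: "finite ((\<lambda>z. card (neighbours G W z)) ` W)" using W(1) by simp
  have "Max ((\<lambda>z. card (neighbours G W z)) ` W) \<in> (\<lambda>z. card (neighbours G W z)) ` W"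
    using W by (intro Max_in) auto
  then obtain x where x: "x \<in> W" "card (neighbours G W x) = Max ((\<lambda>z. card (neighbours G W z)) ` W)" by auto
  have max: "card (neighbours G W z) \<le> card (neighbours G W x)" if "z \<in> W" for z
    unfolding x(2) using fin that by simp
  define V1 where "V1 = insert x (neighbours G W x)"
  have sub: "V1 \<subseteq> W" using x by (auto simp: V1_def neighbours_def)
  have sep: "{i, j} \<notin> edges G" if ij: "i \<in> V1" "j \<in> W - V1" for i j
  proof
    assume e: "{i, j} \<in> edges G"
    then have "i \<noteq> x" using ij by (auto simp: V1_def neighbours_def)
    then have i: "i \<in> W" "{x, i} \<in> edges G" using ij by (auto simp: V1_def neighbours_def)
    have "j \<in> neighbours G W i" using e ij by (simp add: neighbours_def)
    then show False
      using neighbourhoods_nested[OF G W(1) x(1) i max[OF i(1)]] ij by (auto simp: V1_def)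
  qed
  show thesis
  proof (cases "W - V1 = {}")
    case True
    then have "W = V1" using sub by blast
    then show thesis using x by (intro universal[of x]) (auto simp: V1_def neighbours_def)
  next
    case False
    show thesis
    proof (rule disconnected[of V1 "W - V1"])
      show "V1 \<noteq> {}" by (simp add: V1_def)
    qed (use sub False sep in blast)+
  qed
qed

lemma stable_induced: "stable (induced G W) S \<longleftrightarrow> S \<subseteq> W \<and> (\<forall>i\<in>S. \<forall>j\<in>S. {i, j} \<notin> edges G)"
  unfolding stable_def induced_def by auto

lemma clique_induced:
  "clique (induced G W) C \<longleftrightarrow> C \<subseteq> W \<and> (\<forall>i\<in>C. \<forall>j\<in>C. i \<noteq> j \<longrightarrow> {i, j} \<in> edges G)"
  unfolding clique_def induced_def by auto

lemma clique_extends_to_maximal: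
  assumes "finite (vertices H)" "clique H C"
  shows "\<exists>D. maximal_clique H D \<and> C \<subseteq> D"
proof -
  let ?X = "{D. clique H D \<and> C \<subseteq> D}"
  have "finite ?X"
    by (rule finite_subset[of _ "Pow (vertices H)"]) (auto simp: clique_def assms(1))
  moreover have "?X \<noteq> {}" using assms(2) by blast
  ultimately obtain D where "D \<in> ?X" "\<forall>E\<in>?X. D \<subseteq> E \<longrightarrow> D = E"
    using finite_has_maximal[of ?X] by blast
  then show ?thesis unfolding maximal_clique_def by blast
qed

text \<open>Distinct vertices of a stable set lie in distinct maximal cliques.\<close>
lemma stable_card_le_cliques:
  assumes fin: "finite (vertices H)" and S: "stable H S"
  shows "card S \<le> num_maximal_cliques H"
proof -
  have "\<exists>D. maximal_clique H D \<and> s \<in> D" if "s \<in> S" for s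
  proof -
    have "clique H {s}" using S that by (auto simp: clique_def stable_def)
    then show ?thesis using clique_extends_to_maximal[OF fin] by blast
  qed
  then obtain K where K: "\<And>s. s \<in> S \<Longrightarrow> maximal_clique H (K s)" "\<And>s. s \<in> S \<Longrightarrow> s \<in> K s"
    by metis
  have "inj_on K S"
  proof (rule inj_onI, rule ccontr)
    fix s t assume st: "s \<in> S" "t \<in> S" "K s = K t" "s \<noteq> t"
    then have "{s, t} \<in> edges H"
      using K(1)[of s] K(2)[of s] K(2)[of t] by (auto simp: maximal_clique_def clique_def)
    then show False using S st by (auto simp: stable_def)
  qed
  moreover have "finite {C. maximal_clique H C}"
    by (rule finite_subset[of _ "Pow (vertices H)"]) (auto simp: maximal_clique_def clique_def fin)
  moreover have "K ` S \<subseteq> {C. maximal_clique H C}" using K(1) by blast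
  ultimately show ?thesis
    unfolding num_maximal_cliques_def by (intro card_inj_on_le[of K])
qed

text \<open>A vertex \<open>v\<close> of \<open>C\<close> with the fewest neighbours lies in no other maximal clique: another one would
contain a neighbour \<open>d\<close> of \<open>v\<close> that some \<open>c\<close> in \<open>C\<close> misses, although the neighbours of \<open>v\<close> are
nested in those of \<open>c\<close>.\<close>
lemma private_vertex:
  assumes G: "finite_simple_graph G" "\<not> has_obstruction G" and W: "finite W" "W \<noteq> {}"
    and C: "maximal_clique (induced G W) C"
  shows "\<exists>v\<in>C. \<forall>D. maximal_clique (induced G W) D \<and> v \<in> D \<longrightarrow> D = C"
proof -
  have cl: "C \<subseteq> W" "\<And>i j. i \<in> C \<Longrightarrow> j \<in> C \<Longrightarrow> i \<noteq> j \<Longrightarrow> {i, j} \<in> edges G"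
    using C unfolding maximal_clique_def clique_induced by blast+
  have "C \<noteq> {}"
  proof
    assume "C = {}"
    obtain x where "x \<in> W" using W by blast
    then have "clique (induced G W) {x}" by (simp add: clique_induced)
    then show False using C \<open>C = {}\<close> unfolding maximal_clique_def by blast
  qed
  have finC: "finite C" using cl(1) W(1) by (rule finite_subset)
  have "Min ((\<lambda>z. card (neighbours G W z)) ` C) \<in> (\<lambda>z. card (neighbours G W z)) ` C"
    using finC \<open>C \<noteq> {}\<close> by (intro Min_in) auto
  then obtain v where v: "v \<in> C" "card (neighbours G W v) = Min ((\<lambda>z. card (neighbours G W z)) ` C)" by auto
  have min: "card (neighbours G W v) \<le> card (neighbours G W z)" if "z \<in> C" for z
    unfolding v(2) using finC that by simp
  have "D = C" if D: "maximal_clique (induced G W) D" "v \<in> D" for D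
  proof (rule ccontr)
    assume "D \<noteq> C"
    then obtain d where d: "d \<in> D" "d \<notin> C" using C D unfolding maximal_clique_def by blast
    have cD: "D \<subseteq> W" "\<And>i j. i \<in> D \<Longrightarrow> j \<in> D \<Longrightarrow> i \<noteq> j \<Longrightarrow> {i, j} \<in> edges G"
      using D(1) unfolding maximal_clique_def clique_induced by blast+
    have "\<exists>c\<in>C. {c, d} \<notin> edges G"
    proof (rule ccontr)
      assume *: "\<not> ?thesis"
      have "clique (induced G W) (insert d C)"
        unfolding clique_induced
      proof (intro conjI ballI impI)
        show "insert d C \<subseteq> W" using cl(1) cD(1) d by blast
        fix i j assume "i \<in> insert d C" "j \<in> insert d C" "i \<noteq> j"
        then consider "i = d" "j \<in> C" | "j = d" "i \<in> C" | "i \<in> C" "j \<in> C" by blast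
        then show "{i, j} \<in> edges G"
        proof cases
          case 1
          then show ?thesis using * insert_commute[of d j "{}"] by auto
        next
          case 2
          then show ?thesis using * by blast
        next
          case 3
          then show ?thesis using cl(2) \<open>i \<noteq> j\<close> by blast
        qed
      qed
      then show False using C d unfolding maximal_clique_def by blast
    qed
    then obtain c where c: "c \<in> C" "{c, d} \<notin> edges G" by blast
    have vd: "{v, d} \<in> edges G" using cD(2)[of v d] D(2) d v(1) by blast
    then have "c \<noteq> v" using c by blast
    then have cv: "{c, v} \<in> edges G" using cl(2) c v by blast
    have "d \<in> neighbours G W v" using vd d cD by (auto simp: neighbours_def)
    moreover have "neighbours G W v \<subseteq> insert c (neighbours G W c)"
      using neighbourhoods_nested[OF G W(1) _ _ cv min[OF c(1)]] c v cl by blast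
    ultimately show False using c d by (auto simp: neighbours_def)
  qed
  then show ?thesis using v(1) by blast
qed

lemma finite_stable_sets: "finite (vertices H) \<Longrightarrow> finite {S. stable H S}"
  by (rule finite_subset[of _ "Pow (vertices H)"]) (auto simp: stable_def)

text \<open>Private vertices of distinct maximal cliques are not adjacent, since an edge would lie in a common
maximal clique.  They form a stable set with as many elements as there are maximal cliques.\<close>
lemma trivially_perfect_if_no_obstruction:
  assumes G: "finite_simple_graph G" "\<not> has_obstruction G"
  shows "trivially_perfect G"
  unfolding trivially_perfect_def
proof (intro allI impI, elim conjE)
  fix W assume W: "W \<subseteq> vertices G" "W \<noteq> {}"
  let ?H = "induced G W"
  have finW: "finite W" using W(1) G(1) unfolding finite_simple_graph_def by (blast intro: finite_subset)
  then have fin: "finite (vertices ?H)" by (simp add: induced_def)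
  have finS: "finite (card ` {S. stable ?H S})" using finite_stable_sets[OF fin] by simp
  have "stable ?H {}" by (simp add: stable_induced)
  then have ne: "card ` {S. stable ?H S} \<noteq> {}" by blast
  show "stability_number ?H = num_maximal_cliques ?H"
  proof (rule antisym)
    show "stability_number ?H \<le> num_maximal_cliques ?H"
      unfolding stability_number_def Max_le_iff[OF finS ne]
      using stable_card_le_cliques[OF fin] by blast
    obtain p where p: "\<And>C. maximal_clique ?H C \<Longrightarrow> p C \<in> C"
      "\<And>C D. maximal_clique ?H C \<Longrightarrow> maximal_clique ?H D \<Longrightarrow> p C \<in> D \<Longrightarrow> D = C"
      using private_vertex[OF G finW W(2)] by metis
    let ?P = "p ` {C. maximal_clique ?H C}"
    have inj: "inj_on p {C. maximal_clique ?H C}"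
    proof (rule inj_onI)
      fix C D assume "C \<in> {C. maximal_clique ?H C}" "D \<in> {C. maximal_clique ?H C}" "p C = p D"
      then show "C = D" using p(1)[of C] p(2)[of D C] by simp
    qed
    have PW: "p C \<in> W" if "maximal_clique ?H C" for C
      using p(1)[OF that] that by (auto simp: maximal_clique_def clique_induced)
    have stab: "stable ?H ?P"
      unfolding stable_induced
    proof (intro conjI ballI notI)
      show "?P \<subseteq> W" using PW by blast
      fix i j assume "i \<in> ?P" "j \<in> ?P" and e: "{i, j} \<in> edges G"
      then obtain C D where CD: "maximal_clique ?H C" "i = p C" "maximal_clique ?H D" "j = p D" by blast
      have "clique ?H {i, j}" using e PW CD by (auto simp: clique_induced insert_commute)
      then obtain E where E: "maximal_clique ?H E" "{i, j} \<subseteq> E" using clique_extends_to_maximal[OF fin] by blast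
      then have "E = C" "E = D" using p(2)[OF CD(1) E(1)] p(2)[OF CD(3) E(1)] CD by auto
      then show False using CD e edge_neq[OF G(1)] by blast
    qed
    have "num_maximal_cliques ?H = card ?P"
      unfolding num_maximal_cliques_def using card_image[OF inj] by simp
    also have "\<dots> \<le> stability_number ?H"
      unfolding stability_number_def using stab finS by (intro Max_ge) auto
    finally show "num_maximal_cliques ?H \<le> stability_number ?H" .
  qed
qed

lemma edge_maximal_clique:
  assumes "x \<in> W" "y \<in> W" and xy: "{x, y} \<in> edges G"
    and sep: "\<And>z. z \<in> W \<Longrightarrow> z \<noteq> x \<Longrightarrow> z \<noteq> y \<Longrightarrow> {x, z} \<notin> edges G \<or> {y, z} \<notin> edges G"
  shows "maximal_clique (induced G W) {x, y}"
  unfolding maximal_clique_def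
proof (intro conjI allI impI)
  have yx: "{y, x} \<in> edges G" using xy by (simp only: insert_commute)
  show "clique (induced G W) {x, y}"
    unfolding clique_induced using assms(1,2) xy yx by auto
  fix D assume "clique (induced G W) D \<and> {x, y} \<subseteq> D"
  then have D: "D \<subseteq> W" "\<And>i j. i \<in> D \<Longrightarrow> j \<in> D \<Longrightarrow> i \<noteq> j \<Longrightarrow> {i, j} \<in> edges G" "x \<in> D" "y \<in> D"
    unfolding clique_induced by auto
  have "D \<subseteq> {x, y}"
  proof (rule subsetI, rule ccontr)
    fix z assume z: "z \<in> D" "z \<notin> {x, y}"
    then have "{x, z} \<in> edges G" "{y, z} \<in> edges G" using D(2)[of x z] D(2)[of y z] D(3,4) by auto
    then show False using sep[of z] D(1) z by auto
  qed
  then show "D = {x, y}" using D(3,4) by blast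
qed

text \<open>On the four vertices of an obstruction the three edges of the path are maximal cliques, while a
stable set has at most one vertex from each of \<open>{a, b}\<close> and \<open>{c, d}\<close>.\<close>
lemma no_obstruction_if_trivially_perfect:
  assumes G: "finite_simple_graph G" "trivially_perfect G"
  shows "\<not> has_obstruction G"
proof
  assume "has_obstruction G"
  then obtain a b c d where e: "{a, b} \<in> edges G" "{b, c} \<in> edges G" "{c, d} \<in> edges G"
    and n: "{a, c} \<notin> edges G" "{b, d} \<notin> edges G" "a \<noteq> c" "b \<noteq> d"
    unfolding has_obstruction_def by blast
  have dist: "a \<noteq> b" "b \<noteq> c" "c \<noteq> d" using e edge_neq[OF G(1)] by blast+
  have "a \<noteq> d" using e(1) n(2) insert_commute[of a b "{}"] by auto
  let ?W = "{a, b, c, d}" let ?H = "induced G ?W"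
  have W: "?W \<subseteq> vertices G"
    using edge_vertices[OF G(1) e(1)] edge_vertices[OF G(1) e(3)] by simp
  have fin: "finite (vertices ?H)" by (simp add: induced_def)
  have card2: "card S \<le> 2" if S: "stable ?H S" for S
  proof -
    have "S \<subseteq> ?W" "\<not> (a \<in> S \<and> b \<in> S)" "\<not> (c \<in> S \<and> d \<in> S)"
      using S e unfolding stable_induced by blast+
    then have "S \<subseteq> {a, c} \<or> S \<subseteq> {a, d} \<or> S \<subseteq> {b, c} \<or> S \<subseteq> {b, d}" by blast
    moreover have "card S \<le> 2" if "S \<subseteq> {x, y}" for x y
      using card_mono[OF _ that] card_insert_le_m1[of 2 "{y}" x] by simp
    ultimately show ?thesis by blast
  qed
  have finS: "finite (card ` {S. stable ?H S})" using finite_stable_sets[OF fin] by simp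
  have "stable ?H {}" by (simp add: stable_induced)
  then have ne: "card ` {S. stable ?H S} \<noteq> {}" by blast
  have "stability_number ?H \<le> 2"
    unfolding stability_number_def Max_le_iff[OF finS ne] using card2 by blast
  note clq = edge_maximal_clique[where G = G and W = ?W]
  have n': "{c, a} \<notin> edges G" "{d, b} \<notin> edges G"
    using n insert_commute[of c a "{}"] insert_commute[of d b "{}"] by auto
  have "maximal_clique ?H {a, b}" by (rule clq) (use e n in auto)
  moreover have "maximal_clique ?H {b, c}" by (rule clq) (use e n n' in auto)
  moreover have "maximal_clique ?H {c, d}" by (rule clq) (use e n' in auto)
  ultimately have "{{a, b}, {b, c}, {c, d}} \<subseteq> {C. maximal_clique ?H C}" by simp
  moreover have "finite {C. maximal_clique ?H C}"
    by (rule finite_subset[of _ "Pow ?W"]) (auto simp: maximal_clique_def clique_induced)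
  ultimately have "card {{a, b}, {b, c}, {c, d}} \<le> num_maximal_cliques ?H"
    unfolding num_maximal_cliques_def by (intro card_mono)
  moreover have "card {{a, b}, {b, c}, {c, d}} = 3"
    using n dist \<open>a \<noteq> d\<close> by (auto simp: doubleton_eq_iff)
  moreover have "stability_number ?H = num_maximal_cliques ?H"
    using G(2) W unfolding trivially_perfect_def by blast
  ultimately show False using \<open>stability_number ?H \<le> 2\<close> by simp
qed

section \<open>The monoid of stable sets\<close>

definition stable_exponent :: "'n::finite set \<Rightarrow> 'n option \<Rightarrow>\<^sub>0 nat" where
  "stable_exponent S = single None 1 + (\<Sum>i\<in>S. single (Some i) 1)"

lemma lookup_stable_exponent [simp]:
  "lookup (stable_exponent S) None = 1"
  "lookup (stable_exponent S) (Some i) = (if i \<in> S then 1 else 0)"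
  by (simp_all add: stable_exponent_def lookup_add lookup_sum lookup_single when_def)

text \<open>The exponent vectors of the monomials of the toric ring of the subgraph induced on \<open>W\<close>.  All these
monoids share the variables of the whole graph, so that they can be compared.\<close>
inductive_set stable_monoid :: "'n::finite sgraph \<Rightarrow> 'n set \<Rightarrow> ('n option \<Rightarrow>\<^sub>0 nat) set"
  for G W where
  zero: "0 \<in> stable_monoid G W"
| add: "\<lbrakk>stable G S; S \<subseteq> W; m \<in> stable_monoid G W\<rbrakk> \<Longrightarrow> stable_exponent S + m \<in> stable_monoid G W"

abbreviation T_degree :: "('n::finite option \<Rightarrow>\<^sub>0 nat) \<Rightarrow> nat" where
  "T_degree m \<equiv> lookup m None"

lemma stable_monoid_generator:
  "stable G S \<Longrightarrow> S \<subseteq> W \<Longrightarrow> stable_exponent S \<in> stable_monoid G W"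
  using stable_monoid.add[OF _ _ stable_monoid.zero] by fastforce

lemma stable_monoid_add:
  "\<lbrakk>a \<in> stable_monoid G W; b \<in> stable_monoid G W\<rbrakk> \<Longrightarrow> a + b \<in> stable_monoid G W"
  by (induct rule: stable_monoid.induct) (simp_all add: add.assoc stable_monoid.add)

lemma stable_monoid_mono: "V \<subseteq> W \<Longrightarrow> stable_monoid G V \<subseteq> stable_monoid G W"
proof
  fix m assume "V \<subseteq> W" "m \<in> stable_monoid G V"
  from this(2,1) show "m \<in> stable_monoid G W"
    by (induct rule: stable_monoid.induct) (auto intro: stable_monoid.intros)
qed

lemma stable_monoid_support:
  "m \<in> stable_monoid G W \<Longrightarrow> i \<notin> W \<Longrightarrow> lookup m (Some i) = 0"
  by (induct rule: stable_monoid.induct) (auto simp: lookup_add)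

lemma stable_monoid_cases:
  assumes "m \<in> stable_monoid G W" "T_degree m \<noteq> 0"
  obtains S m' where "stable G S" "S \<subseteq> W" "m' \<in> stable_monoid G W" "m = stable_exponent S + m'"
  using assms by cases auto

lemma stable_monoid_deg_0: "m \<in> stable_monoid G W \<Longrightarrow> T_degree m = 0 \<Longrightarrow> m = 0"
  by (erule stable_monoid.cases) (auto simp: lookup_add)

lemma standard_graded_stable_monoid: "standard_graded_monoid (stable_monoid G W) T_degree"
proof
  show "\<exists>s\<in>stable_monoid G W. \<exists>r\<in>stable_monoid G W. T_degree s = 1 \<and> a = s + r"
    if "a \<in> stable_monoid G W" "a \<noteq> 0" for a
  proof -
    have "T_degree a \<noteq> 0" using that stable_monoid_deg_0 by blast
    with that(1) obtain S m where "stable G S" "S \<subseteq> W" "m \<in> stable_monoid G W" "a = stable_exponent S + m"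
      by (rule stable_monoid_cases)
    then show ?thesis using stable_monoid_generator[of G S W]
      by (intro bexI[of _ "stable_exponent S"] bexI[of _ m]) simp_all
  qed
qed (simp_all add: stable_monoid.zero stable_monoid_add lookup_add stable_monoid_deg_0)

lemma stable_monoid_degree_one:
  "{u \<in> stable_monoid G W. T_degree u = 1} = stable_exponent ` {S. stable G S \<and> S \<subseteq> W}"
proof (intro equalityI subsetI)
  fix u assume "u \<in> {u \<in> stable_monoid G W. T_degree u = 1}"
  then have u: "u \<in> stable_monoid G W" "T_degree u = 1" by auto
  then obtain S m where S: "stable G S" "S \<subseteq> W" "m \<in> stable_monoid G W" "u = stable_exponent S + m"
    by (auto elim: stable_monoid_cases)
  then have "m = 0" using u(2) stable_monoid_deg_0[OF S(3)] by (simp add: lookup_add)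
  then show "u \<in> stable_exponent ` {S. stable G S \<and> S \<subseteq> W}" using S by auto
qed (auto intro: stable_monoid_generator)

lemma stable_monoid_empty:
  fixes G :: "'n::finite sgraph"
  shows "graded_iso (single None) (UNIV :: nat set) (\<lambda>j. j) (stable_monoid G {}) T_degree"
  unfolding graded_iso_def bij_betw_def
proof (intro conjI ballI equalityI subsetI)
  show "inj (single (None :: 'n option) :: nat \<Rightarrow> _)" by (rule inj_single)
  have exp: "stable_exponent {} = (single None 1 :: 'n option \<Rightarrow>\<^sub>0 nat)" by (simp add: stable_exponent_def)
  fix m :: "'n option \<Rightarrow>\<^sub>0 nat" assume "m \<in> range (single None)"
  then obtain j where j: "m = single None j" by blast
  have "single None j \<in> stable_monoid G {}" for j
  proof (induct j)
    case 0
    show ?case using stable_monoid.zero by simp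
  next
    case (Suc j)
    have "stable G {}" by (simp add: stable_def)
    from stable_monoid.add[OF this _ Suc] show ?case unfolding exp by (simp flip: single_add)
  qed
  then show "m \<in> stable_monoid G {}" using j by simp
next
  fix m assume m: "m \<in> stable_monoid G {}"
  have "m = single None (T_degree m)"
  proof (rule poly_mapping_eqI)
    fix k show "lookup m k = lookup (single None (T_degree m)) k"
      using stable_monoid_support[OF m] by (cases k) (simp_all add: lookup_single)
  qed
  then show "m \<in> range (single None)" by blast
qed (simp_all add: single_add)

text \<open>A vertex \<open>x\<close> adjacent to all others is contained in no stable set but \<open>{x}\<close>.  The generator of
\<open>{x}\<close>, whose \<open>j\<close>-th power has the exponents \<open>j\<close> at \<open>T\<close> and at \<open>x\<close>, is therefore a free variable.\<close>
lemma stable_monoid_cone: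
  assumes G: "finite_simple_graph G" and x: "x \<in> vertices G" "x \<notin> V"
    and univ: "\<And>y. y \<in> V \<Longrightarrow> {x, y} \<in> edges G"
  shows "graded_iso (\<lambda>z. fst z + (single None (snd z) + single (Some x) (snd z)))
    (stable_monoid G V \<times> (UNIV :: nat set)) (\<lambda>z. T_degree (fst z) + snd z)
    (stable_monoid G (insert x V)) T_degree"
    (is "graded_iso ?\<phi> ?P _ ?M _")
  unfolding graded_iso_def bij_betw_def
proof (intro conjI ballI equalityI subsetI)
  have lookup_x: "lookup (?\<phi> z) (Some x) = snd z" if "z \<in> ?P" for z
    using that stable_monoid_support[of "fst z" G V x] x by (auto simp: lookup_add lookup_single)
  show "inj_on ?\<phi> ?P"
  proof (rule inj_onI)
    fix z z' assume z: "z \<in> ?P" "z' \<in> ?P" "?\<phi> z = ?\<phi> z'"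
    then have "snd z = snd z'" using lookup_x by metis
    then show "z = z'" using z(3) by (simp add: prod_eq_iff)
  qed
  have stx: "stable G {x}" using x no_loop[OF G, of x] by (simp add: stable_def)
  have exp: "stable_exponent {x} + (single None j + single (Some x) j) = single None (Suc j) + single (Some x) (Suc j)" for j
    by (rule poly_mapping_eqI) (simp add: stable_exponent_def lookup_add lookup_single when_def)
  have power: "single None j + single (Some x) j \<in> ?M" for j
  proof (induct j)
    case 0
    show ?case using stable_monoid.zero by simp
  next
    case (Suc j)
    from stable_monoid.add[OF stx _ Suc] show ?case unfolding exp by simp
  qed
  show "m \<in> ?M" if m: "m \<in> ?\<phi> ` ?P" for m
  proof -
    obtain z where z: "z \<in> ?P" "m = ?\<phi> z" using m by blast
    then have "fst z \<in> ?M" using stable_monoid_mono[OF subset_insertI[of V x], of G] by auto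
    then show ?thesis unfolding z(2) by (intro stable_monoid_add power)
  qed
  show "m \<in> ?\<phi> ` ?P" if "m \<in> ?M" for m
    using that
  proof (induct rule: stable_monoid.induct)
    case zero
    show ?case by (intro image_eqI[of _ _ "(0, 0)"]) (auto simp: stable_monoid.zero)
  next
    case (add S m)
    then obtain m' j where m: "m' \<in> stable_monoid G V" "m = m' + (single None j + single (Some x) j)" by auto
    show ?case
    proof (cases "x \<in> S")
      case True
      have "S = {x}"
      proof (rule ccontr)
        assume "S \<noteq> {x}"
        then obtain y where "y \<in> S" "y \<noteq> x" using True by blast
        then show False using add(1,2) True univ unfolding stable_def by blast
      qed
      then have "stable_exponent S + m = m' + (stable_exponent {x} + (single None j + single (Some x) j))"
        by (simp add: m(2) add_ac)
      then have "stable_exponent S + m = ?\<phi> (m', Suc j)" unfolding exp by simp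
      then show ?thesis using m(1) by blast
    next
      case False
      then have "stable_exponent S + m' \<in> stable_monoid G V" using add(1,2) m(1) by (intro stable_monoid.add) auto
      moreover have "stable_exponent S + m = ?\<phi> (stable_exponent S + m', j)" by (simp add: m(2) add_ac)
      ultimately show ?thesis by blast
    qed
  qed
  show "?\<phi> (a + b) = ?\<phi> a + ?\<phi> b" for a b by (simp add: single_add add_ac)
  show "T_degree (?\<phi> z) = T_degree (fst z) + snd z" for z by (simp add: lookup_add lookup_single)
qed

text \<open>Pairs of exponent vectors with the same exponent of \<open>T\<close> are glued by adding them, with that
exponent counted only once.\<close>
definition forget_T :: "('n::finite option \<Rightarrow>\<^sub>0 nat) \<Rightarrow> 'n option \<Rightarrow>\<^sub>0 nat" where
  "forget_T m = Poly_Mapping.update None 0 m"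

lemma lookup_forget_T [simp]:
  "lookup (forget_T m) None = 0" "lookup (forget_T m) (Some i) = lookup m (Some i)"
  by (simp_all add: forget_T_def lookup_update)

lemma forget_T_simps: "forget_T 0 = 0" "forget_T (a + b) = forget_T a + forget_T b"
proof -
  show "forget_T (0 :: 'a option \<Rightarrow>\<^sub>0 nat) = 0"
    by (rule poly_mapping_eqI) (metis lookup_forget_T lookup_zero option.exhaust)
  show "forget_T (a + b) = forget_T a + forget_T b"
  proof (rule poly_mapping_eqI)
    fix k show "lookup (forget_T (a + b)) k = lookup (forget_T a + forget_T b) k"
      by (cases k) (simp_all add: lookup_add)
  qed
qed

lemma stable_exponent_Un:
  assumes "S1 \<inter> S2 = {}"
  shows "stable_exponent S1 + forget_T (stable_exponent S2) = stable_exponent (S1 \<union> S2)"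
proof (rule poly_mapping_eqI)
  fix k show "lookup (stable_exponent S1 + forget_T (stable_exponent S2)) k = lookup (stable_exponent (S1 \<union> S2)) k"
    using assms by (cases k) (auto simp: lookup_add)
qed

text \<open>Without edges between \<open>V1\<close> and \<open>V2\<close>, a stable set of the union is a pair of stable sets.  A product of
\<open>d\<close> generators for \<open>V1\<close> and one of \<open>d\<close> generators for \<open>V2\<close> can be paired off factor by factor, hence
the fibre product.\<close>
lemma stable_monoid_union:
  assumes disj: "V1 \<inter> V2 = {}" and sep: "\<And>i j. i \<in> V1 \<Longrightarrow> j \<in> V2 \<Longrightarrow> {i, j} \<notin> edges G"
  shows "graded_iso (\<lambda>z. fst z + forget_T (snd z))
    {z \<in> stable_monoid G V1 \<times> stable_monoid G V2. T_degree (fst z) = T_degree (snd z)} (\<lambda>z. T_degree (fst z))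
    (stable_monoid G (V1 \<union> V2)) T_degree"
    (is "graded_iso ?\<phi> ?P _ ?M _")
  unfolding graded_iso_def bij_betw_def
proof (intro conjI ballI equalityI subsetI)
  show "inj_on ?\<phi> ?P"
  proof (rule inj_onI)
    fix z z' assume z: "z \<in> ?P" "z' \<in> ?P" and eq: "?\<phi> z = ?\<phi> z'"
    have memz: "fst z \<in> stable_monoid G V1" "snd z \<in> stable_monoid G V2" "T_degree (fst z) = T_degree (snd z)"
      using z(1) by auto
    have memz': "fst z' \<in> stable_monoid G V1" "snd z' \<in> stable_monoid G V2" "T_degree (fst z') = T_degree (snd z')"
      using z(2) by auto
    have lk: "lookup (fst z) k + lookup (forget_T (snd z)) k = lookup (fst z') k + lookup (forget_T (snd z')) k" for k
      using arg_cong[OF eq, of "\<lambda>p. lookup p k"] by (simp add: lookup_add)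
    have T: "T_degree (fst z) = T_degree (fst z')" using lk[of None] by simp
    have "fst z = fst z'"
    proof (rule poly_mapping_eqI)
      fix k show "lookup (fst z) k = lookup (fst z') k"
      proof (cases k)
        case None
        then show ?thesis using T by simp
      next
        case (Some i)
        show ?thesis
        proof (cases "i \<in> V1")
          case True
          then have "i \<notin> V2" using disj by blast
          then show ?thesis
            using lk[of k] stable_monoid_support[OF memz(2)] stable_monoid_support[OF memz'(2)] by (simp add: Some)
        next
          case False
          then show ?thesis
            using stable_monoid_support[OF memz(1)] stable_monoid_support[OF memz'(1)] by (simp add: Some)
        qed
      qed
    qed
    moreover have "snd z = snd z'"
    proof (rule poly_mapping_eqI)
      fix k show "lookup (snd z) k = lookup (snd z') k"
        using lk[of k] T memz(3) memz'(3) \<open>fst z = fst z'\<close> by (cases k) simp_all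
    qed
    ultimately show "z = z'" by (rule prod_eqI)
  qed
  have into: "m1 + forget_T m2 \<in> ?M"
    if "m1 \<in> stable_monoid G V1" "m2 \<in> stable_monoid G V2" "T_degree m1 = T_degree m2" for m1 m2
    using that
  proof (induct arbitrary: m2 rule: stable_monoid.induct)
    case zero
    then have "m2 = 0" using stable_monoid_deg_0[of m2] by simp
    then show ?case by (simp add: forget_T_simps stable_monoid.zero)
  next
    case (add S1 m1)
    then have "T_degree m2 \<noteq> 0" by (simp add: lookup_add)
    with add(5) obtain S2 m2' where S2: "stable G S2" "S2 \<subseteq> V2" "m2' \<in> stable_monoid G V2" "m2 = stable_exponent S2 + m2'"
      by (rule stable_monoid_cases)
    have "T_degree m1 = T_degree m2'" using add(6) S2(4) by (simp add: lookup_add)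
    then have IH: "m1 + forget_T m2' \<in> ?M" using add(4) S2(3) by blast
    have "S1 \<inter> S2 = {}" using add(2) S2(2) disj by blast
    then have "stable_exponent S1 + m1 + forget_T m2 = stable_exponent (S1 \<union> S2) + (m1 + forget_T m2')"
      by (simp add: S2(4) forget_T_simps add_ac flip: stable_exponent_Un)
    moreover have "stable G (S1 \<union> S2)"
      unfolding stable_def
    proof (intro conjI ballI)
      show "S1 \<union> S2 \<subseteq> vertices G" using add(1) S2(1) by (simp add: stable_def)
      fix i j assume "i \<in> S1 \<union> S2" "j \<in> S1 \<union> S2"
      then consider "i \<in> S1" "j \<in> S1" | "i \<in> S2" "j \<in> S2" | "i \<in> V1" "j \<in> V2" | "i \<in> V2" "j \<in> V1"
        using add(2) S2(2) by blast
      then show "{i, j} \<notin> edges G"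
      proof cases
        case 4
        then show ?thesis using sep[of j i] by (simp add: insert_commute)
      qed (use add(1) S2(1) sep in \<open>auto simp: stable_def\<close>)
    qed
    ultimately show ?case using stable_monoid.add[OF _ _ IH] add(2) S2(2) by auto
  qed
  show "m \<in> ?M" if m: "m \<in> ?\<phi> ` ?P" for m using m into by auto
  show "m \<in> ?\<phi> ` ?P" if "m \<in> ?M" for m
    using that
  proof (induct rule: stable_monoid.induct)
    case zero
    show ?case by (intro image_eqI[of _ _ "(0, 0)"]) (auto simp: forget_T_simps stable_monoid.zero)
  next
    case (add S m)
    then obtain m1 m2 where m: "m1 \<in> stable_monoid G V1" "m2 \<in> stable_monoid G V2" "T_degree m1 = T_degree m2"
      "m = m1 + forget_T m2" by auto
    let ?z = "(stable_exponent (S \<inter> V1) + m1, stable_exponent (S \<inter> V2) + m2)"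
    have st: "stable G (S \<inter> U)" for U using add(1) by (auto simp: stable_def)
    have z: "?z \<in> ?P" using m(1-3) st by (simp add: stable_monoid.add lookup_add)
    have "S = S \<inter> V1 \<union> S \<inter> V2" "(S \<inter> V1) \<inter> (S \<inter> V2) = {}" using add(2) disj by blast+
    then have "stable_exponent S = stable_exponent (S \<inter> V1) + forget_T (stable_exponent (S \<inter> V2))"
      using stable_exponent_Un[of "S \<inter> V1" "S \<inter> V2"] by simp
    then have "stable_exponent S + m = ?\<phi> ?z" by (simp add: m(4) forget_T_simps add_ac)
    then show ?case using z by (rule image_eqI)
  qed
  show "?\<phi> (a + b) = ?\<phi> a + ?\<phi> b" for a b by (simp add: forget_T_simps add_ac)
  show "T_degree (?\<phi> z) = T_degree (fst z)" for z by (simp add: lookup_add)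
qed

text \<open>Induction along the decomposition of the graph: a universal vertex contributes a tensor product with
a polynomial ring in one variable, a disconnection a Segre product, and both operations preserve
the two properties.\<close>
lemma stable_monoid_trivial:
  assumes G: "finite_simple_graph G" "\<not> has_obstruction G" and W: "finite W" "W \<subseteq> vertices G"
  shows "koszul_monoid (stable_monoid G W) T_degree \<and>
    constructible_monoid TYPE('k::field) (stable_monoid G W) T_degree"
  using W
proof (induct W rule: finite_psubset_induct)
  case (psubset W)
  note std = standard_graded_stable_monoid
  show ?case
  proof (cases "W = {}")
    case True
    show ?thesis
      unfolding True
      using koszul_monoid_iso[OF standard_graded_nat koszul_monoid_nat stable_monoid_empty]
        constructible_monoid_iso[OF constructible_monoid_nat stable_monoid_empty] by blast
  next
    case False
    from G psubset(1) False show ?thesis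
    proof (cases rule: universal_or_disconnected)
      case (universal x)
      let ?V = "W - {x}"
      have IH: "koszul_monoid (stable_monoid G ?V) T_degree"
        "constructible_monoid TYPE('k) (stable_monoid G ?V) T_degree"
        using psubset(2)[of ?V] psubset(3) universal(1) by blast+
      have iso: "graded_iso (\<lambda>z. fst z + (single None (snd z) + single (Some x) (snd z)))
          (stable_monoid G ?V \<times> (UNIV :: nat set)) (\<lambda>z. T_degree (fst z) + snd z) (stable_monoid G W) T_degree"
        using stable_monoid_cone[OF G(1), of x ?V] universal psubset(3) by (auto simp: insert_absorb)
      show ?thesis
        using koszul_monoid_iso[OF standard_graded_product[OF std standard_graded_nat]
            koszul_monoid_product[OF std IH(1) standard_graded_nat koszul_monoid_nat] iso]
          constructible_monoid_iso[OF constructible_monoid_product(1)[OF IH(2) constructible_monoid_nat] iso]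
        by blast
    next
      case (disconnected V1 V2)
      have sub: "V1 \<subset> W" "V2 \<subset> W" using disconnected(1-4) by blast+
      have IH1: "koszul_monoid (stable_monoid G V1) T_degree"
        "constructible_monoid TYPE('k) (stable_monoid G V1) T_degree"
        using psubset(2)[OF sub(1)] psubset(3) sub by blast+
      have IH2: "koszul_monoid (stable_monoid G V2) T_degree"
        "constructible_monoid TYPE('k) (stable_monoid G V2) T_degree"
        using psubset(2)[OF sub(2)] psubset(3) sub by blast+
      note iso = stable_monoid_union[OF disconnected(2,5), folded disconnected(1)]
      show ?thesis
        using koszul_monoid_iso[OF standard_graded_fibre_product[OF std std]
            koszul_monoid_fibre_product[OF std IH1(1) std IH2(1)] iso]
          constructible_monoid_iso[OF constructible_monoid_product(2)[OF IH1(2) IH2(2)] iso]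
        by blast
    qed
  qed
qed

lemma stable_exponent_add_eqD:
  assumes "stable_exponent A + stable_exponent B = stable_exponent C + stable_exponent D"
  shows "A \<union> B = C \<union> D"
proof (rule Set.set_eqI)
  fix i
  have "lookup (stable_exponent A) (Some i) + lookup (stable_exponent B) (Some i)
      = lookup (stable_exponent C) (Some i) + lookup (stable_exponent D) (Some i)"
    using arg_cong[OF assms, of "\<lambda>m. lookup m (Some i)"] by (simp only: lookup_add)
  then show "i \<in> A \<union> B \<longleftrightarrow> i \<in> C \<union> D"
    by (cases "i \<in> A"; cases "i \<in> B"; cases "i \<in> C"; cases "i \<in> D") simp_all
qed

text \<open>If \<open>w\<close> is a product of two generators, the elements \<open>s\<close>, \<open>r\<close>, \<open>t\<close> of the Koszul condition all have
degree 1, so they come from stable sets.\<close>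
lemma koszul_stable_monoidD:
  fixes G :: "'n::finite sgraph"
  assumes K: "koszul_monoid (stable_monoid G UNIV) T_degree"
    and st: "stable G U" "stable G V" "stable G A" "stable G B" "stable G C" "stable G D"
    and eq: "stable_exponent V + (stable_exponent A + stable_exponent B)
      = stable_exponent U + (stable_exponent C + stable_exponent D)"
  obtains S R T where "stable G S" "stable G R" "stable G T"
    "stable_exponent A + stable_exponent B = stable_exponent S + stable_exponent R"
    "stable_exponent V + stable_exponent S = stable_exponent U + stable_exponent T"
proof -
  let ?M = "stable_monoid G UNIV"
  note gen = stable_monoid_generator[OF _ subset_UNIV]
  have "T_degree (stable_exponent A + stable_exponent B) \<noteq> 0" by (simp add: lookup_add)
  then have nz: "stable_exponent A + stable_exponent B \<noteq> 0" by (metis lookup_zero)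
  obtain s r t where s: "s \<in> ?M" "r \<in> ?M" "t \<in> ?M" "T_degree s = 1"
    "stable_exponent A + stable_exponent B = s + r" "stable_exponent V + s = stable_exponent U + t"
    using koszul_monoidD[OF K gen[OF st(1)] gen[OF st(2)] stable_monoid_add[OF gen[OF st(3)] gen[OF st(4)]]
        stable_monoid_add[OF gen[OF st(5)] gen[OF st(6)]] _ _ nz eq] by auto
  have "T_degree r = 1" "T_degree t = 1"
    using arg_cong[OF s(5), of T_degree] arg_cong[OF s(6), of T_degree] s(4) by (simp_all add: lookup_add)
  then have "s \<in> stable_exponent ` {S. stable G S \<and> S \<subseteq> UNIV}" "r \<in> stable_exponent ` {S. stable G S \<and> S \<subseteq> UNIV}"
    "t \<in> stable_exponent ` {S. stable G S \<and> S \<subseteq> UNIV}"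
    unfolding stable_monoid_degree_one[symmetric] using s(1-4) by blast+
  then show thesis using s(5,6) that by blast
qed

text \<open>Write \<open>[S]\<close> for the generator of a stable set \<open>S\<close>.  If \<open>{a, d}\<close> is an edge, then
\<open>[b][d][ac] = [a][c][bd]\<close>, so \<open>[d][ac]\<close> lies in \<open>([a]) : [b]\<close>.  If it is not an edge, then
\<open>[ad][b][c] = [\<emptyset>][ac][bd]\<close>, so \<open>[b][c]\<close> lies in \<open>([\<emptyset>]) : [ad]\<close>.  In both cases no factor of degree 1
lies in the colon ideal, because each candidate would make some edge stable.\<close>
lemma no_obstruction_if_koszul:
  fixes G :: "'n::finite sgraph"
  assumes G: "finite_simple_graph G" and K: "koszul_monoid (stable_monoid G UNIV) T_degree"
  shows "\<not> has_obstruction G"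
proof
  assume "has_obstruction G"
  then obtain a b c d where e: "{a, b} \<in> edges G" "{b, c} \<in> edges G" "{c, d} \<in> edges G"
    and n: "{a, c} \<notin> edges G" "{b, d} \<notin> edges G" "a \<noteq> c" "b \<noteq> d"
    unfolding has_obstruction_def by blast
  have dist: "a \<noteq> b" "b \<noteq> c" "c \<noteq> d" using e edge_neq[OF G(1)] by blast+
  have ad: "a \<noteq> d" using e(1) n(2) insert_commute[of a b "{}"] by auto
  have vert: "a \<in> vertices G" "b \<in> vertices G" "c \<in> vertices G" "d \<in> vertices G"
    using e edge_vertices[OF G] by blast+
  have st1: "stable G {x}" if "x \<in> vertices G" for x
    using that no_loop[OF G, of x] by (simp add: stable_def)
  have st2: "stable G {x, y}" if "x \<in> vertices G" "y \<in> vertices G" "{x, y} \<notin> edges G" for x y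
    unfolding stable_def
  proof (intro conjI ballI)
    show "{x, y} \<subseteq> vertices G" using that by simp
    have yx: "{y, x} \<notin> edges G" using that(3) insert_commute[of x y "{}"] by simp
    fix i j assume "i \<in> {x, y}" "j \<in> {x, y}"
    then consider "i = x" "j = x" | "i = x" "j = y" | "i = y" "j = x" | "i = y" "j = y" by blast
    then show "{i, j} \<notin> edges G"
      using that(3) yx no_loop[OF G, of x] no_loop[OF G, of y] by cases simp_all
  qed
  have st0: "stable G {}" by (simp add: stable_def)
  have not_both: "x \<notin> S \<or> y \<notin> S" if "stable G S" "{x, y} \<in> edges G" for S x y
    using that unfolding stable_def by blast
  have sum3: "stable_exponent X + (stable_exponent Y + stable_exponent Z) = stable_exponent X' + (stable_exponent Y' + stable_exponent Z')"
    if "\<And>i. of_bool (i \<in> X) + (of_bool (i \<in> Y) + of_bool (i \<in> Z)) = (of_bool (i \<in> X') + (of_bool (i \<in> Y') + of_bool (i \<in> Z')) :: nat)"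
    for X Y Z X' Y' Z' :: "'n set"
  proof (rule poly_mapping_eqI)
    fix k show "lookup (stable_exponent X + (stable_exponent Y + stable_exponent Z)) k
      = lookup (stable_exponent X' + (stable_exponent Y' + stable_exponent Z')) k"
    proof (cases k)
      case (Some i)
      then show ?thesis using that[of i] by (simp add: lookup_add of_bool_def)
    qed (simp add: lookup_add)
  qed
  show False
  proof (cases "{a, d} \<in> edges G")
    case True
    have eq: "stable_exponent {b} + (stable_exponent {d} + stable_exponent {a, c})
        = stable_exponent {a} + (stable_exponent {c} + stable_exponent {b, d})"
      by (rule sum3) (use dist ad n(3,4) in \<open>simp add: of_bool_def\<close>)
    obtain S R T where S: "stable G S" "stable G R" "stable G T"
      "stable_exponent {d} + stable_exponent {a, c} = stable_exponent S + stable_exponent R"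
      "stable_exponent {b} + stable_exponent S = stable_exponent {a} + stable_exponent T"
      using koszul_stable_monoidD[OF K st1[OF vert(1)] st1[OF vert(2)] st1[OF vert(4)] st2[OF vert(1,3) n(1)]
          st1[OF vert(3)] st2[OF vert(2,4) n(2)] eq] by blast
    note w = eqset_imp_iff[OF stable_exponent_add_eqD[OF S(4)]]
      and vs = eqset_imp_iff[OF stable_exponent_add_eqD[OF S(5)]]
    have "a \<in> S" using vs[of a] dist(1) by simp
    then have "d \<in> R" using not_both[OF S(1) True] w[of d] by simp
    then have "c \<in> S" using not_both[OF S(2) e(3)] w[of c] by simp
    then have "c \<in> T" using vs[of c] n(3) by simp
    moreover have "b \<in> T" using vs[of b] dist(1) by simp
    ultimately show False using not_both[OF S(3) e(2)] by simp
  next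
    case False
    have eq: "stable_exponent {a, d} + (stable_exponent {b} + stable_exponent {c})
        = stable_exponent {} + (stable_exponent {a, c} + stable_exponent {b, d})"
      by (rule sum3) (use dist ad n(3,4) in \<open>simp add: of_bool_def\<close>)
    obtain S R T where S: "stable G S" "stable G R" "stable G T"
      "stable_exponent {b} + stable_exponent {c} = stable_exponent S + stable_exponent R"
      "stable_exponent {a, d} + stable_exponent S = stable_exponent {} + stable_exponent T"
      using koszul_stable_monoidD[OF K st0 st2[OF vert(1,4) False] st1[OF vert(2)] st1[OF vert(3)]
          st2[OF vert(1,3) n(1)] st2[OF vert(2,4) n(2)] eq] by blast
    note w = eqset_imp_iff[OF stable_exponent_add_eqD[OF S(4)]]
      and vs = eqset_imp_iff[OF stable_exponent_add_eqD[OF S(5)]]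
    have "a \<in> T" "d \<in> T" using vs[of a] vs[of d] by simp_all
    then have "b \<notin> S" "c \<notin> S"
      using vs[of b] vs[of c] not_both[OF S(3) e(1)] not_both[OF S(3) e(3)] by auto
    then have "b \<in> R" "c \<in> R" using w[of b] w[of c] by simp_all
    then show False using not_both[OF S(2) e(2)] by simp
  qed
qed

section \<open>The toric ring as a monoid algebra\<close>

lemma rho_nth: "rho S $ i = (if i \<in> S then 1 else 0)"
  by (simp add: rho_def sum_component axis_def)

text \<open>The polytope lies in the unit cube, and a point with coordinates 0 and 1 is an extreme point of the
cube.\<close>
lemma extreme_points_stable_set_polytope:
  "x extreme_point_of stable_set_polytope G \<longleftrightarrow> x \<in> rho ` {S. stable G S}"
proof
  assume "x extreme_point_of stable_set_polytope G"
  then show "x \<in> rho ` {S. stable G S}"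
    unfolding stable_set_polytope_def by (rule extreme_point_of_convex_hull)
next
  assume "x \<in> rho ` {S. stable G S}"
  then obtain S where S: "stable G S" "x = rho S" by blast
  have "convex {y :: real ^ 'a. \<forall>i. y $ i \<in> {0..1}}"
    by (auto simp: convex_def intro: convex_bound_le)
  then have box: "stable_set_polytope G \<subseteq> {y. \<forall>i. y $ i \<in> {0..1}}"
    unfolding stable_set_polytope_def by (intro hull_minimal) (auto simp: rho_nth)
  show "x extreme_point_of stable_set_polytope G"
    unfolding extreme_point_of_def
  proof (intro conjI ballI notI)
    show "x \<in> stable_set_polytope G"
      unfolding stable_set_polytope_def S(2) by (rule hull_inc) (use S in blast)
    fix y z assume yz: "y \<in> stable_set_polytope G" "z \<in> stable_set_polytope G" "x \<in> open_segment y z"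
    then obtain u where u: "y \<noteq> z" "0 < u" "u < 1" "x = (1 - u) *\<^sub>R y + u *\<^sub>R z"
      by (auto simp: in_segment)
    have "y $ i = z $ i" for i
    proof -
      have b: "0 \<le> y $ i" "y $ i \<le> 1" "0 \<le> z $ i" "z $ i \<le> 1" using box yz by auto
      have x: "x $ i = (1 - u) * y $ i + u * z $ i" by (simp add: u(4))
      show ?thesis
      proof (cases "i \<in> S")
        case True
        then have "(1 - u) * (1 - y $ i) + u * (1 - z $ i) = 0" using x S(2) by (simp add: rho_nth algebra_simps)
        moreover have "0 \<le> (1 - u) * (1 - y $ i)" "0 \<le> u * (1 - z $ i)" using u b by simp_all
        ultimately have "(1 - u) * (1 - y $ i) = 0" "u * (1 - z $ i) = 0" by linarith+
        then show ?thesis using u by simp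
      next
        case False
        then have "(1 - u) * y $ i + u * z $ i = 0" using x S(2) by (simp add: rho_nth)
        moreover have "0 \<le> (1 - u) * y $ i" "0 \<le> u * z $ i" using u b by simp_all
        ultimately have "(1 - u) * y $ i = 0" "u * z $ i = 0" by linarith+
        then show ?thesis using u by simp
      qed
    qed
    then show False using u(1) by (simp add: vec_eq_iff)
  qed
qed

lemma toric_generators_eq:
  fixes G :: "'n::finite sgraph"
  shows "(toric_generators G :: ('n option, 'k::field) mpoly set) =
    (\<lambda>u. single u 1) ` {u \<in> stable_monoid G UNIV. T_degree u = 1}"
proof -
  have "lookup m None = 1 \<and> (\<chi> i. real (lookup m (Some i))) extreme_point_of stable_set_polytope G \<longleftrightarrow>
      m \<in> stable_exponent ` {S. stable G S}" for m :: "'n option \<Rightarrow>\<^sub>0 nat"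
  proof
    assume m: "lookup m None = 1 \<and> (\<chi> i. real (lookup m (Some i))) extreme_point_of stable_set_polytope G"
    then obtain S where S: "stable G S" "(\<chi> i. real (lookup m (Some i))) = rho S"
      unfolding extreme_points_stable_set_polytope by blast
    have "lookup m (Some i) = (if i \<in> S then 1 else 0)" for i
      using arg_cong[OF S(2), of "\<lambda>x. x $ i"] by (simp add: rho_nth split: if_splits)
    then have "m = stable_exponent S"
      using m by (intro poly_mapping_eqI) (metis lookup_stable_exponent not_None_eq)
    then show "m \<in> stable_exponent ` {S. stable G S}" using S(1) by blast
  next
    assume "m \<in> stable_exponent ` {S. stable G S}"
    then obtain S where S: "stable G S" "m = stable_exponent S" by blast
    then have "(\<chi> i. real (lookup m (Some i))) = rho S" by (simp add: vec_eq_iff rho_nth)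
    then show "lookup m None = 1 \<and> (\<chi> i. real (lookup m (Some i))) extreme_point_of stable_set_polytope G"
      using S extreme_points_stable_set_polytope[of "rho S" G] by auto
  qed
  then show ?thesis
    unfolding toric_generators_def stable_monoid_degree_one by auto
qed

lemma poly_ring_UNIV: "poly_ring UNIV = monoid_algebra UNIV (\<lambda>m. \<Sum>v\<in>keys m. lookup m v)"
  by (simp add: poly_ring_def monoid_algebra_def subset_eq)

text \<open>The polynomials supported on the monoid form a ring that contains the generators, and each of their
terms is a constant times a product of generators.\<close>
lemma toric_carrier_eq:
  fixes G :: "'n::finite sgraph"
  shows "(toric_carrier G :: ('n option, 'k::field) mpoly set) = {p. keys p \<subseteq> stable_monoid G UNIV}"
proof -
  let ?M = "stable_monoid G UNIV"
  let ?H = "{single 0 c |c. True} \<union> toric_generators G :: ('n option, 'k) mpoly set"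
  interpret S: standard_graded_monoid ?M T_degree by (rule standard_graded_stable_monoid)
  show ?thesis
    unfolding toric_carrier_def poly_ring_UNIV
  proof (intro equalityI subsetI)
    fix p :: "('n option, 'k) mpoly"
    assume "p \<in> generate_ring (monoid_algebra UNIV (\<lambda>m. \<Sum>v\<in>keys m. lookup m v)) ?H"
    then have "keys p \<subseteq> ?M"
    proof (induct rule: generate_ring.induct)
      case one
      then show ?case using S.zero_mem by simp
    next
      case (incl h)
      then show ?case using S.zero_mem by (auto simp: toric_generators_eq split: if_splits)
    next
      case (a_inv h)
      then show ?case by (simp add: a_inv_monoid_algebra)
    next
      case (eng_add h1 h2)
      then show ?case by (simp add: keys_add_subset)
    next
      case (eng_mult h1 h2)
      then show ?case using S.keys_mult_mem by simp
    qed
    then show "p \<in> {p. keys p \<subseteq> ?M}" by simp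
  next
    fix p :: "('n option, 'k) mpoly" assume "p \<in> {p. keys p \<subseteq> ?M}"
    then have "keys p \<subseteq> ?M" by simp
    let ?R = "generate_ring (monoid_algebra UNIV (\<lambda>m. \<Sum>v\<in>keys m. lookup m v)) ?H"
    have const: "single 0 c \<in> ?R" for c by (rule generate_ring.incl) blast
    have mono: "single m 1 \<in> ?R" if "m \<in> ?M" for m
      using that
    proof (induct rule: stable_monoid.induct)
      case zero
      show ?case by (rule const)
    next
      case (add S m)
      have "single (stable_exponent S) 1 \<in> ?H"
        using add(1) stable_monoid_generator[of G S UNIV] by (auto simp: toric_generators_eq)
      from generate_ring.eng_mult[OF generate_ring.incl[OF this] add(4)]
      show ?case by (simp add: mult_single)
    qed
    from \<open>keys p \<subseteq> ?M\<close> show "p \<in> ?R"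
    proof (induct rule: poly_mapping_induct_on)
      case zero
      show ?case using const[of 0] by simp
    next
      case (single m c)
      from generate_ring.eng_mult[OF const[of c] mono[OF single]] show ?case by (simp add: mult_single)
    next
      case (add p q)
      from generate_ring.eng_add[OF add(3,4)] show ?case by simp
    qed
  qed
qed

lemma toric_ring_eq: "toric_ring G = monoid_algebra (stable_monoid G UNIV) T_degree"
  by (auto simp: toric_ring_def poly_ring_def monoid_algebra_def toric_carrier_eq subset_eq intro!: ext)

theorem theorem1p3:
  fixes G :: "'n::finite sgraph"
    and us :: "('n option, 'k::field) mpoly list"
  assumes "finite_simple_graph G" and "vertices G = UNIV"
    and "distinct us" and "set us = toric_generators G"
  shows "(strongly_koszul (toric_ring G) us \<longleftrightarrow> trivially_perfect G) \<and>
         (strongly_koszul (toric_ring G) us \<longrightarrow>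
            trivial_algebra (toric_ring G :: ('k, ('n option, 'k) mpoly) galg))"
proof -
  let ?M = "stable_monoid G UNIV"
  interpret standard_graded_monoid ?M T_degree by (rule standard_graded_stable_monoid)
  have koszul: "strongly_koszul (toric_ring G) us \<longleftrightarrow> koszul_monoid ?M T_degree"
    unfolding toric_ring_eq
    by (rule strongly_koszul_monoid_algebra[OF assms(3) assms(4)[unfolded toric_generators_eq]])
  have trivial: "koszul_monoid ?M T_degree \<and> constructible_monoid TYPE('k) ?M T_degree"
    if "\<not> has_obstruction G"
    by (rule stable_monoid_trivial[OF assms(1) that]) (simp_all add: assms(2))
  show ?thesis
    unfolding koszul
  proof (intro conjI iffI impI)
    assume "koszul_monoid ?M T_degree"
    then have no: "\<not> has_obstruction G" by (rule no_obstruction_if_koszul[OF assms(1)])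
    then show "trivially_perfect G" by (rule trivially_perfect_if_no_obstruction[OF assms(1)])
    show "trivial_algebra (toric_ring G :: ('k, ('n option, 'k) mpoly) galg)"
      unfolding toric_ring_eq
      by (rule trivial_algebra_monoid_algebra[OF standard_graded_monoid_axioms conjunct2[OF trivial[OF no]]])
  next
    assume "trivially_perfect G"
    then show "koszul_monoid ?M T_degree"
      using trivial no_obstruction_if_trivially_perfect[OF assms(1)] by blast
  qed
qed

end
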